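(* Let $R$ be a unital ring and let $\mathcal{T}$ be a class of right $R$-modules. The following are equivalent: (1) There exists a silting module $T$ such that $\mathcal{T}=\mathrm{Gen}(T)$. (2) (a) $\mathcal{T}$ is a torsion class, and (b) there exists a $\mathcal{T}$-preenvelope $\epsilon:R\to M$ of the regular module $R$ which can be obtained as a pushout, i.e. there are a homomorphism $\rho:L_{-1}\to L_0$ with $\rho\in{}^\square\mathcal{T}$, a homomorphism $\delta:L_{-1}\to R$, and a commutative diagram with exact rows $$\begin{array}{ccccccc} L_{-1} & \xrightarrow{\rho} & L_0 & \to & K & \to & 0\\ \downarrow{\scriptstyle\delta} & & \downarrow & & \| & & \\ R & \xrightarrow{\epsilon} & M & \to & K & \to & 0\end{array}$$ whose left square is a pushout. (3) (a) $\mathcal{T}$ is a torsion class, and (b) for every right $R$-module $X$ there exists a $\mathcal{T}$-preenvelope $\epsilon:X\to T_0$ which can be obtained as a pushout, i.e. there are a homomorphism $\rho:L_{-1}\to L_0$ with $\rho\in{}^\square\mathcal{T}$, a homomorphism $L_{-1}\to X$, and a commutative diagram with exact rows $$\begin{array}{ccccccc} L_{-1} & \xrightarrow{\rho} & L_0 & \to & T_1 & \to & 0\\ \downarrow & & \downarrow & & \| & & \\ X & \xrightarrow{\epsilon} & T_0 & \to & T_1 & \to & 0\end{array}$$ whose left square is a pushout. Moreover, if (2) holds and a diagram as in (2) is given, then $T=M\oplus K$ is a silting module and $\mathcal{T}=\mathrm{Gen}(T)=\mathcal{D}_\rho$.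
   Context: All modules are right modules over a unital ring $R$; $\mathrm{Mod}\text{-}R$ is the category of right $R$-modules. For a module $T$, $\mathrm{Gen}(T)$ is the class of all modules that are epimorphic images of direct sums of copies of $T$. $\mathcal{P}^{\to}$ denotes the class of all homomorphisms $\sigma:P_{-1}\to P_0$ between projective modules. For $\sigma:P_{-1}\to P_0$ in $\mathcal{P}^\to$, put $\mathcal{D}_\sigma=\{X\in\mathrm{Mod}\text{-}R\mid \mathrm{Hom}_R(\sigma,X):\mathrm{Hom}_R(P_0,X)\to\mathrm{Hom}_R(P_{-1},X)\text{ is an epimorphism}\}$. For a class $\mathcal{T}$ of modules, ${}^\square\mathcal{T}=\{\alpha\in\mathcal{P}^\to\mid \mathcal{T}\subseteq\mathcal{D}_\alpha\}$. A torsion class is a class of modules closed under isomorphic images, epimorphic images, direct sums and extensions. A module $T$ is silting if there is a projective presentation $P_{-1}\xrightarrow{\sigma}P_0\to T\to 0$ (exact, with $P_{-1},P_0$ projective) such that $\mathcal{D}_\sigma$ is a torsion class, $T\in\mathcal{D}_\sigma$, and $\mathcal{D}_\sigma=\mathrm{Gen}(T)$. A homomorphism $\epsilon:X\to T$ with $T\in\mathcal{T}$ is a $\mathcal{T}$-preenvelope of $X$ if every homomorphism $X\to T'$ with $T'\in\mathcal{T}$ factors through $\epsilon$. *)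

theory Defs
  imports "HOL-Algebra.Module" "HOL-Algebra.AbelCoset" "HOL-Algebra.Product_Groups" "HOL-Library.Equipollence"
begin

section \<open>The universe of sets\<close>

text \<open>
  HOL has no proper classes.  As usual, the category of modules is therefore taken relative to a
  Grothendieck universe.  Here it is given by a type whose cardinality is uncountable and strongly
  inaccessible: sets are represented, up to bijection, by the subsets of the type of strictly
  smaller cardinality, and proper classes of modules by arbitrary sets of modules with such
  carriers.  Strong inaccessibility makes this category closed under direct sums, quotients,
  extensions, pushouts, and direct sums indexed by Hom sets.
\<close>

definition small :: "'u set \<Rightarrow> bool"
  where "small A \<longleftrightarrow> A \<prec> (UNIV :: 'u set)"

definition is_universe :: "'u itself \<Rightarrow> bool"
  where "is_universe (_ :: 'u itself) \<longleftrightarrow>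
    (UNIV :: nat set) \<prec> (UNIV :: 'u set) \<and>
    (\<forall>A :: 'u set. small A \<longrightarrow> Pow A \<prec> (UNIV :: 'u set)) \<and>
    (\<forall>(I :: 'u set) (F :: 'u \<Rightarrow> 'u set).
       small I \<and> (\<forall>i\<in>I. small (F i)) \<longrightarrow> small (\<Union>i\<in>I. F i))"

section \<open>Right modules\<close>

text \<open>
  The record of HOL-Algebra modules is reused.  Its scalar multiplication takes the scalar first,
  so \<open>a \<odot>\<^bsub>M\<^esub> x\<close> stands for the right action \<open>x a\<close>; what makes \<open>M\<close> a right module is the law
  \<open>x (a b) = (x a) b\<close>.  The fields \<open>mult\<close> and \<open>one\<close> of the record carry no meaning.
\<close>

locale right_module = R?: ring R + M?: abelian_group M
    for R :: "('r, 'm) ring_scheme" (structure) and M :: "('r, 'a, 'n) module_scheme" (structure) +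
  assumes smult_closed:
      "\<lbrakk>a \<in> carrier R; x \<in> carrier M\<rbrakk> \<Longrightarrow> a \<odot>\<^bsub>M\<^esub> x \<in> carrier M"
    and smult_l_distr:
      "\<lbrakk>a \<in> carrier R; b \<in> carrier R; x \<in> carrier M\<rbrakk>
       \<Longrightarrow> (a \<oplus>\<^bsub>R\<^esub> b) \<odot>\<^bsub>M\<^esub> x = a \<odot>\<^bsub>M\<^esub> x \<oplus>\<^bsub>M\<^esub> b \<odot>\<^bsub>M\<^esub> x"
    and smult_r_distr:
      "\<lbrakk>a \<in> carrier R; x \<in> carrier M; y \<in> carrier M\<rbrakk>
       \<Longrightarrow> a \<odot>\<^bsub>M\<^esub> (x \<oplus>\<^bsub>M\<^esub> y) = a \<odot>\<^bsub>M\<^esub> x \<oplus>\<^bsub>M\<^esub> a \<odot>\<^bsub>M\<^esub> y"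
    and smult_assoc:
      "\<lbrakk>a \<in> carrier R; b \<in> carrier R; x \<in> carrier M\<rbrakk>
       \<Longrightarrow> (a \<otimes>\<^bsub>R\<^esub> b) \<odot>\<^bsub>M\<^esub> x = b \<odot>\<^bsub>M\<^esub> (a \<odot>\<^bsub>M\<^esub> x)"
    and smult_one:
      "x \<in> carrier M \<Longrightarrow> \<one>\<^bsub>R\<^esub> \<odot>\<^bsub>M\<^esub> x = x"

definition Mods :: "('r, 'm) ring_scheme \<Rightarrow> ('r, 'u) module set"
  where "Mods R = {M. right_module R M \<and> small (carrier M)}"

definition regular_module :: "('r, 'm) ring_scheme \<Rightarrow> ('r, 'r) module"
  where "regular_module R =
    \<lparr>carrier = carrier R, monoid.mult = monoid.mult R, one = one R, zero = zero R, add = add R,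
     smult = (\<lambda>a x. x \<otimes>\<^bsub>R\<^esub> a)\<rparr>"

text \<open>
  Homomorphisms are extensional functions, so that two homomorphisms are equal as soon as they
  agree on the carrier, and composites are formed with \<^const>\<open>compose\<close>.  The two modules may
  have carriers in different types.
\<close>

definition Hom :: "('r, 'm) ring_scheme \<Rightarrow> ('r, 'a) module \<Rightarrow> ('r, 'b) module \<Rightarrow> ('a \<Rightarrow> 'b) set"
  where "Hom R M N =
    {f \<in> extensional (carrier M) \<inter> hom (add_monoid M) (add_monoid N).
       \<forall>a\<in>carrier R. \<forall>x\<in>carrier M. f (a \<odot>\<^bsub>M\<^esub> x) = a \<odot>\<^bsub>N\<^esub> f x}"

definition Epi :: "('r, 'm) ring_scheme \<Rightarrow> ('r, 'a) module \<Rightarrow> ('r, 'b) module \<Rightarrow> ('a \<Rightarrow> 'b) set"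
  where "Epi R M N = {f \<in> Hom R M N. f ` carrier M = carrier N}"

definition isomorphic :: "('r, 'm) ring_scheme \<Rightarrow> ('r, 'a) module \<Rightarrow> ('r, 'b) module \<Rightarrow> bool"
  where "isomorphic R M N \<longleftrightarrow> (\<exists>f \<in> Hom R M N. bij_betw f (carrier M) (carrier N))"

definition direct_sum :: "'i set \<Rightarrow> ('i \<Rightarrow> ('r, 'a) module) \<Rightarrow> ('r, 'i \<Rightarrow> 'a) module"
  where "direct_sum I M =
    (let S = sum_group I (\<lambda>i. add_monoid (M i)) in
      \<lparr>carrier = carrier S, monoid.mult = undefined, one = undefined, zero = one S, add = monoid.mult S,
       smult = (\<lambda>a x. \<lambda>i\<in>I. a \<odot>\<^bsub>M i\<^esub> x i)\<rparr>)"

definition direct_sum2 :: "('r, 'a) module \<Rightarrow> ('r, 'b) module \<Rightarrow> ('r, 'a \<times> 'b) module"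
  where "direct_sum2 M N =
    (let S = add_monoid M \<times>\<times> add_monoid N in
      \<lparr>carrier = carrier S, monoid.mult = undefined, one = undefined, zero = one S, add = monoid.mult S,
       smult = (\<lambda>a (x, y). (a \<odot>\<^bsub>M\<^esub> x, a \<odot>\<^bsub>N\<^esub> y))\<rparr>)"

definition right_exact ::
    "('r, 'm) ring_scheme \<Rightarrow> ('r, 'a) module \<Rightarrow> ('a \<Rightarrow> 'b) \<Rightarrow> ('r, 'b) module \<Rightarrow> ('b \<Rightarrow> 'c) \<Rightarrow>
     ('r, 'c) module \<Rightarrow> bool"  \<comment> \<open>\<open>A \<rightarrow> B \<rightarrow> C \<rightarrow> 0\<close> is exact\<close>
  where "right_exact R A f B g C \<longleftrightarrow>
    f \<in> Hom R A B \<and> g \<in> Epi R B C \<and> f ` carrier A = a_kernel B C g"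

definition short_exact ::
    "('r, 'm) ring_scheme \<Rightarrow> ('r, 'a) module \<Rightarrow> ('a \<Rightarrow> 'b) \<Rightarrow> ('r, 'b) module \<Rightarrow> ('b \<Rightarrow> 'c) \<Rightarrow>
     ('r, 'c) module \<Rightarrow> bool"
  where "short_exact R A f B g C \<longleftrightarrow> right_exact R A f B g C \<and> inj_on f (carrier A)"

definition projective :: "('r, 'm) ring_scheme \<Rightarrow> ('r, 'u) module \<Rightarrow> bool"
  where "projective R P \<longleftrightarrow>
    P \<in> Mods R \<and>
    (\<forall>A \<in> (Mods R :: ('r, 'u) module set). \<forall>B \<in> (Mods R :: ('r, 'u) module set).
       \<forall>p \<in> Epi R A B. \<forall>f \<in> Hom R P B. \<exists>g \<in> Hom R P A. f = compose (carrier P) p g)"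

text \<open>
  The pushout of \<open>f : A \<rightarrow> B\<close> and \<open>g : A \<rightarrow> C\<close>, given by \<open>i : B \<rightarrow> D\<close> and \<open>j : C \<rightarrow> D\<close>.
\<close>

definition is_pushout ::
    "('r, 'm) ring_scheme \<Rightarrow> ('r, 'u) module \<Rightarrow> ('r, 'x) module \<Rightarrow> ('r, 'u) module \<Rightarrow>
     ('r, 'u) module \<Rightarrow> ('u \<Rightarrow> 'x) \<Rightarrow> ('u \<Rightarrow> 'u) \<Rightarrow> ('x \<Rightarrow> 'u) \<Rightarrow> ('u \<Rightarrow> 'u) \<Rightarrow> bool"
  where "is_pushout R A B C D f g i j \<longleftrightarrow>
    f \<in> Hom R A B \<and> g \<in> Hom R A C \<and> i \<in> Hom R B D \<and> j \<in> Hom R C D \<and>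
    compose (carrier A) i f = compose (carrier A) j g \<and>
    (\<forall>Z \<in> (Mods R :: ('r, 'u) module set). \<forall>i' \<in> Hom R B Z. \<forall>j' \<in> Hom R C Z.
       compose (carrier A) i' f = compose (carrier A) j' g \<longrightarrow>
       (\<exists>!h. h \<in> Hom R D Z \<and> compose (carrier B) h i = i' \<and> compose (carrier C) h j = j'))"

section \<open>Silting modules\<close>

definition Gen :: "('r, 'm) ring_scheme \<Rightarrow> ('r, 'u) module \<Rightarrow> ('r, 'u) module set"
  where "Gen R T =
    {X \<in> Mods R. \<exists>I :: 'u set. small I \<and> Epi R (direct_sum I (\<lambda>_. T)) X \<noteq> {}}"

definition torsion_class :: "('r, 'm) ring_scheme \<Rightarrow> ('r, 'u) module set \<Rightarrow> bool"
  where "torsion_class R \<T> \<longleftrightarrow>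
    \<T> \<subseteq> Mods R \<and>
    (\<forall>X \<in> \<T>. \<forall>Y \<in> Mods R. isomorphic R X Y \<longrightarrow> Y \<in> \<T>) \<and>
    (\<forall>X \<in> \<T>. \<forall>Y \<in> Mods R. Epi R X Y \<noteq> {} \<longrightarrow> Y \<in> \<T>) \<and>
    (\<forall>(I :: 'u set) X. \<forall>Y \<in> Mods R.
       small I \<and> (\<forall>i\<in>I. X i \<in> \<T>) \<and> isomorphic R (direct_sum I X) Y \<longrightarrow> Y \<in> \<T>) \<and>
    (\<forall>X \<in> \<T>. \<forall>Z \<in> \<T>. \<forall>Y \<in> Mods R. (\<exists>f g. short_exact R X f Y g Z) \<longrightarrow> Y \<in> \<T>)"

text \<open>A homomorphism \<open>\<sigma> : P \<rightarrow> Q\<close> is recorded with its domain and codomain, as \<open>(P, \<sigma>, Q)\<close>.\<close>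

type_synonym ('r, 'u) arrow = "('r, 'u) module \<times> ('u \<Rightarrow> 'u) \<times> ('r, 'u) module"

definition proj_maps :: "('r, 'm) ring_scheme \<Rightarrow> ('r, 'u) arrow set"
  where "proj_maps R = {(P, \<sigma>, Q). projective R P \<and> projective R Q \<and> \<sigma> \<in> Hom R P Q}"

definition D_class :: "('r, 'm) ring_scheme \<Rightarrow> ('r, 'u) arrow \<Rightarrow> ('r, 'u) module set"
  where "D_class R = (\<lambda>(P, \<sigma>, Q).
    {X \<in> Mods R. (\<lambda>h. compose (carrier P) h \<sigma>) ` Hom R Q X = Hom R P X})"

definition box_class :: "('r, 'm) ring_scheme \<Rightarrow> ('r, 'u) module set \<Rightarrow> ('r, 'u) arrow set"
  where "box_class R \<T> = {\<alpha> \<in> proj_maps R. \<T> \<subseteq> D_class R \<alpha>}"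

definition silting :: "('r, 'm) ring_scheme \<Rightarrow> ('r, 'u) module \<Rightarrow> bool"
  where "silting R T \<longleftrightarrow>
    T \<in> Mods R \<and>
    (\<exists>P \<sigma> Q \<pi>. (P, \<sigma>, Q) \<in> proj_maps R \<and> right_exact R P \<sigma> Q \<pi> T \<and>
       torsion_class R (D_class R (P, \<sigma>, Q)) \<and>
       T \<in> D_class R (P, \<sigma>, Q) \<and>
       D_class R (P, \<sigma>, Q) = Gen R T)"

definition preenvelope ::
    "('r, 'm) ring_scheme \<Rightarrow> ('r, 'u) module set \<Rightarrow> ('r, 'x) module \<Rightarrow> ('x \<Rightarrow> 'u) \<Rightarrow>
     ('r, 'u) module \<Rightarrow> bool"
  where "preenvelope R \<T> X \<epsilon> T \<longleftrightarrow>
    T \<in> \<T> \<and> \<epsilon> \<in> Hom R X T \<and>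
    (\<forall>T' \<in> \<T>. \<forall>f \<in> Hom R X T'. \<exists>g \<in> Hom R T T'. f = compose (carrier X) g \<epsilon>)"

text \<open>
  The diagram with exact rows \<open>L\<^sub>1 \<rightarrow> L\<^sub>0 \<rightarrow> K \<rightarrow> 0\<close> (maps \<open>\<rho>\<close>, \<open>l\<close>) and \<open>X \<rightarrow> M \<rightarrow> K \<rightarrow> 0\<close>
  (maps \<open>\<epsilon>\<close>, \<open>\<kappa>\<close>), vertical maps \<open>\<delta>\<close>, \<open>\<beta>\<close> and the identity of \<open>K\<close>, and pushout left square.
  Here \<open>L\<^sub>1\<close> is the module usually written with index \<open>-1\<close>.
\<close>

definition pushout_diagram ::
    "('r, 'm) ring_scheme \<Rightarrow> ('r, 'u) module set \<Rightarrow> ('r, 'u) module \<Rightarrow> ('u \<Rightarrow> 'u) \<Rightarrow> ('r, 'u) module \<Rightarrow>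
     ('u \<Rightarrow> 'u) \<Rightarrow> ('u \<Rightarrow> 'x) \<Rightarrow> ('u \<Rightarrow> 'u) \<Rightarrow>
     ('r, 'x) module \<Rightarrow> ('x \<Rightarrow> 'u) \<Rightarrow> ('r, 'u) module \<Rightarrow> ('u \<Rightarrow> 'u) \<Rightarrow> ('r, 'u) module \<Rightarrow> bool"
  where "pushout_diagram R \<T> L\<^sub>1 \<rho> L\<^sub>0 l \<delta> \<beta> X \<epsilon> M \<kappa> K \<longleftrightarrow>
    (L\<^sub>1, \<rho>, L\<^sub>0) \<in> box_class R \<T> \<and> M \<in> Mods R \<and> K \<in> Mods R \<and>
    right_exact R L\<^sub>1 \<rho> L\<^sub>0 l K \<and>
    right_exact R X \<epsilon> M \<kappa> K \<and>
    compose (carrier L\<^sub>0) \<kappa> \<beta> = l \<and>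
    is_pushout R L\<^sub>1 X L\<^sub>0 M \<delta> \<rho> \<epsilon> \<beta>"

end

theory Submission
  imports Defs
begin

text \<open>
  Let \<open>T\<close> be silting with respect to \<open>\<sigma> : P \<rightarrow> Q\<close>, so that \<open>Gen T = D\<^sub>\<sigma>\<close>, and let \<open>X\<close> be a module. A
  preenvelope of \<open>X\<close> is obtained by a Bongartz type construction: push out the direct sum of copies of
  \<open>\<sigma>\<close>, one for each homomorphism \<open>P \<rightarrow> X\<close>, along the evaluation map to \<open>X\<close>. The cokernel of the
  resulting map \<open>X \<rightarrow> M\<close> is generated by \<open>T\<close>, and every homomorphism \<open>P \<rightarrow> X\<close> extends along \<open>\<sigma>\<close> once
  it is composed with \<open>X \<rightarrow> M\<close>; together with projectivity of \<open>P\<close> and \<open>Q\<close> this puts \<open>M\<close> into \<open>D\<^sub>\<sigma>\<close>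
  (lemma \<open>silting_pushout_preenvelope\<close>).

  Conversely, let a preenvelope \<open>\<epsilon> : R \<rightarrow> M\<close> with cokernel \<open>K\<close> arise as a pushout of \<open>\<rho>\<close>, where
  \<open>\<T> \<subseteq> D\<^sub>\<rho>\<close>. Homomorphisms \<open>R \<rightarrow> X\<close> reach every element of \<open>X\<close>, and for \<open>X\<close> in \<open>D\<^sub>\<rho>\<close> they factor through
  \<open>\<epsilon>\<close> by the pushout property, so \<open>M\<close> generates \<open>D\<^sub>\<rho>\<close>. With \<open>T = M \<oplus> K\<close> this gives
  \<open>\<T> \<subseteq> D\<^sub>\<rho> \<subseteq> Gen T \<subseteq> \<T>\<close>. The pushout square yields a projective presentation of \<open>M\<close>, and the direct
  sum of it with \<open>\<rho>\<close>, the presentation of \<open>K\<close>, has the class \<open>D\<^sub>\<rho>\<close> again, so \<open>T\<close> is silting (lemma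
  \<open>pushout_preenvelope_silting\<close>). The summand \<open>K\<close> is there for the sake of this presentation: that of \<open>M\<close>
  alone may have a larger class.

  The regular module has its carrier outside the universe type, so the second half works with an
  isomorphic copy inside; the lemmas \<open>preenvelope_transport\<close> and \<open>pushout_diagram_transport\<close> move the
  data between the two. Restriction to a universe is harmless because direct sums indexed by Hom sets stay small
  (\<open>small_function_space\<close>), and because every small module has a copy inside (\<open>copy_exists\<close>).
\<close>

section \<open>Smallness\<close>

text \<open>
The index set may live in any type: it is small, so it can be replaced by its image under an
injection into the universe, where the defining closure property of the universe applies.
\<close>

lemma small_UNION:
  assumes univ: "is_universe TYPE('u)"
    and I: "I \<prec> (UNIV :: 'u set)" and F: "\<And>i. i \<in> I \<Longrightarrow> F i \<prec> (UNIV :: 'u set)"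
  shows "(\<Union>i\<in>I. F i :: 'u set) \<prec> (UNIV :: 'u set)"
proof -
  obtain g :: "_ \<Rightarrow> 'u" where g: "inj_on g I"
    using I unfolding lesspoll_def lepoll_def by blast
  have "g ` I \<prec> (UNIV :: 'u set)" "\<And>i. i \<in> g ` I \<Longrightarrow> F (inv_into I g i) \<prec> (UNIV :: 'u set)"
    using I F g by auto
  moreover have *: "\<forall>(J :: 'u set) (G :: 'u \<Rightarrow> 'u set).
      J \<prec> (UNIV :: 'u set) \<and> (\<forall>i\<in>J. G i \<prec> (UNIV :: 'u set)) \<longrightarrow> (\<Union>i\<in>J. G i) \<prec> (UNIV :: 'u set)"
    using univ unfolding is_universe_def small_def by simp
  ultimately have "(\<Union>i\<in>g ` I. F (inv_into I g i)) \<prec> (UNIV :: 'u set)"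
    by (intro *[rule_format]) auto
  then show ?thesis using g by simp
qed

text \<open>
The universe is infinite, hence as large as its square. Coding the factors into the universe turns
\<open>A \<times> B\<close> into the union over \<open>x \<in> A\<close> of the copies \<open>{x} \<times> B\<close>, a small union of small sets.
\<close>

lemma small_Times:
  assumes univ: "is_universe TYPE('u)"
    and A: "A \<prec> (UNIV :: 'u set)" and B: "B \<prec> (UNIV :: 'u set)"
  shows "A \<times> B \<prec> (UNIV :: 'u set)"
proof -
  have "infinite (UNIV :: 'u set)"
    using univ unfolding is_universe_def infinite_le_lepoll by (blast dest: lesspoll_imp_lepoll)
  then have "(UNIV :: 'u set) \<times> (UNIV :: 'u set) \<lesssim> (UNIV :: 'u set)"
    by (intro eqpoll_imp_lepoll eqpoll_iff_card_of_ordIso[THEN iffD2] card_of_Times_same_infinite)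
  then obtain g :: "'u \<times> 'u \<Rightarrow> 'u" where g: "inj g"
    unfolding lepoll_def by auto
  obtain a :: "_ \<Rightarrow> 'u" where a: "inj_on a A" using A unfolding lesspoll_def lepoll_def by blast
  obtain b :: "_ \<Rightarrow> 'u" where b: "inj_on b B" using B unfolding lesspoll_def lepoll_def by blast
  have "inj_on (\<lambda>(x, y). g (a x, b y)) (A \<times> B)"
    using a b by (auto intro!: inj_onI dest!: injD[OF g] dest: inj_onD)
  then have "A \<times> B \<lesssim> (\<lambda>(x, y). g (a x, b y)) ` (A \<times> B)" by simp
  also have "\<dots> = (\<Union>x\<in>A. (\<lambda>y. g (a x, b y)) ` B)" by auto
  also have "\<dots> \<prec> (UNIV :: 'u set)"
    by (rule small_UNION[OF univ A]) (rule lesspoll_trans1[OF image_lepoll B])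
  finally show ?thesis .
qed

text \<open>
A function on \<open>A\<close> is determined by its graph, a subset of the small set \<open>A \<times> B\<close>, and the power set
of a small set is small. This bounds both Hom sets and the carriers of direct sums.
\<close>

lemma small_function_space:
  assumes univ: "is_universe TYPE('u)"
    and A: "A \<prec> (UNIV :: 'u set)" and B: "B \<prec> (UNIV :: 'u set)"
    and F: "F \<subseteq> extensional A \<inter> (A \<rightarrow> B)"
  shows "F \<prec> (UNIV :: 'u set)"
proof -
  have "A \<times> B \<prec> (UNIV :: 'u set)" by (rule small_Times[OF univ A B])
  then obtain g :: "_ \<Rightarrow> 'u" where g: "inj_on g (A \<times> B)"
    unfolding lesspoll_def lepoll_def by blast
  then have "g ` (A \<times> B) \<prec> (UNIV :: 'u set)"
    using \<open>A \<times> B \<prec> _\<close> by simp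
  then have *: "Pow (g ` (A \<times> B)) \<prec> (UNIV :: 'u set)"
    using univ unfolding is_universe_def small_def by blast
  have "inj_on (\<lambda>f. (\<lambda>x. g (x, f x)) ` A) F"
  proof (rule inj_onI)
    fix f f' assume f: "f \<in> F" "f' \<in> F" and eq: "(\<lambda>x. g (x, f x)) ` A = (\<lambda>x. g (x, f' x)) ` A"
    show "f = f'"
    proof (rule extensionalityI[where A = A])
      show "f \<in> extensional A" "f' \<in> extensional A" using f F by auto
      fix x assume x: "x \<in> A"
      then obtain y where y: "y \<in> A" "g (x, f x) = g (y, f' y)" using eq by blast
      have "(x, f x) = (y, f' y)"
        by (rule inj_onD[OF g y(2)]) (use y x f F in auto)
      then show "f x = f' x" by auto
    qed
  qed
  moreover have "(\<lambda>f. (\<lambda>x. g (x, f x)) ` A) ` F \<subseteq> Pow (g ` (A \<times> B))"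
    using F by auto
  ultimately have "F \<lesssim> Pow (g ` (A \<times> B))" unfolding lepoll_def by blast
  then show ?thesis using * by (rule lesspoll_trans1)
qed

section \<open>Modules and homomorphisms\<close>

lemma right_moduleI:
  assumes "ring R" "abelian_group M"
    and "\<And>a x. \<lbrakk>a \<in> carrier R; x \<in> carrier M\<rbrakk> \<Longrightarrow> a \<odot>\<^bsub>M\<^esub> x \<in> carrier M"
    and "\<And>a b x. \<lbrakk>a \<in> carrier R; b \<in> carrier R; x \<in> carrier M\<rbrakk>
       \<Longrightarrow> (a \<oplus>\<^bsub>R\<^esub> b) \<odot>\<^bsub>M\<^esub> x = a \<odot>\<^bsub>M\<^esub> x \<oplus>\<^bsub>M\<^esub> b \<odot>\<^bsub>M\<^esub> x"
    and "\<And>a x y. \<lbrakk>a \<in> carrier R; x \<in> carrier M; y \<in> carrier M\<rbrakk>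
       \<Longrightarrow> a \<odot>\<^bsub>M\<^esub> (x \<oplus>\<^bsub>M\<^esub> y) = a \<odot>\<^bsub>M\<^esub> x \<oplus>\<^bsub>M\<^esub> a \<odot>\<^bsub>M\<^esub> y"
    and "\<And>a b x. \<lbrakk>a \<in> carrier R; b \<in> carrier R; x \<in> carrier M\<rbrakk>
       \<Longrightarrow> (a \<otimes>\<^bsub>R\<^esub> b) \<odot>\<^bsub>M\<^esub> x = b \<odot>\<^bsub>M\<^esub> (a \<odot>\<^bsub>M\<^esub> x)"
    and "\<And>x. x \<in> carrier M \<Longrightarrow> \<one>\<^bsub>R\<^esub> \<odot>\<^bsub>M\<^esub> x = x"
  shows "right_module R M"
  using assms by (auto intro!: right_module.intro right_module_axioms.intro)

lemma Mods_right_module: "M \<in> Mods R \<Longrightarrow> right_module R M"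
  by (simp add: Mods_def)

lemma (in right_module) smult_r_null: "a \<in> carrier R \<Longrightarrow> a \<odot>\<^bsub>M\<^esub> \<zero>\<^bsub>M\<^esub> = \<zero>\<^bsub>M\<^esub>"
  using smult_r_distr[of a "\<zero>\<^bsub>M\<^esub>" "\<zero>\<^bsub>M\<^esub>"] smult_closed[of a "\<zero>\<^bsub>M\<^esub>"]
  by (simp add: M.add.l_cancel_one')

lemma (in right_module) smult_l_null: "x \<in> carrier M \<Longrightarrow> \<zero>\<^bsub>R\<^esub> \<odot>\<^bsub>M\<^esub> x = \<zero>\<^bsub>M\<^esub>"
  using smult_l_distr[of "\<zero>\<^bsub>R\<^esub>" "\<zero>\<^bsub>R\<^esub>" x] smult_closed[of "\<zero>\<^bsub>R\<^esub>" x]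
  by (simp add: M.add.l_cancel_one')

lemma (in right_module) smult_minus:
  assumes "a \<in> carrier R" "x \<in> carrier M" shows "a \<odot>\<^bsub>M\<^esub> (\<ominus>\<^bsub>M\<^esub> x) = \<ominus>\<^bsub>M\<^esub> (a \<odot>\<^bsub>M\<^esub> x)"
  using assms smult_r_distr[of a "\<ominus>\<^bsub>M\<^esub> x" x]
  by (intro M.minus_equality[symmetric]) (auto simp: M.l_neg smult_r_null smult_closed)

text \<open>
Negation is scalar multiplication by \<open>-1\<close>, so that submodules and homomorphisms respect it
without further axioms.
\<close>

lemma (in right_module) a_inv_eq_smult:
  assumes "x \<in> carrier M" shows "\<ominus>\<^bsub>M\<^esub> x = (\<ominus>\<^bsub>R\<^esub> \<one>\<^bsub>R\<^esub>) \<odot>\<^bsub>M\<^esub> x"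
proof (rule M.minus_equality)
  show "(\<ominus>\<^bsub>R\<^esub> \<one>\<^bsub>R\<^esub>) \<odot>\<^bsub>M\<^esub> x \<oplus>\<^bsub>M\<^esub> x = \<zero>\<^bsub>M\<^esub>"
    using smult_l_distr[of "\<ominus>\<^bsub>R\<^esub> \<one>\<^bsub>R\<^esub>" "\<one>\<^bsub>R\<^esub>" x] assms by (simp add: smult_one R.l_neg smult_l_null)
qed (use assms in \<open>auto intro: smult_closed\<close>)

lemma Hom_memI:
  assumes "f \<in> extensional (carrier M)" "\<And>x. x \<in> carrier M \<Longrightarrow> f x \<in> carrier N"
    and "\<And>x y. \<lbrakk>x \<in> carrier M; y \<in> carrier M\<rbrakk> \<Longrightarrow> f (x \<oplus>\<^bsub>M\<^esub> y) = f x \<oplus>\<^bsub>N\<^esub> f y"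
    and "\<And>a x. \<lbrakk>a \<in> carrier R; x \<in> carrier M\<rbrakk> \<Longrightarrow> f (a \<odot>\<^bsub>M\<^esub> x) = a \<odot>\<^bsub>N\<^esub> f x"
  shows "f \<in> Hom R M N"
  using assms by (auto simp: Hom_def hom_def)

lemma Hom_restrictI:
  assumes M: "right_module R M" and "\<And>x. x \<in> carrier M \<Longrightarrow> f x \<in> carrier N"
    and "\<And>x y. \<lbrakk>x \<in> carrier M; y \<in> carrier M\<rbrakk> \<Longrightarrow> f (x \<oplus>\<^bsub>M\<^esub> y) = f x \<oplus>\<^bsub>N\<^esub> f y"
    and "\<And>a x. \<lbrakk>a \<in> carrier R; x \<in> carrier M\<rbrakk> \<Longrightarrow> f (a \<odot>\<^bsub>M\<^esub> x) = a \<odot>\<^bsub>N\<^esub> f x"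
  shows "restrict f (carrier M) \<in> Hom R M N"
proof -
  interpret right_module R M by fact
  show ?thesis using assms(2-) by (intro Hom_memI) (auto simp: smult_closed)
qed

context
  fixes R :: "('r, 'm) ring_scheme" and M N f
  assumes f: "f \<in> Hom R M N"
begin

lemma Hom_extensional: "f \<in> extensional (carrier M)"
  and Hom_closed: "x \<in> carrier M \<Longrightarrow> f x \<in> carrier N"
  and Hom_add: "\<lbrakk>x \<in> carrier M; y \<in> carrier M\<rbrakk> \<Longrightarrow> f (x \<oplus>\<^bsub>M\<^esub> y) = f x \<oplus>\<^bsub>N\<^esub> f y"
  and Hom_smult: "\<lbrakk>a \<in> carrier R; x \<in> carrier M\<rbrakk> \<Longrightarrow> f (a \<odot>\<^bsub>M\<^esub> x) = a \<odot>\<^bsub>N\<^esub> f x"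
  using f by (auto simp: Hom_def hom_def)

lemma Hom_zero: assumes "right_module R M" "right_module R N" shows "f \<zero>\<^bsub>M\<^esub> = \<zero>\<^bsub>N\<^esub>"
proof -
  interpret M: right_module R M by fact
  interpret N: right_module R N by fact
  show ?thesis using Hom_add[of "\<zero>\<^bsub>M\<^esub>" "\<zero>\<^bsub>M\<^esub>"] Hom_closed[of "\<zero>\<^bsub>M\<^esub>"]
    by (simp add: N.add.l_cancel_one')
qed

lemma Hom_minus:
  assumes "right_module R M" "right_module R N" "x \<in> carrier M" "y \<in> carrier M"
  shows "f (x \<ominus>\<^bsub>M\<^esub> y) = f x \<ominus>\<^bsub>N\<^esub> f y"
proof -
  interpret M: right_module R M by fact
  interpret N: right_module R N by fact
  show ?thesis using assms(3,4)
    by (simp add: a_minus_def Hom_add M.a_inv_eq_smult N.a_inv_eq_smult Hom_closed Hom_smult M.smult_closed)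
qed

end

lemma Hom_compose:
  assumes "f \<in> Hom R M N" "g \<in> Hom R N X" "right_module R M"
  shows "compose (carrier M) g f \<in> Hom R M X"
proof -
  interpret M: right_module R M by fact
  show ?thesis
    by (rule Hom_memI)
      (auto simp: compose_def M.smult_closed Hom_closed[OF assms(1)] Hom_closed[OF assms(2)]
        Hom_add[OF assms(1)] Hom_add[OF assms(2)] Hom_smult[OF assms(1)] Hom_smult[OF assms(2)])
qed

lemma Hom_eqI:
  assumes "f \<in> Hom R M N" "g \<in> Hom R M N" "\<And>x. x \<in> carrier M \<Longrightarrow> f x = g x"
  shows "f = g"
  by (rule extensionalityI[OF Hom_extensional[OF assms(1)] Hom_extensional[OF assms(2)] assms(3)])

lemma Hom_sum:
  assumes f: "f \<in> Hom R A B" and g: "g \<in> Hom R A B" and A: "right_module R A" and B: "right_module R B"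
  shows "(\<lambda>x\<in>carrier A. f x \<oplus>\<^bsub>B\<^esub> g x) \<in> Hom R A B"
proof -
  interpret B: right_module R B by fact
  show ?thesis
    by (rule Hom_restrictI[OF A])
      (auto simp: Hom_closed[OF f] Hom_closed[OF g] Hom_add[OF f] Hom_add[OF g] Hom_smult[OF f] Hom_smult[OF g]
        B.M.a_ac B.smult_r_distr)
qed

lemma Hom_diff:
  assumes f: "f \<in> Hom R A B" and g: "g \<in> Hom R A B" and A: "right_module R A" and B: "right_module R B"
  shows "(\<lambda>x\<in>carrier A. f x \<ominus>\<^bsub>B\<^esub> g x) \<in> Hom R A B"
proof -
  interpret B: right_module R B by fact
  show ?thesis
    by (rule Hom_restrictI[OF A])
      (auto simp: a_minus_def Hom_closed[OF f] Hom_closed[OF g] Hom_add[OF f] Hom_add[OF g] Hom_smult[OF f] Hom_smult[OF g]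
        B.M.minus_add B.M.a_ac B.smult_r_distr B.smult_minus)
qed

section \<open>Submodules, quotients and copies\<close>

lemma Epi_Hom: "f \<in> Epi R M N \<Longrightarrow> f \<in> Hom R M N"
  and Epi_surj: "f \<in> Epi R M N \<Longrightarrow> y \<in> carrier N \<Longrightarrow> \<exists>x\<in>carrier M. y = f x"
  by (auto simp: Epi_def)

lemma EpiI: "f \<in> Hom R M N \<Longrightarrow> (\<And>y. y \<in> carrier N \<Longrightarrow> \<exists>x\<in>carrier M. y = f x) \<Longrightarrow> f \<in> Epi R M N"
  by (auto simp: Epi_def dest: Hom_closed)

definition right_submodule :: "('r, 'm) ring_scheme \<Rightarrow> ('r, 'a) module \<Rightarrow> 'a set \<Rightarrow> bool"
  where "right_submodule R M N \<longleftrightarrow> N \<subseteq> carrier M \<and> \<zero>\<^bsub>M\<^esub> \<in> N \<and> (\<forall>x\<in>N. \<forall>y\<in>N. x \<oplus>\<^bsub>M\<^esub> y \<in> N) \<and>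
    (\<forall>a\<in>carrier R. \<forall>x\<in>N. a \<odot>\<^bsub>M\<^esub> x \<in> N)"

lemma (in right_module) minus_zero_iff_eq:
  assumes "x \<in> carrier M" "y \<in> carrier M" shows "x \<ominus>\<^bsub>M\<^esub> y = \<zero>\<^bsub>M\<^esub> \<longleftrightarrow> x = y"
proof
  assume "x \<ominus>\<^bsub>M\<^esub> y = \<zero>\<^bsub>M\<^esub>"
  then have "x \<oplus>\<^bsub>M\<^esub> (\<ominus>\<^bsub>M\<^esub> y) \<oplus>\<^bsub>M\<^esub> y = y"
    using assms by (simp add: a_minus_def)
  then show "x = y" using assms by (simp add: M.a_assoc M.l_neg)
qed (use assms in \<open>simp add: a_minus_def M.r_neg\<close>)

lemma right_submodule_preimage:
  assumes f: "f \<in> Hom R M N" and "right_module R M" "right_module R N" "right_submodule R N K"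
  shows "right_submodule R M {x \<in> carrier M. f x \<in> K}"
proof -
  interpret M: right_module R M by fact
  interpret N: right_module R N by fact
  show ?thesis
    using assms(4) by (auto simp: right_submodule_def Hom_zero[OF f] Hom_add[OF f] Hom_smult[OF f]
        assms(2,3) M.smult_closed)
qed

lemma right_submodule_image:
  assumes f: "f \<in> Hom R M N" and "right_module R M" "right_module R N"
  shows "right_submodule R N (f ` carrier M)"
proof -
  interpret M: right_module R M by fact
  interpret N: right_module R N by fact
  show ?thesis unfolding right_submodule_def
  proof (intro conjI ballI)
    show "\<zero>\<^bsub>N\<^esub> \<in> f ` carrier M" using Hom_zero[OF f assms(2,3)] by (metis M.M.zero_closed imageI)
    fix x assume x: "x \<in> f ` carrier M"
    show "a \<odot>\<^bsub>N\<^esub> x \<in> f ` carrier M" if "a \<in> carrier R" for a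
      using x that by (auto simp flip: Hom_smult[OF f] intro: M.smult_closed)
    show "x \<oplus>\<^bsub>N\<^esub> y \<in> f ` carrier M" if "y \<in> f ` carrier M" for y
      using x that by (auto simp flip: Hom_add[OF f])
  qed (use Hom_closed[OF f] in auto)
qed

lemma right_submodule_equalizer:
  assumes f: "f \<in> Hom R M N" and g: "g \<in> Hom R M N" and "right_module R M" "right_module R N"
  shows "right_submodule R M {x \<in> carrier M. f x = g x}"
proof -
  interpret M: right_module R M by fact
  interpret N: right_module R N by fact
  show ?thesis
    by (auto simp: right_submodule_def Hom_zero[OF f] Hom_add[OF f] Hom_smult[OF f]
        Hom_zero[OF g] Hom_add[OF g] Hom_smult[OF g] assms(3,4) M.smult_closed)
qed

text \<open>
Transport of structure along a map whose kernel relation is a congruence: the sum of two values is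
computed on arbitrary preimages. Applied to a choice of coset representatives it gives quotients, and
applied to a homomorphism it gives images.
\<close>

lemma right_module_image:
  fixes c :: "'a \<Rightarrow> 'b" and M :: "('r, 'a) module"
  assumes "right_module R M"
    and add: "\<And>x x' y y'. \<lbrakk>x \<in> carrier M; x' \<in> carrier M; y \<in> carrier M; y' \<in> carrier M; c x = c x'; c y = c y'\<rbrakk>
      \<Longrightarrow> c (x \<oplus>\<^bsub>M\<^esub> y) = c (x' \<oplus>\<^bsub>M\<^esub> y')"
    and smult: "\<And>a x x'. \<lbrakk>a \<in> carrier R; x \<in> carrier M; x' \<in> carrier M; c x = c x'\<rbrakk>
      \<Longrightarrow> c (a \<odot>\<^bsub>M\<^esub> x) = c (a \<odot>\<^bsub>M\<^esub> x')"
  obtains Q :: "('r, 'b) module"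
    where "right_module R Q" "carrier Q = c ` carrier M" "restrict c (carrier M) \<in> Epi R M Q"
proof -
  interpret M: right_module R M by fact
  define r where "r = inv_into (carrier M) c"
  define Q :: "('r, 'b) module" where "Q = \<lparr>carrier = c ` carrier M, monoid.mult = undefined, one = undefined,
    zero = c \<zero>\<^bsub>M\<^esub>, add = \<lambda>u v. c (r u \<oplus>\<^bsub>M\<^esub> r v), smult = \<lambda>a u. c (a \<odot>\<^bsub>M\<^esub> r u)\<rparr>"
  have r: "r (c x) \<in> carrier M" "c (r (c x)) = c x" if "x \<in> carrier M" for x
    using that unfolding r_def by (auto intro: inv_into_into f_inv_into_f)
  have Q_add: "c x \<oplus>\<^bsub>Q\<^esub> c y = c (x \<oplus>\<^bsub>M\<^esub> y)" if "x \<in> carrier M" "y \<in> carrier M" for x y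
    using that by (simp add: Q_def) (intro add, auto simp: r)
  have Q_smult: "a \<odot>\<^bsub>Q\<^esub> c x = c (a \<odot>\<^bsub>M\<^esub> x)" if "a \<in> carrier R" "x \<in> carrier M" for a x
    using that by (simp add: Q_def) (intro smult, auto simp: r)
  have carr: "carrier Q = c ` carrier M" and zero: "\<zero>\<^bsub>Q\<^esub> = c \<zero>\<^bsub>M\<^esub>" by (simp_all add: Q_def)
  have "abelian_group Q"
  proof (rule abelian_groupI)
    fix x assume "x \<in> carrier Q"
    then obtain x' where x': "x = c x'" "x' \<in> carrier M" by (auto simp: carr)
    then have "c (\<ominus>\<^bsub>M\<^esub> x') \<oplus>\<^bsub>Q\<^esub> x = \<zero>\<^bsub>Q\<^esub>" by (simp add: Q_add zero M.M.l_neg)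
    then show "\<exists>y\<in>carrier Q. y \<oplus>\<^bsub>Q\<^esub> x = \<zero>\<^bsub>Q\<^esub>" using x' by (auto simp: carr)
  qed (auto simp: carr Q_add zero M.M.a_ac)
  then have "right_module R Q"
    by (intro right_moduleI M.R.ring_axioms)
      (auto simp: carr Q_add Q_smult M.smult_closed M.smult_l_distr M.smult_r_distr M.smult_assoc M.smult_one)
  moreover have "restrict c (carrier M) \<in> Epi R M Q"
    by (auto simp: Epi_def carr Q_add Q_smult assms(1) intro!: Hom_restrictI)
  ultimately show thesis using that carr by blast
qed

text \<open>
The cosets of \<open>N\<close> would form a carrier of the wrong type. Instead the quotient is carried by
representatives, coded in the universe by an injection \<open>g\<close>.
\<close>

lemma quotient_exists:
  fixes M :: "('r, 'a) module" and N :: "'a set"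
  assumes M: "right_module R M" and N: "right_submodule R M N"
    and small: "carrier M \<prec> (UNIV :: 'u set)"
  obtains Q :: "('r, 'u) module" and \<pi>
    where "Q \<in> Mods R" "\<pi> \<in> Epi R M Q" "a_kernel M Q \<pi> = N"
proof -
  interpret M: right_module R M by fact
  obtain g :: "'a \<Rightarrow> 'u" where g: "inj_on g (carrier M)"
    using small unfolding lesspoll_def lepoll_def by blast
  have N': "x \<oplus>\<^bsub>M\<^esub> y \<in> N" "\<zero>\<^bsub>M\<^esub> \<in> N" "x \<in> carrier M" if "x \<in> N" "y \<in> N" for x y
    using N that by (auto simp: right_submodule_def)
  have Nm: "\<ominus>\<^bsub>M\<^esub> x \<in> N" if "x \<in> N" for x
    using N that N'(3)[OF that that] by (simp add: M.a_inv_eq_smult right_submodule_def)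
  \<comment> \<open>the code of the chosen representative of the coset of \<open>x\<close>\<close>
  define c where "c x = g (SOME y. y \<in> carrier M \<and> x \<ominus>\<^bsub>M\<^esub> y \<in> N)" for x
  have rep: "(SOME y. y \<in> carrier M \<and> x \<ominus>\<^bsub>M\<^esub> y \<in> N) \<in> carrier M \<and>
     x \<ominus>\<^bsub>M\<^esub> (SOME y. y \<in> carrier M \<and> x \<ominus>\<^bsub>M\<^esub> y \<in> N) \<in> N" if "x \<in> carrier M" for x
    by (rule someI[of _ x]) (use that N in \<open>auto simp: a_minus_def M.M.r_neg right_submodule_def\<close>)
  have c: "c x = c y \<longleftrightarrow> x \<ominus>\<^bsub>M\<^esub> y \<in> N" if x: "x \<in> carrier M" and y: "y \<in> carrier M" for x y
  proof
    assume "c x = c y"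
    then have "(SOME z. z \<in> carrier M \<and> x \<ominus>\<^bsub>M\<^esub> z \<in> N) = (SOME z. z \<in> carrier M \<and> y \<ominus>\<^bsub>M\<^esub> z \<in> N)"
      unfolding c_def using g rep[OF x] rep[OF y] by (auto dest: inj_onD)
    then obtain z where z: "z \<in> carrier M" "x \<ominus>\<^bsub>M\<^esub> z \<in> N" "y \<ominus>\<^bsub>M\<^esub> z \<in> N"
      using rep[OF x] rep[OF y] by metis
    have "(x \<ominus>\<^bsub>M\<^esub> z) \<oplus>\<^bsub>M\<^esub> (\<ominus>\<^bsub>M\<^esub> (y \<ominus>\<^bsub>M\<^esub> z)) \<in> N" by (intro N' Nm z)
    also have "\<ominus>\<^bsub>M\<^esub> (y \<ominus>\<^bsub>M\<^esub> z) = z \<ominus>\<^bsub>M\<^esub> y"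
      using y z(1) by (simp add: a_minus_def M.M.minus_add M.M.a_ac)
    also have "(x \<ominus>\<^bsub>M\<^esub> z) \<oplus>\<^bsub>M\<^esub> (z \<ominus>\<^bsub>M\<^esub> y) = x \<ominus>\<^bsub>M\<^esub> y"
      using x y z(1) by (simp add: a_minus_def M.M.a_assoc M.M.r_neg1)
    finally show "x \<ominus>\<^bsub>M\<^esub> y \<in> N" .
  next
    assume xy: "x \<ominus>\<^bsub>M\<^esub> y \<in> N"
    have "x \<ominus>\<^bsub>M\<^esub> z \<in> N \<longleftrightarrow> y \<ominus>\<^bsub>M\<^esub> z \<in> N" if z: "z \<in> carrier M" for z
    proof -
      have eq: "x \<ominus>\<^bsub>M\<^esub> z = (x \<ominus>\<^bsub>M\<^esub> y) \<oplus>\<^bsub>M\<^esub> (y \<ominus>\<^bsub>M\<^esub> z)"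
        using x y z by (simp add: a_minus_def M.M.a_ac M.M.r_neg1 M.M.r_neg2)
      have eq': "y \<ominus>\<^bsub>M\<^esub> z = (\<ominus>\<^bsub>M\<^esub> (x \<ominus>\<^bsub>M\<^esub> y)) \<oplus>\<^bsub>M\<^esub> (x \<ominus>\<^bsub>M\<^esub> z)"
        using x y z by (simp add: a_minus_def M.M.minus_add M.M.a_ac M.M.r_neg1 M.M.r_neg2)
      show ?thesis
      proof
        show "x \<ominus>\<^bsub>M\<^esub> z \<in> N \<Longrightarrow> y \<ominus>\<^bsub>M\<^esub> z \<in> N" by (subst eq') (intro N' Nm xy)
        show "y \<ominus>\<^bsub>M\<^esub> z \<in> N \<Longrightarrow> x \<ominus>\<^bsub>M\<^esub> z \<in> N" by (subst eq) (intro N' Nm xy)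
      qed
    qed
    then show "c x = c y" unfolding c_def by (metis (mono_tags, lifting))
  qed
  obtain Q :: "('r, 'u) module" where Q: "right_module R Q" "carrier Q = c ` carrier M"
      "restrict c (carrier M) \<in> Epi R M Q"
  proof (rule right_module_image[OF M])
    show "c (x \<oplus>\<^bsub>M\<^esub> y) = c (x' \<oplus>\<^bsub>M\<^esub> y')"
      if x: "x \<in> carrier M" "x' \<in> carrier M" "y \<in> carrier M" "y' \<in> carrier M" "c x = c x'" "c y = c y'" for x x' y y'
    proof -
      have "(x \<ominus>\<^bsub>M\<^esub> x') \<oplus>\<^bsub>M\<^esub> (y \<ominus>\<^bsub>M\<^esub> y') \<in> N" using x by (intro N') (simp_all add: c)
      also have "(x \<ominus>\<^bsub>M\<^esub> x') \<oplus>\<^bsub>M\<^esub> (y \<ominus>\<^bsub>M\<^esub> y') = (x \<oplus>\<^bsub>M\<^esub> y) \<ominus>\<^bsub>M\<^esub> (x' \<oplus>\<^bsub>M\<^esub> y')"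
        using x by (simp add: a_minus_def M.M.minus_add M.M.a_ac)
      finally show ?thesis using x by (simp add: c)
    qed
    show "c (a \<odot>\<^bsub>M\<^esub> x) = c (a \<odot>\<^bsub>M\<^esub> x')" if "a \<in> carrier R" "x \<in> carrier M" "x' \<in> carrier M" "c x = c x'" for a x x'
    proof -
      have "a \<odot>\<^bsub>M\<^esub> x \<oplus>\<^bsub>M\<^esub> a \<odot>\<^bsub>M\<^esub> (\<ominus>\<^bsub>M\<^esub> x') \<in> N"
        using N that by (simp add: c right_submodule_def a_minus_def flip: M.smult_r_distr)
      then show ?thesis using that by (simp add: c M.smult_closed M.smult_minus a_minus_def)
    qed
  qed auto
  have "carrier Q \<prec> (UNIV :: 'u set)"
    using Q(2) small image_lepoll lesspoll_trans1 by metis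
  then have "Q \<in> Mods R" using Q by (simp add: Mods_def small_def)
  moreover have "a_kernel M Q (restrict c (carrier M)) = N"
  proof -
    have "\<zero>\<^bsub>Q\<^esub> = c \<zero>\<^bsub>M\<^esub>" using Hom_zero[OF Epi_Hom[OF Q(3)] M Q(1)] by simp
    then have "a_kernel M Q (restrict c (carrier M)) = {x \<in> carrier M. x \<ominus>\<^bsub>M\<^esub> \<zero>\<^bsub>M\<^esub> \<in> N}"
      by (auto simp: a_kernel_def' c)
    also have "\<dots> = N"
    proof -
      have "x \<ominus>\<^bsub>M\<^esub> \<zero>\<^bsub>M\<^esub> = x" if "x \<in> carrier M" for x
        using that by (simp add: a_minus_def M.M.add.inv_one)
      moreover have "N \<subseteq> carrier M" using N by (auto simp: right_submodule_def)
      ultimately show ?thesis by auto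
    qed
    finally show ?thesis .
  qed
  ultimately show thesis using that Q(3) by blast
qed

lemma Hom_inverse:
  assumes f: "f \<in> Hom R M N" and M: "right_module R M" and N: "right_module R N" and bij: "bij_betw f (carrier M) (carrier N)"
  obtains g where "g \<in> Hom R N M" "\<And>x. x \<in> carrier M \<Longrightarrow> g (f x) = x" "\<And>y. y \<in> carrier N \<Longrightarrow> f (g y) = y"
proof -
  interpret M: right_module R M by fact
  interpret N: right_module R N by fact
  define g where "g = inv_into (carrier M) f"
  have g: "g y \<in> carrier M" "f (g y) = y" if "y \<in> carrier N" for y
    using that bij unfolding g_def by (auto simp: bij_betw_def intro: inv_into_into f_inv_into_f)
  have gf: "g (f x) = x" if "x \<in> carrier M" for x
    using that bij unfolding g_def by (simp add: bij_betw_def)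
  have "restrict g (carrier N) \<in> Hom R N M"
  proof (rule Hom_restrictI[OF N])
    fix x y assume xy: "x \<in> carrier N" "y \<in> carrier N"
    show "g (x \<oplus>\<^bsub>N\<^esub> y) = g x \<oplus>\<^bsub>M\<^esub> g y"
      using gf[of "g x \<oplus>\<^bsub>M\<^esub> g y"] by (simp add: Hom_add[OF f] g xy)
  next
    fix a x assume xy: "a \<in> carrier R" "x \<in> carrier N"
    show "g (a \<odot>\<^bsub>N\<^esub> x) = a \<odot>\<^bsub>M\<^esub> g x"
      using gf[of "a \<odot>\<^bsub>M\<^esub> g x"] by (simp add: Hom_smult[OF f] g xy M.smult_closed)
  qed (use g in auto)
  then show thesis using that[of "restrict g (carrier N)"] g gf Hom_closed[OF f] by auto
qed

lemma Hom_inj_iff: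
  assumes f: "f \<in> Hom R M N" and M: "right_module R M" and N: "right_module R N"
  shows "inj_on f (carrier M) \<longleftrightarrow> a_kernel M N f = {\<zero>\<^bsub>M\<^esub>}"
proof -
  interpret M: right_module R M by fact
  interpret N: right_module R N by fact
  show ?thesis
  proof
    assume "inj_on f (carrier M)"
    then show "a_kernel M N f = {\<zero>\<^bsub>M\<^esub>}"
      using Hom_zero[OF f M N] by (auto simp: a_kernel_def') (metis M.M.zero_closed inj_onD)
  next
    assume k: "a_kernel M N f = {\<zero>\<^bsub>M\<^esub>}"
    show "inj_on f (carrier M)"
    proof (rule inj_onI)
      fix x y assume xy: "x \<in> carrier M" "y \<in> carrier M" "f x = f y"
      then have "x \<ominus>\<^bsub>M\<^esub> y \<in> a_kernel M N f"
        by (simp add: a_kernel_def' Hom_minus[OF f M N] N.M.r_neg a_minus_def[where R = N] Hom_closed[OF f])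
      then have "x \<ominus>\<^bsub>M\<^esub> y = \<zero>\<^bsub>M\<^esub>" using k by simp
      then show "x = y" using xy by (simp add: M.minus_zero_iff_eq)
    qed
  qed
qed

text \<open>
A small module over an arbitrary type has an isomorphic copy inside the universe, namely its
quotient by zero. All direct sums and the regular module enter \<open>Mods R\<close> in this way.
\<close>

lemma copy_exists:
  fixes M :: "('r, 'a) module"
  assumes M: "right_module R M" and small: "carrier M \<prec> (UNIV :: 'u set)"
  obtains Q :: "('r, 'u) module" and f
    where "Q \<in> Mods R" "f \<in> Hom R M Q" "bij_betw f (carrier M) (carrier Q)"
proof -
  interpret M: right_module R M by fact
  have "right_submodule R M {\<zero>\<^bsub>M\<^esub>}" by (auto simp: right_submodule_def M.smult_r_null)
  then obtain Q :: "('r, 'u) module" and f where Q: "Q \<in> Mods R" "f \<in> Epi R M Q" "a_kernel M Q f = {\<zero>\<^bsub>M\<^esub>}"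
    using quotient_exists[OF M _ small] by blast
  then have "inj_on f (carrier M)" using Hom_inj_iff[OF Epi_Hom M] Mods_right_module by blast
  then show thesis using that[of Q f] Q by (auto simp: Epi_def bij_betw_def)
qed

lemma Hom_factor_Epi:
  assumes p: "p \<in> Epi R M N" and f: "f \<in> Hom R M X"
    and M: "right_module R M" and N: "right_module R N" and X: "right_module R X"
    and ker: "\<And>x. x \<in> carrier M \<Longrightarrow> p x = \<zero>\<^bsub>N\<^esub> \<Longrightarrow> f x = \<zero>\<^bsub>X\<^esub>"
  obtains h where "h \<in> Hom R N X" "\<And>x. x \<in> carrier M \<Longrightarrow> h (p x) = f x"
proof -
  interpret M: right_module R M by fact
  interpret N: right_module R N by fact
  interpret X: right_module R X by fact
  note p' = Epi_Hom[OF p]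
  define h where "h = (\<lambda>y\<in>carrier N. f (inv_into (carrier M) p y))"
  have h: "h (p x) = f x" if x: "x \<in> carrier M" for x
  proof -
    define x' where "x' = inv_into (carrier M) p (p x)"
    have x': "x' \<in> carrier M" "p x' = p x"
      using x unfolding x'_def by (auto intro: inv_into_into f_inv_into_f)
    have "f (x' \<ominus>\<^bsub>M\<^esub> x) = \<zero>\<^bsub>X\<^esub>"
      using x x' Hom_closed[OF p' x] by (intro ker) (auto simp: Hom_minus[OF p' M N] a_minus_def[where R = N] N.M.r_neg)
    then have "f x' \<ominus>\<^bsub>X\<^esub> f x = \<zero>\<^bsub>X\<^esub>" by (simp add: Hom_minus[OF f M X x'(1) x])
    then have "f x' = f x" using Hom_closed[OF f x] Hom_closed[OF f x'(1)] by (simp add: X.minus_zero_iff_eq)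
    then show ?thesis using Hom_closed[OF p' x] by (simp add: h_def x'_def)
  qed
  have "h \<in> Hom R N X"
  proof (rule Hom_memI)
    show "h \<in> extensional (carrier N)" by (simp add: h_def)
  next
    fix y assume "y \<in> carrier N"
    then obtain x where x: "x \<in> carrier M" "y = p x" using Epi_surj[OF p] by blast
    then show "h y \<in> carrier X" by (simp add: h Hom_closed[OF f])
    fix a assume a: "a \<in> carrier R"
    then show "h (a \<odot>\<^bsub>N\<^esub> y) = a \<odot>\<^bsub>X\<^esub> h y"
      using x h[of "a \<odot>\<^bsub>M\<^esub> x"] by (simp add: h Hom_smult[OF f] Hom_smult[OF p'] M.smult_closed)
  next
    fix y z assume "y \<in> carrier N" "z \<in> carrier N"
    then obtain x x' where x: "x \<in> carrier M" "y = p x" "x' \<in> carrier M" "z = p x'" using Epi_surj[OF p] by metis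
    then show "h (y \<oplus>\<^bsub>N\<^esub> z) = h y \<oplus>\<^bsub>X\<^esub> h z"
      using h[of "x \<oplus>\<^bsub>M\<^esub> x'"] by (simp add: h Hom_add[OF f] Hom_add[OF p'])
  qed
  then show thesis using that h by blast
qed

lemma cokernel_exists:
  fixes B :: "('r, 'u) module"
  assumes f: "f \<in> Hom R A B" and A: "right_module R A" and B: "B \<in> Mods R"
  obtains C :: "('r, 'u) module" and \<pi> where "C \<in> Mods R" "right_exact R A f B \<pi> C"
proof -
  have "right_submodule R B (f ` carrier A)"
    by (rule right_submodule_image[OF f A Mods_right_module[OF B]])
  moreover have "carrier B \<prec> (UNIV :: 'u set)" using B by (simp add: Mods_def small_def)
  ultimately obtain C :: "('r, 'u) module" and \<pi> where "C \<in> Mods R" "\<pi> \<in> Epi R B C" "a_kernel B C \<pi> = f ` carrier A"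
    using quotient_exists[OF Mods_right_module[OF B]] by blast
  then show thesis using f by (intro that[of C \<pi>]) (auto simp: right_exact_def)
qed
section \<open>Direct sums\<close>

text \<open>
A coproduct is recorded by the existence part of its universal property and by the fact that the
images of the injections generate it; the latter yields uniqueness, and is also what is needed to
show that quotients of coproducts are generated by images of the summands. The argument \<open>'u itself\<close>
selects the universe in which the test modules \<open>X\<close> live, since the type of \<open>S\<close> does not.
\<close>

definition is_coproduct :: "('r, 'm) ring_scheme \<Rightarrow> 'i set \<Rightarrow> ('i \<Rightarrow> ('r, 'a) module) \<Rightarrow> ('r, 's) module \<Rightarrow>
    ('i \<Rightarrow> 'a \<Rightarrow> 's) \<Rightarrow> 'u itself \<Rightarrow> bool"
  where "is_coproduct R I M S \<iota> (_ :: 'u itself) \<longleftrightarrow>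
    (\<forall>i\<in>I. \<iota> i \<in> Hom R (M i) S) \<and>
    (\<forall>N. right_submodule R S N \<and> (\<forall>i\<in>I. \<iota> i ` carrier (M i) \<subseteq> N) \<longrightarrow> N = carrier S) \<and>
    (\<forall>X \<in> (Mods R :: ('r, 'u) module set). \<forall>f. (\<forall>i\<in>I. f i \<in> Hom R (M i) X) \<longrightarrow>
      (\<exists>h \<in> Hom R S X. \<forall>i\<in>I. \<forall>x\<in>carrier (M i). h (\<iota> i x) = f i x))"

lemma (in right_module) smult_finsum:
  assumes "finite A" "f \<in> A \<rightarrow> carrier M" "a \<in> carrier R"
  shows "a \<odot>\<^bsub>M\<^esub> finsum M f A = finsum M (\<lambda>i. a \<odot>\<^bsub>M\<^esub> f i) A"
  using assms
proof (induction A rule: finite_induct)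
  case empty
  then show ?case by (simp add: smult_r_null)
next
  case (insert i A)
  then have "f i \<in> carrier M" "f \<in> A \<rightarrow> carrier M" by auto
  moreover from this have "(\<lambda>i. a \<odot>\<^bsub>M\<^esub> f i) \<in> A \<rightarrow> carrier M" "a \<odot>\<^bsub>M\<^esub> f i \<in> carrier M"
    using insert.prems by (auto intro!: smult_closed)
  ultimately show ?case using insert by (simp add: smult_r_distr)
qed

lemma direct_sum_carrier:
  assumes "\<And>i. i \<in> I \<Longrightarrow> right_module R (M i)"
  shows "carrier (direct_sum I M) = {x \<in> \<Pi>\<^sub>E i\<in>I. carrier (M i). finite {i\<in>I. x i \<noteq> \<zero>\<^bsub>M i\<^esub>}}"
proof -
  have "group (add_monoid (M i))" if "i \<in> I" for i
    using assms[OF that] by (simp add: right_module_def abelian_group.a_group)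
  then show ?thesis by (simp add: direct_sum_def Let_def carrier_sum_group)
qed

lemma direct_sum_simps:
  "\<zero>\<^bsub>direct_sum I M\<^esub> = (\<lambda>i\<in>I. \<zero>\<^bsub>M i\<^esub>)"
  "x \<oplus>\<^bsub>direct_sum I M\<^esub> y = (\<lambda>i\<in>I. x i \<oplus>\<^bsub>M i\<^esub> y i)"
  "a \<odot>\<^bsub>direct_sum I M\<^esub> x = (\<lambda>i\<in>I. a \<odot>\<^bsub>M i\<^esub> x i)"
  by (simp_all add: direct_sum_def Let_def)

lemma direct_sum_right_module:
  assumes R: "ring R" and M: "\<And>i. i \<in> I \<Longrightarrow> right_module R (M i)"
  shows "right_module R (direct_sum I M)"
proof -
  let ?S = "direct_sum I M"
  note carr = direct_sum_carrier[of I R M, OF M]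
  note ag = M[THEN right_module.axioms(2)]
  have "group (add_monoid (M i))" if "i \<in> I" for i
    using ag[OF that] by (rule abelian_group.a_group)
  then interpret S: group "sum_group I (\<lambda>i. add_monoid (M i))" by (rule sum_group)
  have S: "carrier (sum_group I (\<lambda>i. add_monoid (M i))) = carrier ?S"
    by (simp add: direct_sum_def Let_def)
  have mem: "x i \<in> carrier (M i)" if "x \<in> carrier ?S" "i \<in> I" for x i
    using that by (auto simp: carr)
  have ext: "x \<in> extensional I" if "x \<in> carrier ?S" for x
    using that by (auto simp: carr PiE_def)
  have "abelian_group ?S"
  proof (rule abelian_groupI)
    fix x y assume x: "x \<in> carrier ?S" and y: "y \<in> carrier ?S"
    show "x \<oplus>\<^bsub>?S\<^esub> y \<in> carrier ?S"
      using S.m_closed[of x y] x y by (simp add: S direct_sum_simps)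
    show "x \<oplus>\<^bsub>?S\<^esub> y = y \<oplus>\<^bsub>?S\<^esub> x"
      using x y by (auto simp: direct_sum_simps mem intro!: restrict_ext abelian_monoid.a_comm abelian_group.axioms(1)[OF ag])
    show "x \<oplus>\<^bsub>?S\<^esub> y \<oplus>\<^bsub>?S\<^esub> z = x \<oplus>\<^bsub>?S\<^esub> (y \<oplus>\<^bsub>?S\<^esub> z)" if "z \<in> carrier ?S" for z
      using S.m_assoc[of x y z] x y that by (simp add: S direct_sum_simps)
    show "\<zero>\<^bsub>?S\<^esub> \<oplus>\<^bsub>?S\<^esub> x = x"
      using S.l_one[of x] x by (simp add: S direct_sum_simps)
    show "\<exists>y\<in>carrier ?S. y \<oplus>\<^bsub>?S\<^esub> x = \<zero>\<^bsub>?S\<^esub>"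
      using S.l_inv_ex[of x] x by (simp add: S direct_sum_simps)
  next
    show "\<zero>\<^bsub>?S\<^esub> \<in> carrier ?S" using S.one_closed by (simp add: S direct_sum_simps)
  qed
  then show ?thesis
  proof (rule right_moduleI[OF R])
    fix x assume x: "x \<in> carrier ?S"
    show "\<one>\<^bsub>R\<^esub> \<odot>\<^bsub>?S\<^esub> x = x"
      using x ext[OF x] by (auto simp: direct_sum_simps right_module.smult_one[OF M] mem intro!: extensionalityI[where A = I])
  next
    fix a x assume a: "a \<in> carrier R" and x: "x \<in> carrier ?S"
    have "{i\<in>I. a \<odot>\<^bsub>M i\<^esub> x i \<noteq> \<zero>\<^bsub>M i\<^esub>} \<subseteq> {i\<in>I. x i \<noteq> \<zero>\<^bsub>M i\<^esub>}"
      using a by (auto simp: right_module.smult_r_null[OF M])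
    then have "finite {i\<in>I. a \<odot>\<^bsub>M i\<^esub> x i \<noteq> \<zero>\<^bsub>M i\<^esub>}"
      using x by (auto simp: carr intro: finite_subset)
    moreover have "{i\<in>I. (\<lambda>i\<in>I. a \<odot>\<^bsub>M i\<^esub> x i) i \<noteq> \<zero>\<^bsub>M i\<^esub>} = {i\<in>I. a \<odot>\<^bsub>M i\<^esub> x i \<noteq> \<zero>\<^bsub>M i\<^esub>}" by auto
    ultimately show "a \<odot>\<^bsub>?S\<^esub> x \<in> carrier ?S"
      using a x by (auto simp: carr direct_sum_simps intro!: right_module.smult_closed[OF M])
    fix b assume b: "b \<in> carrier R"
    show "(a \<oplus>\<^bsub>R\<^esub> b) \<odot>\<^bsub>?S\<^esub> x = a \<odot>\<^bsub>?S\<^esub> x \<oplus>\<^bsub>?S\<^esub> b \<odot>\<^bsub>?S\<^esub> x"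
      using a b x by (auto simp: direct_sum_simps right_module.smult_l_distr[OF M] mem intro!: restrict_ext)
    show "(a \<otimes>\<^bsub>R\<^esub> b) \<odot>\<^bsub>?S\<^esub> x = b \<odot>\<^bsub>?S\<^esub> (a \<odot>\<^bsub>?S\<^esub> x)"
      using a b x by (auto simp: direct_sum_simps right_module.smult_assoc[OF M] mem intro!: restrict_ext)
  next
    fix a x y assume "a \<in> carrier R" "x \<in> carrier ?S" "y \<in> carrier ?S"
    then show "a \<odot>\<^bsub>?S\<^esub> (x \<oplus>\<^bsub>?S\<^esub> y) = a \<odot>\<^bsub>?S\<^esub> x \<oplus>\<^bsub>?S\<^esub> a \<odot>\<^bsub>?S\<^esub> y"
      by (auto simp: direct_sum_simps right_module.smult_r_distr[OF M] mem intro!: restrict_ext)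
  qed
qed

lemma direct_sum_small:
  fixes M :: "'i \<Rightarrow> ('r, 'u) module"
  assumes univ: "is_universe TYPE('u)" and I: "I \<prec> (UNIV :: 'u set)"
    and M: "\<And>i. i \<in> I \<Longrightarrow> M i \<in> Mods R"
  shows "carrier (direct_sum I M) \<prec> (UNIV :: 'u set)"
proof (rule small_function_space[OF univ I])
  show "(\<Union>i\<in>I. carrier (M i)) \<prec> (UNIV :: 'u set)"
    using small_UNION[OF univ I, of "\<lambda>i. carrier (M i)"] M by (simp add: Mods_def small_def)
  have "carrier (direct_sum I M) \<subseteq> (\<Pi>\<^sub>E i\<in>I. carrier (M i))"
    using direct_sum_carrier[of I R M] M by (auto simp: Mods_right_module)
  then show "carrier (direct_sum I M) \<subseteq> extensional I \<inter> (I \<rightarrow> (\<Union>i\<in>I. carrier (M i)))"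
    by (fastforce simp: PiE_def)
qed

text \<open>
The homomorphism induced by a family \<open>f\<close> sends \<open>s\<close> to the sum of \<open>f i (s i)\<close> over the support of
\<open>s\<close>. The support of \<open>s + t\<close> may be smaller than the union of the two supports, so the proofs of linearity
allow the sum to run over any larger finite set of indices. Generation is an induction on the support, splitting
off one component at a time.
\<close>

lemma direct_sum_is_coproduct:
  fixes M :: "'i \<Rightarrow> ('r, 'a) module"
  assumes R: "ring R" and M: "\<And>i. i \<in> I \<Longrightarrow> right_module R (M i)"
  shows "is_coproduct R I M (direct_sum I M)
    (\<lambda>i. \<lambda>x\<in>carrier (M i). \<lambda>j\<in>I. if j = i then x else \<zero>\<^bsub>M j\<^esub>) TYPE('u)"
    (is "is_coproduct R I M ?S ?\<iota> _")
proof -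
  note carr = direct_sum_carrier[of I R M, OF M]
  interpret S: right_module R ?S by (rule direct_sum_right_module[OF R M])
  have mem: "x i \<in> carrier (M i)" if "x \<in> carrier ?S" "i \<in> I" for x i
    using that by (auto simp: carr)
  have ext: "x \<in> extensional I" if "x \<in> carrier ?S" for x
    using that by (auto simp: carr PiE_def)
  note ag = M[THEN right_module.axioms(2)]
  note zero = abelian_monoid.zero_closed[OF abelian_group.axioms(1)[OF ag]]
  note l_zero = abelian_monoid.l_zero[OF abelian_group.axioms(1)[OF ag]]
  note r_zero = abelian_monoid.r_zero[OF abelian_group.axioms(1)[OF ag]]
  have \<iota>_supp: "{j\<in>I. ?\<iota> i x j \<noteq> \<zero>\<^bsub>M j\<^esub>} \<subseteq> {i}" if "x \<in> carrier (M i)" for i x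
    using that by auto
  have \<iota>_mem: "?\<iota> i x \<in> carrier ?S" if "i \<in> I" "x \<in> carrier (M i)" for i x
    using that finite_subset[OF \<iota>_supp[OF that(2)]] by (auto simp: carr zero)
  have \<iota>: "?\<iota> i \<in> Hom R (M i) ?S" if i: "i \<in> I" for i
    by (rule Hom_restrictI[OF M[OF i]])
      (use i \<iota>_mem in \<open>auto simp: direct_sum_simps fun_eq_iff l_zero zero right_module.smult_r_null[OF M]\<close>)
  have gen: "N = carrier ?S" if N: "right_submodule R ?S N" and \<iota>N: "\<forall>i\<in>I. ?\<iota> i ` carrier (M i) \<subseteq> N" for N
  proof
    show "N \<subseteq> carrier ?S" using N by (simp add: right_submodule_def)
    have "\<forall>x\<in>carrier ?S. {i\<in>I. x i \<noteq> \<zero>\<^bsub>M i\<^esub>} \<subseteq> B \<longrightarrow> x \<in> N" if "finite B" for B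
      using that
    proof (induction B rule: finite_induct)
      case empty
      have "x = \<zero>\<^bsub>?S\<^esub>" if "x \<in> carrier ?S" "{i\<in>I. x i \<noteq> \<zero>\<^bsub>M i\<^esub>} \<subseteq> {}" for x
        by (rule extensionalityI[OF ext[OF that(1)]]) (use that in \<open>auto simp: direct_sum_simps\<close>)
      then show ?case using N by (auto simp: right_submodule_def)
    next
      case (insert i B)
      show ?case
      proof (intro ballI impI)
        fix x assume x: "x \<in> carrier ?S" and supp: "{j\<in>I. x j \<noteq> \<zero>\<^bsub>M j\<^esub>} \<subseteq> insert i B"
        show "x \<in> N"
        proof (cases "i \<in> I")
          case False
          then have "{j\<in>I. x j \<noteq> \<zero>\<^bsub>M j\<^esub>} \<subseteq> B" using supp by auto
          then show ?thesis using insert x by blast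
        next
          case True
          let ?y = "x(i := \<zero>\<^bsub>M i\<^esub>)"
          have supp_y: "{j\<in>I. ?y j \<noteq> \<zero>\<^bsub>M j\<^esub>} \<subseteq> B" using supp by auto
          then have "finite {j\<in>I. ?y j \<noteq> \<zero>\<^bsub>M j\<^esub>}" using insert.hyps finite_subset by blast
          then have y: "?y \<in> carrier ?S"
            using x zero[OF True] True by (auto simp: carr PiE_iff extensional_def)
          have eq: "x = ?y \<oplus>\<^bsub>?S\<^esub> ?\<iota> i (x i)"
            by (rule extensionalityI[OF ext[OF x], of "?y \<oplus>\<^bsub>?S\<^esub> ?\<iota> i (x i)"])
              (auto simp: direct_sum_simps mem[OF x] mem[OF x True] l_zero r_zero)
          have "?y \<in> N" using insert.IH supp_y y by blast
          moreover have "?\<iota> i (x i) \<in> N" using \<iota>N True mem[OF x True] by blast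
          ultimately have "?y \<oplus>\<^bsub>?S\<^esub> ?\<iota> i (x i) \<in> N" using N unfolding right_submodule_def by blast
          then show ?thesis by (subst eq)
        qed
      qed
    qed
    then show "carrier ?S \<subseteq> N" by (auto simp: carr)
  qed
  have ex: "\<exists>h \<in> Hom R ?S X. \<forall>i\<in>I. \<forall>x\<in>carrier (M i). h (?\<iota> i x) = f i x"
    if X: "right_module R X" and f: "\<forall>i\<in>I. f i \<in> Hom R (M i) X" for X :: "('r, 'u) module" and f
  proof -
    interpret X: right_module R X by fact
    have fX: "f i x \<in> carrier X" if "i \<in> I" "x \<in> carrier (M i)" for i x
      by (rule Hom_closed[OF f[rule_format, OF that(1)] that(2)])
    have f0: "f i \<zero>\<^bsub>M i\<^esub> = \<zero>\<^bsub>X\<^esub>" if "i \<in> I" for i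
      by (rule Hom_zero[OF f[rule_format, OF that] M[OF that] X])
    define h where "h = (\<lambda>s\<in>carrier ?S. finsum X (\<lambda>i. f i (s i)) {i\<in>I. s i \<noteq> \<zero>\<^bsub>M i\<^esub>})"
    \<comment> \<open>the sum may be taken over any finite set containing the support\<close>
    have h: "h s = finsum X (\<lambda>i. f i (s i)) B"
      if "s \<in> carrier ?S" "finite B" "B \<subseteq> I" "{i\<in>I. s i \<noteq> \<zero>\<^bsub>M i\<^esub>} \<subseteq> B" for s B
      unfolding h_def using that
      by (simp, intro X.M.add.finprod_mono_neutral_cong_left) (auto simp: f0 intro!: fX mem)
    have fin: "finite {i\<in>I. s i \<noteq> \<zero>\<^bsub>M i\<^esub>}" if "s \<in> carrier ?S" for s
      using that by (simp add: carr)
    have "h \<in> Hom R ?S X"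
    proof (rule Hom_memI)
      show "h \<in> extensional (carrier ?S)" by (simp add: h_def)
    next
      fix s assume s: "s \<in> carrier ?S"
      then show "h s \<in> carrier X" unfolding h_def by (auto intro!: X.M.finsum_closed fX mem)
      let ?B = "{i\<in>I. s i \<noteq> \<zero>\<^bsub>M i\<^esub>}"
      fix a assume a: "a \<in> carrier R"
      have "h (a \<odot>\<^bsub>?S\<^esub> s) = finsum X (\<lambda>i. f i ((a \<odot>\<^bsub>?S\<^esub> s) i)) ?B"
        by (rule h) (use S.smult_closed[OF a s] a fin[OF s] in \<open>auto simp: direct_sum_simps right_module.smult_r_null[OF M]\<close>)
      also have "\<dots> = finsum X (\<lambda>i. a \<odot>\<^bsub>X\<^esub> f i (s i)) ?B"
        by (rule X.M.finsum_cong') (use s a f in \<open>auto simp: direct_sum_simps mem fX Hom_smult[OF f[rule_format]] intro!: X.smult_closed\<close>)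
      also have "\<dots> = a \<odot>\<^bsub>X\<^esub> h s"
        using s a fin[OF s] by (simp add: h_def) (intro X.smult_finsum[symmetric], auto intro!: fX mem)
      finally show "h (a \<odot>\<^bsub>?S\<^esub> s) = a \<odot>\<^bsub>X\<^esub> h s" .
    next
      fix s t assume s: "s \<in> carrier ?S" and t: "t \<in> carrier ?S"
      let ?B = "{i\<in>I. s i \<noteq> \<zero>\<^bsub>M i\<^esub>} \<union> {i\<in>I. t i \<noteq> \<zero>\<^bsub>M i\<^esub>}"
      have "h (s \<oplus>\<^bsub>?S\<^esub> t) = finsum X (\<lambda>i. f i ((s \<oplus>\<^bsub>?S\<^esub> t) i)) ?B"
        by (rule h) (use S.M.a_closed[OF s t] fin[OF s] fin[OF t] in \<open>auto simp: direct_sum_simps l_zero zero\<close>)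
      also have "\<dots> = finsum X (\<lambda>i. f i (s i) \<oplus>\<^bsub>X\<^esub> f i (t i)) ?B"
        by (rule X.M.finsum_cong') (use s t f in \<open>auto simp: direct_sum_simps mem fX Hom_add[OF f[rule_format]]\<close>)
      also have "\<dots> = finsum X (\<lambda>i. f i (s i)) ?B \<oplus>\<^bsub>X\<^esub> finsum X (\<lambda>i. f i (t i)) ?B"
        by (rule X.M.finsum_addf) (use s t in \<open>auto intro!: fX mem\<close>)
      also have "finsum X (\<lambda>i. f i (s i)) ?B = h s"
        by (rule h[symmetric]) (use s t fin in auto)
      also have "finsum X (\<lambda>i. f i (t i)) ?B = h t"
        by (rule h[symmetric]) (use s t fin in auto)
      finally show "h (s \<oplus>\<^bsub>?S\<^esub> t) = h s \<oplus>\<^bsub>X\<^esub> h t" .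
    qed
    moreover have "h (?\<iota> i x) = f i x" if i: "i \<in> I" and x: "x \<in> carrier (M i)" for i x
    proof -
      have "h (?\<iota> i x) = finsum X (\<lambda>j. f j (?\<iota> i x j)) {i}"
        by (rule h) (use i x \<iota>_mem in auto)
      also have "\<dots> = f i x" using i x fX[OF i x] by simp
      finally show ?thesis .
    qed
    ultimately show ?thesis by blast
  qed
  show ?thesis unfolding is_coproduct_def using \<iota> gen ex Mods_right_module by blast
qed
context
  fixes R :: "('r, 'm) ring_scheme" and I :: "'i set" and M :: "'i \<Rightarrow> ('r, 'a) module" and S :: "('r, 's) module"
    and \<iota> :: "'i \<Rightarrow> 'a \<Rightarrow> 's"
  assumes S: "is_coproduct R I M S \<iota> TYPE('u)"
begin

lemma is_coproduct_inj: "i \<in> I \<Longrightarrow> \<iota> i \<in> Hom R (M i) S"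
  using S by (simp add: is_coproduct_def)

lemma is_coproduct_gen:
  assumes "right_submodule R S N" "\<And>i x. i \<in> I \<Longrightarrow> x \<in> carrier (M i) \<Longrightarrow> \<iota> i x \<in> N"
  shows "N = carrier S"
proof -
  have "\<forall>i\<in>I. \<iota> i ` carrier (M i) \<subseteq> N" using assms(2) by auto
  then show ?thesis using S assms(1) unfolding is_coproduct_def by blast
qed

lemma is_coproduct_Hom:
  fixes X :: "('r, 'u) module"
  assumes "X \<in> Mods R" "\<And>i. i \<in> I \<Longrightarrow> f i \<in> Hom R (M i) X"
  obtains h where "h \<in> Hom R S X" "\<And>i x. i \<in> I \<Longrightarrow> x \<in> carrier (M i) \<Longrightarrow> h (\<iota> i x) = f i x"
proof -
  have "\<forall>i\<in>I. f i \<in> Hom R (M i) X" using assms(2) by simp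
  then have "\<exists>h \<in> Hom R S X. \<forall>i\<in>I. \<forall>x\<in>carrier (M i). h (\<iota> i x) = f i x"
    using S assms(1) by (simp add: is_coproduct_def)
  then show thesis using that by blast
qed

text \<open>
The elements on which two homomorphisms agree form a submodule, and the coproduct is generated by
the summands.
\<close>

lemma is_coproduct_ext:
  assumes "f \<in> Hom R S X" "g \<in> Hom R S X" "right_module R S" "right_module R X"
    and "\<And>i x. i \<in> I \<Longrightarrow> x \<in> carrier (M i) \<Longrightarrow> f (\<iota> i x) = g (\<iota> i x)" and "s \<in> carrier S"
  shows "f s = g s"
proof -
  have "{s \<in> carrier S. f s = g s} = carrier S"
    using assms(5) Hom_closed[OF is_coproduct_inj]
    by (intro is_coproduct_gen right_submodule_equalizer[OF assms(1-4)]) auto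
  then show ?thesis using assms(6) by blast
qed

end

lemma is_coproduct_iso:
  fixes M :: "'i \<Rightarrow> ('r, 'a) module" and S :: "('r, 's) module" and S' :: "('r, 't) module"
  assumes S: "is_coproduct R I M S \<iota> TYPE('u)" and f: "f \<in> Hom R S S'" "bij_betw f (carrier S) (carrier S')"
    and mods: "\<And>i. i \<in> I \<Longrightarrow> right_module R (M i)" "right_module R S" "right_module R S'"
  shows "is_coproduct R I M S' (\<lambda>i. compose (carrier (M i)) f (\<iota> i)) TYPE('u)"
  unfolding is_coproduct_def
proof (intro conjI allI ballI impI)
  show "compose (carrier (M i)) f (\<iota> i) \<in> Hom R (M i) S'" if "i \<in> I" for i
    by (rule Hom_compose[OF is_coproduct_inj[OF S that] f(1) mods(1)[OF that]])
  note in_S = Hom_closed[OF is_coproduct_inj[OF S]]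
  fix N assume N: "right_submodule R S' N \<and> (\<forall>i\<in>I. compose (carrier (M i)) f (\<iota> i) ` carrier (M i) \<subseteq> N)"
  then have "compose (carrier (M i)) f (\<iota> i) x \<in> N" if "i \<in> I" "x \<in> carrier (M i)" for i x
    using that by blast
  then have "f (\<iota> i x) \<in> N" if "i \<in> I" "x \<in> carrier (M i)" for i x
    using that by (metis compose_eq)
  then have "{x \<in> carrier S. f x \<in> N} = carrier S"
    by (intro is_coproduct_gen[OF S right_submodule_preimage[OF f(1) mods(2,3)]])
      (use N in_S in auto)
  then have "f ` carrier S \<subseteq> N" by auto
  then show "N = carrier S'" using N f(2) by (auto simp: bij_betw_def right_submodule_def)
next
  obtain g where g: "g \<in> Hom R S' S" "\<And>x. x \<in> carrier S \<Longrightarrow> g (f x) = x" "\<And>y. y \<in> carrier S' \<Longrightarrow> f (g y) = y"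
    using Hom_inverse[OF f(1) mods(2,3) f(2)] by blast
  note in_S = Hom_closed[OF is_coproduct_inj[OF S]]
  fix X :: "('r, 'u) module" and k assume X: "X \<in> Mods R" and k: "\<forall>i\<in>I. k i \<in> Hom R (M i) X"
  obtain h where h: "h \<in> Hom R S X" "\<And>i x. i \<in> I \<Longrightarrow> x \<in> carrier (M i) \<Longrightarrow> h (\<iota> i x) = k i x"
    by (rule is_coproduct_Hom[OF S X, of k]) (use k in auto)
  have "compose (carrier S') h g (compose (carrier (M i)) f (\<iota> i) x) = k i x" if "i \<in> I" "x \<in> carrier (M i)" for i x
    using in_S[OF that] that Hom_closed[OF f(1)] by (simp add: compose_def g h)
  then show "\<exists>h\<in>Hom R S' X. \<forall>i\<in>I. \<forall>x\<in>carrier (M i). h (compose (carrier (M i)) f (\<iota> i) x) = k i x"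
    using Hom_compose[OF g(1) h(1) mods(3)] by blast
qed

lemma coproduct_exists:
  fixes M :: "'i \<Rightarrow> ('r, 'u) module"
  assumes univ: "is_universe TYPE('u)" and R: "ring R" and I: "I \<prec> (UNIV :: 'u set)"
    and M: "\<And>i. i \<in> I \<Longrightarrow> M i \<in> Mods R"
  obtains S :: "('r, 'u) module" and \<iota> f
  where "S \<in> Mods R" "is_coproduct R I M S \<iota> TYPE('u)"
    "f \<in> Hom R (direct_sum I M) S" "bij_betw f (carrier (direct_sum I M)) (carrier S)"
proof -
  note M' = Mods_right_module[OF M]
  note dm = direct_sum_right_module[of R I M, OF R M']
  obtain S :: "('r, 'u) module" and f where S: "S \<in> Mods R" "f \<in> Hom R (direct_sum I M) S"
      "bij_betw f (carrier (direct_sum I M)) (carrier S)"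
    by (rule copy_exists[OF dm direct_sum_small[OF univ I M]])
  show thesis
    by (rule that[OF S(1) is_coproduct_iso[OF direct_sum_is_coproduct[of R I M, OF R M'] S(2,3) M' dm
        Mods_right_module[OF S(1)]] S(2,3)])
qed

section \<open>Biproducts and pushouts\<close>

text \<open>
The four structure maps determine the module up to isomorphism, so the facts below hold for every
module isomorphic to \<^const>\<open>direct_sum2\<close>, whatever its carrier.
\<close>

definition is_biproduct :: "('r, 'm) ring_scheme \<Rightarrow> ('r, 'a) module \<Rightarrow> ('r, 'b) module \<Rightarrow> ('r, 's) module \<Rightarrow>
    ('a \<Rightarrow> 's) \<Rightarrow> ('b \<Rightarrow> 's) \<Rightarrow> ('s \<Rightarrow> 'a) \<Rightarrow> ('s \<Rightarrow> 'b) \<Rightarrow> bool"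
  where "is_biproduct R A B S i j p q \<longleftrightarrow>
    i \<in> Hom R A S \<and> j \<in> Hom R B S \<and> p \<in> Hom R S A \<and> q \<in> Hom R S B \<and>
    (\<forall>x\<in>carrier A. p (i x) = x \<and> q (i x) = \<zero>\<^bsub>B\<^esub>) \<and>
    (\<forall>y\<in>carrier B. p (j y) = \<zero>\<^bsub>A\<^esub> \<and> q (j y) = y) \<and>
    (\<forall>s\<in>carrier S. i (p s) \<oplus>\<^bsub>S\<^esub> j (q s) = s)"

lemma direct_sum2_simps:
  "carrier (direct_sum2 M N) = carrier M \<times> carrier N"
  "\<zero>\<^bsub>direct_sum2 M N\<^esub> = (\<zero>\<^bsub>M\<^esub>, \<zero>\<^bsub>N\<^esub>)"
  "(x, y) \<oplus>\<^bsub>direct_sum2 M N\<^esub> (x', y') = (x \<oplus>\<^bsub>M\<^esub> x', y \<oplus>\<^bsub>N\<^esub> y')"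
  "a \<odot>\<^bsub>direct_sum2 M N\<^esub> (x, y) = (a \<odot>\<^bsub>M\<^esub> x, a \<odot>\<^bsub>N\<^esub> y)"
  by (simp_all add: direct_sum2_def Let_def DirProd_def)

lemma direct_sum2_right_module:
  assumes "right_module R M" "right_module R N"
  shows "right_module R (direct_sum2 M N)"
proof -
  interpret M: right_module R M by fact
  interpret N: right_module R N by fact
  have "abelian_group (direct_sum2 M N)"
  proof (rule abelian_groupI)
    fix x assume "x \<in> carrier (direct_sum2 M N)"
    then show "\<exists>y\<in>carrier (direct_sum2 M N). y \<oplus>\<^bsub>direct_sum2 M N\<^esub> x = \<zero>\<^bsub>direct_sum2 M N\<^esub>"
      by (intro bexI[of _ "(\<ominus>\<^bsub>M\<^esub> fst x, \<ominus>\<^bsub>N\<^esub> snd x)"])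
        (auto simp: direct_sum2_simps M.M.l_neg N.M.l_neg)
  qed (auto simp: direct_sum2_simps M.M.a_ac N.M.a_ac)
  then show ?thesis
    by (intro right_moduleI M.R.ring_axioms)
      (auto simp: direct_sum2_simps M.smult_closed M.smult_l_distr M.smult_r_distr M.smult_assoc M.smult_one
        N.smult_closed N.smult_l_distr N.smult_r_distr N.smult_assoc N.smult_one)
qed

lemma direct_sum2_is_biproduct:
  assumes M: "right_module R M" and N: "right_module R N"
  shows "is_biproduct R M N (direct_sum2 M N) (\<lambda>x\<in>carrier M. (x, \<zero>\<^bsub>N\<^esub>)) (\<lambda>y\<in>carrier N. (\<zero>\<^bsub>M\<^esub>, y))
    (\<lambda>s\<in>carrier (direct_sum2 M N). fst s) (\<lambda>s\<in>carrier (direct_sum2 M N). snd s)"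
proof -
  interpret M: right_module R M by fact
  interpret N: right_module R N by fact
  show ?thesis unfolding is_biproduct_def
    by (intro conjI Hom_restrictI M N direct_sum2_right_module)
      (auto simp: direct_sum2_simps M.smult_r_null N.smult_r_null)
qed

lemma is_biproduct_iso:
  assumes S: "is_biproduct R A B S i j p q" and f: "f \<in> Hom R S T" "bij_betw f (carrier S) (carrier T)"
    and mods: "right_module R A" "right_module R B" "right_module R S" "right_module R T"
  obtains i' j' p' q' where "is_biproduct R A B T i' j' p' q'"
proof -
  obtain g where g: "g \<in> Hom R T S" "\<And>x. x \<in> carrier S \<Longrightarrow> g (f x) = x" "\<And>y. y \<in> carrier T \<Longrightarrow> f (g y) = y"
    using Hom_inverse[OF f(1) mods(3,4) f(2)] by blast
  have i: "i \<in> Hom R A S" and j: "j \<in> Hom R B S" and p: "p \<in> Hom R S A" and q: "q \<in> Hom R S B"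
    using S by (auto simp: is_biproduct_def)
  note homs = Hom_closed[OF i] Hom_closed[OF j] Hom_closed[OF p] Hom_closed[OF q] Hom_closed[OF f(1)] Hom_closed[OF g(1)]
  have "is_biproduct R A B T (compose (carrier A) f i) (compose (carrier B) f j)
      (compose (carrier T) p g) (compose (carrier T) q g)"
    using S unfolding is_biproduct_def
    by (auto simp: compose_def homs g simp flip: Hom_add[OF f(1)]
        intro!: Hom_compose[OF i f(1) mods(1), unfolded compose_def] Hom_compose[OF j f(1) mods(2), unfolded compose_def]
         Hom_compose[OF g(1) p mods(4), unfolded compose_def] Hom_compose[OF g(1) q mods(4), unfolded compose_def])
  then show thesis by (rule that)
qed

lemma direct_sum2_copy_exists:
  fixes A B :: "('r, 'u) module"
  assumes univ: "is_universe TYPE('u)" and A: "A \<in> Mods R" and B: "B \<in> Mods R"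
  obtains S :: "('r, 'u) module" where "S \<in> Mods R" "isomorphic R (direct_sum2 A B) S"
proof -
  note m = direct_sum2_right_module[OF A[THEN Mods_right_module] B[THEN Mods_right_module]]
  have "carrier (direct_sum2 A B) \<prec> (UNIV :: 'u set)"
    unfolding direct_sum2_simps using A B by (intro small_Times[OF univ]) (auto simp: Mods_def small_def)
  from copy_exists[OF m this] show thesis using that unfolding isomorphic_def by metis
qed

lemma isomorphic_direct_sum2_is_biproduct:
  assumes "isomorphic R (direct_sum2 A B) S" "right_module R A" "right_module R B" "right_module R S"
  obtains i j p q where "is_biproduct R A B S i j p q"
  using assms is_biproduct_iso[OF direct_sum2_is_biproduct _ _ assms(2,3) direct_sum2_right_module assms(4)]
  unfolding isomorphic_def by metis

lemma biproduct_exists: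
  fixes A B :: "('r, 'u) module"
  assumes univ: "is_universe TYPE('u)" and A: "A \<in> Mods R" and B: "B \<in> Mods R"
  obtains S :: "('r, 'u) module" and i j p q where "S \<in> Mods R" "is_biproduct R A B S i j p q"
  using direct_sum2_copy_exists[OF assms] isomorphic_direct_sum2_is_biproduct A B Mods_right_module by metis

lemma is_biproduct_Hom:
  assumes S: "is_biproduct R A B S i j p q" and f: "f \<in> Hom R A X" and g: "g \<in> Hom R B X"
    and mods: "right_module R A" "right_module R B" "right_module R S" "right_module R X"
  obtains h where "h \<in> Hom R S X" "\<And>x. x \<in> carrier A \<Longrightarrow> h (i x) = f x" "\<And>y. y \<in> carrier B \<Longrightarrow> h (j y) = g y"
proof -
  interpret X: right_module R X by fact
  interpret S: right_module R S by fact
  have i: "i \<in> Hom R A S" and j: "j \<in> Hom R B S" and p: "p \<in> Hom R S A" and q: "q \<in> Hom R S B"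
    using S by (auto simp: is_biproduct_def)
  note homs = Hom_closed[OF i] Hom_closed[OF j] Hom_closed[OF p] Hom_closed[OF q] Hom_closed[OF f] Hom_closed[OF g]
  define h where "h = (\<lambda>s\<in>carrier S. f (p s) \<oplus>\<^bsub>X\<^esub> g (q s))"
  have "h \<in> Hom R S X"
    using Hom_sum[OF Hom_compose[OF p f mods(3)] Hom_compose[OF q g mods(3)] mods(3,4)]
    by (simp add: h_def compose_def cong: restrict_cong)
  moreover have "h (i x) = f x" if "x \<in> carrier A" for x
    using that S Hom_zero[OF g mods(2,4)] by (auto simp: h_def is_biproduct_def homs)
  moreover have "h (j y) = g y" if "y \<in> carrier B" for y
    using that S Hom_zero[OF f mods(1,4)] by (auto simp: h_def is_biproduct_def homs)
  ultimately show thesis using that by blast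
qed

text \<open>
The pushout is the cokernel of \<open>a \<mapsto> (f a, - g a)\<close> into \<open>B \<oplus> C\<close>. Besides the universal property,
this construction shows that \<open>D\<close> is the sum of the images of \<open>B\<close> and \<open>C\<close>, and that elements of \<open>B\<close>
and \<open>C\<close> are identified in \<open>D\<close> only when they come from a common element of \<open>A\<close>.
\<close>

lemma pushout_exists:
  fixes A B C :: "('r, 'u) module"
  assumes univ: "is_universe TYPE('u)" and A: "A \<in> Mods R" and B: "B \<in> Mods R" and C: "C \<in> Mods R"
    and f: "f \<in> Hom R A B" and g: "g \<in> Hom R A C"
  obtains D :: "('r, 'u) module" and i j where "D \<in> Mods R" "is_pushout R A B C D f g i j"
    "\<And>d. d \<in> carrier D \<Longrightarrow> \<exists>b\<in>carrier B. \<exists>c\<in>carrier C. d = i b \<oplus>\<^bsub>D\<^esub> j c"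
    "\<And>b c. b \<in> carrier B \<Longrightarrow> c \<in> carrier C \<Longrightarrow> i b = j c \<Longrightarrow> \<exists>a\<in>carrier A. b = f a \<and> c = g a"
proof -
  note A' = Mods_right_module[OF A] and B' = Mods_right_module[OF B] and C' = Mods_right_module[OF C]
  interpret A: right_module R A by fact
  interpret B: right_module R B by fact
  interpret C: right_module R C by fact
  obtain S :: "('r, 'u) module" and s t p q where S: "S \<in> Mods R" "is_biproduct R B C S s t p q"
    using biproduct_exists[OF univ B C] by blast
  note S' = Mods_right_module[OF S(1)]
  interpret S: right_module R S by fact
  have s: "s \<in> Hom R B S" and t: "t \<in> Hom R C S" and p: "p \<in> Hom R S B" and q: "q \<in> Hom R S C"
    using S(2) by (auto simp: is_biproduct_def)
  note homs = Hom_closed[OF s] Hom_closed[OF t] Hom_closed[OF p] Hom_closed[OF q] Hom_closed[OF f] Hom_closed[OF g]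
  define u where "u = (\<lambda>a\<in>carrier A. s (f a) \<ominus>\<^bsub>S\<^esub> t (g a))"
  have u: "u \<in> Hom R A S" unfolding u_def
    using Hom_diff[OF Hom_compose[OF f s A'] Hom_compose[OF g t A'] A' S'] by (simp add: compose_def cong: restrict_cong)
  obtain D :: "('r, 'u) module" and \<pi> where D: "D \<in> Mods R" and ex: "right_exact R A u S \<pi> D"
    using cokernel_exists[OF u A' S(1)] by blast
  note D' = Mods_right_module[OF D]
  interpret D: right_module R D by fact
  have \<pi>: "\<pi> \<in> Epi R S D" and ker: "u ` carrier A = a_kernel S D \<pi>"
    using ex by (auto simp: right_exact_def)
  note \<pi>' = Epi_Hom[OF \<pi>]
  define i where "i = compose (carrier B) \<pi> s"
  define j where "j = compose (carrier C) \<pi> t"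
  have i: "i \<in> Hom R B D" and j: "j \<in> Hom R C D"
    unfolding i_def j_def by (rule Hom_compose[OF s \<pi>' B'] Hom_compose[OF t \<pi>' C'])+
  have ij: "\<And>b. b \<in> carrier B \<Longrightarrow> i b = \<pi> (s b)" "\<And>c. c \<in> carrier C \<Longrightarrow> j c = \<pi> (t c)"
    by (auto simp: i_def j_def compose_def)
  have comm: "i (f a) = j (g a)" if a: "a \<in> carrier A" for a
  proof -
    have "u a \<in> a_kernel S D \<pi>" using a ker by blast
    then have "\<pi> (s (f a) \<ominus>\<^bsub>S\<^esub> t (g a)) = \<zero>\<^bsub>D\<^esub>" using a by (simp add: a_kernel_def' u_def)
    then show ?thesis using a by (simp add: ij homs Hom_minus[OF \<pi>' S' D'] D.minus_zero_iff_eq Hom_closed[OF \<pi>'])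
  qed
  have gen: "\<exists>b\<in>carrier B. \<exists>c\<in>carrier C. d = i b \<oplus>\<^bsub>D\<^esub> j c" if d: "d \<in> carrier D" for d
  proof -
    obtain z where z: "z \<in> carrier S" "d = \<pi> z" using Epi_surj[OF \<pi> d] by blast
    then have "d = \<pi> (s (p z) \<oplus>\<^bsub>S\<^esub> t (q z))" using S(2) by (simp add: is_biproduct_def)
    then have "d = i (p z) \<oplus>\<^bsub>D\<^esub> j (q z)" using z by (simp add: Hom_add[OF \<pi>'] homs ij)
    then show ?thesis using z homs by blast
  qed
  have "is_pushout R A B C D f g i j" unfolding is_pushout_def
  proof (intro conjI ballI impI f g i j)
    show "compose (carrier A) i f = compose (carrier A) j g"
      using comm by (auto simp: compose_def intro!: restrict_ext)
    fix Z :: "('r, 'u) module" and i' j'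
    assume Z: "Z \<in> Mods R" and i': "i' \<in> Hom R B Z" and j': "j' \<in> Hom R C Z"
      and "compose (carrier A) i' f = compose (carrier A) j' g"
    then have eq: "i' (f a) = j' (g a)" if "a \<in> carrier A" for a
      using that by (metis compose_eq)
    note Z' = Mods_right_module[OF Z]
    interpret Z: right_module R Z by fact
    obtain k where k: "k \<in> Hom R S Z" "\<And>x. x \<in> carrier B \<Longrightarrow> k (s x) = i' x" "\<And>y. y \<in> carrier C \<Longrightarrow> k (t y) = j' y"
      by (rule is_biproduct_Hom[OF S(2) i' j' B' C' S' Z']) (erule that; simp)
    have k0: "k x = \<zero>\<^bsub>Z\<^esub>" if x: "x \<in> carrier S" "\<pi> x = \<zero>\<^bsub>D\<^esub>" for x
    proof -
      have "x \<in> u ` carrier A" using x ker by (simp add: a_kernel_def')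
      then obtain a where a: "a \<in> carrier A" "x = s (f a) \<ominus>\<^bsub>S\<^esub> t (g a)" by (auto simp: u_def)
      then show ?thesis
        using Hom_closed[OF j'] eq[of a]
        by (simp add: Hom_minus[OF k(1) S' Z'] homs k Z.minus_zero_iff_eq)
    qed
    obtain h where h: "h \<in> Hom R D Z" "\<And>x. x \<in> carrier S \<Longrightarrow> h (\<pi> x) = k x"
      by (rule Hom_factor_Epi[OF \<pi> k(1) S' D' Z' k0]) (assumption | erule that; simp)+
    show "\<exists>!h. h \<in> Hom R D Z \<and> compose (carrier B) h i = i' \<and> compose (carrier C) h j = j'"
    proof (rule ex1I[of _ h], intro conjI h)
      show "compose (carrier B) h i = i'"
        by (rule Hom_eqI[OF Hom_compose[OF i h(1) B'] i']) (simp add: compose_eq h ij k homs)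
      show "compose (carrier C) h j = j'"
        by (rule Hom_eqI[OF Hom_compose[OF j h(1) C'] j']) (simp add: compose_eq h ij k homs)
      fix h' assume h': "h' \<in> Hom R D Z \<and> compose (carrier B) h' i = i' \<and> compose (carrier C) h' j = j'"
      then have h'': "h' \<in> Hom R D Z" "h' (i b) = i' b" "h' (j c) = j' c" if "b \<in> carrier B" "c \<in> carrier C" for b c
        using that by (auto simp: compose_eq)
      have h''': "h (i b) = i' b" "h (j c) = j' c" if "b \<in> carrier B" "c \<in> carrier C" for b c
        using that by (auto simp: ij h k homs)
      show "h' = h"
      proof (rule Hom_eqI)
        show "h' \<in> Hom R D Z" using h' by blast
        fix d assume "d \<in> carrier D"
        then obtain b c where d: "b \<in> carrier B" "c \<in> carrier C" "d = i b \<oplus>\<^bsub>D\<^esub> j c" using gen by blast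
        then show "h' d = h d"
          using Hom_closed[OF i] Hom_closed[OF j] by (simp add: Hom_add[OF h(1)] Hom_add[OF h''(1)] h'' h''')
      qed (rule h)
    qed
  qed
  moreover have "\<exists>a\<in>carrier A. b = f a \<and> c = g a"
    if b: "b \<in> carrier B" and c: "c \<in> carrier C" and eq: "i b = j c" for b c
  proof -
    have "\<pi> (s b \<ominus>\<^bsub>S\<^esub> t c) = \<zero>\<^bsub>D\<^esub>"
      using that by (simp add: ij homs Hom_minus[OF \<pi>' S' D'] D.minus_zero_iff_eq Hom_closed[OF \<pi>'])
    then have "s b \<ominus>\<^bsub>S\<^esub> t c \<in> u ` carrier A" using b c by (simp add: ker a_kernel_def' homs)
    then obtain a where a: "a \<in> carrier A" "s b \<ominus>\<^bsub>S\<^esub> t c = s (f a) \<ominus>\<^bsub>S\<^esub> t (g a)" by (auto simp: u_def)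
    have pm: "p (s x \<ominus>\<^bsub>S\<^esub> t y) = x" "q (s x \<ominus>\<^bsub>S\<^esub> t y) = \<ominus>\<^bsub>C\<^esub> y" if "x \<in> carrier B" "y \<in> carrier C" for x y
      using that S(2)
      by (auto simp: Hom_minus[OF p S' B'] Hom_minus[OF q S' C'] homs is_biproduct_def a_minus_def[where R = B] a_minus_def[where R = C] B.M.add.inv_one)
    have "b = f a" using pm[OF b c] pm[of "f a" "g a"] a by (simp add: homs)
    moreover have "\<ominus>\<^bsub>C\<^esub> c = \<ominus>\<^bsub>C\<^esub> g a" using b c pm[OF b c] pm[of "f a" "g a"] a by (simp add: homs)
    then have "c = g a" using c a homs C.M.minus_minus by metis
    ultimately show ?thesis using a by blast
  qed
  ultimately show thesis using that[OF D] gen by blast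
qed
lemma is_biproductD:
  assumes "is_biproduct R A B S i j p q"
  shows "i \<in> Hom R A S" "j \<in> Hom R B S" "p \<in> Hom R S A" "q \<in> Hom R S B"
    "\<And>x. x \<in> carrier A \<Longrightarrow> p (i x) = x" "\<And>x. x \<in> carrier A \<Longrightarrow> q (i x) = \<zero>\<^bsub>B\<^esub>"
    "\<And>y. y \<in> carrier B \<Longrightarrow> p (j y) = \<zero>\<^bsub>A\<^esub>" "\<And>y. y \<in> carrier B \<Longrightarrow> q (j y) = y"
    "\<And>s. s \<in> carrier S \<Longrightarrow> i (p s) \<oplus>\<^bsub>S\<^esub> j (q s) = s"
  using assms unfolding is_biproduct_def by simp_all

lemma is_biproduct_ext:
  assumes S: "is_biproduct R A B S i j p q" and "s \<in> carrier S" "t \<in> carrier S" "p s = p t" "q s = q t"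
  shows "s = t"
proof -
  have "s = i (p s) \<oplus>\<^bsub>S\<^esub> j (q s)" by (rule is_biproductD(9)[OF S assms(2), symmetric])
  also have "\<dots> = t" unfolding assms(4,5) by (rule is_biproductD(9)[OF S assms(3)])
  finally show ?thesis .
qed

lemma is_biproduct_pair:
  assumes S: "is_biproduct R A B S i j p q" and ab: "a \<in> carrier A" "b \<in> carrier B"
    and A: "right_module R A" and B: "right_module R B" and S': "right_module R S"
  obtains s where "s \<in> carrier S" "p s = a" "q s = b"
proof -
  interpret A: right_module R A by fact
  interpret B: right_module R B by fact
  interpret S: right_module R S by fact
  note d = is_biproductD[OF S]
  note homs = Hom_closed[OF d(1)] Hom_closed[OF d(2)]
  show thesis
    by (rule that[of "i a \<oplus>\<^bsub>S\<^esub> j b"]) (simp_all add: homs ab d(5-8) Hom_add[OF d(3)] Hom_add[OF d(4)])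
qed

lemma is_biproduct_pairing:
  assumes S: "is_biproduct R A B S i j p q" and f: "f \<in> Hom R X A" and g: "g \<in> Hom R X B"
    and A: "right_module R A" and B: "right_module R B" and S': "right_module R S" and X: "right_module R X"
  obtains h where "h \<in> Hom R X S" "\<And>x. x \<in> carrier X \<Longrightarrow> p (h x) = f x" "\<And>x. x \<in> carrier X \<Longrightarrow> q (h x) = g x"
proof -
  interpret A: right_module R A by fact
  interpret B: right_module R B by fact
  interpret S: right_module R S by fact
  note d = is_biproductD[OF S]
  note homs = Hom_closed[OF d(1)] Hom_closed[OF d(2)] Hom_closed[OF f] Hom_closed[OF g]
  have "(\<lambda>x\<in>carrier X. i (f x) \<oplus>\<^bsub>S\<^esub> j (g x)) \<in> Hom R X S"
    using Hom_sum[OF Hom_compose[OF f d(1) X] Hom_compose[OF g d(2) X] X S']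
    by (simp add: compose_def cong: restrict_cong)
  then show thesis
    by (rule that) (simp_all add: homs d(5-8) Hom_add[OF d(3)] Hom_add[OF d(4)])
qed

section \<open>Projective modules\<close>

lemma projective_lift:
  fixes P A B :: "('r, 'u) module"
  assumes "projective R P" "A \<in> Mods R" "B \<in> Mods R" "p \<in> Epi R A B" "f \<in> Hom R P B"
  obtains g where "g \<in> Hom R P A" "\<And>x. x \<in> carrier P \<Longrightarrow> p (g x) = f x"
proof -
  obtain g where "g \<in> Hom R P A" "f = compose (carrier P) p g"
    using assms unfolding projective_def by meson
  then show thesis using that[of g] by (simp add: compose_eq)
qed

lemma projectiveI:
  fixes P :: "('r, 'u) module"
  assumes P: "P \<in> Mods R"
    and lift: "\<And>(A :: ('r, 'u) module) (B :: ('r, 'u) module) p f. \<lbrakk>A \<in> Mods R; B \<in> Mods R; p \<in> Epi R A B; f \<in> Hom R P B\<rbrakk>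
      \<Longrightarrow> \<exists>g\<in>Hom R P A. \<forall>x\<in>carrier P. p (g x) = f x"
  shows "projective R P"
  unfolding projective_def
proof (intro conjI ballI P)
  fix A B :: "('r, 'u) module" and p f
  assume *: "A \<in> Mods R" "B \<in> Mods R" "p \<in> Epi R A B" "f \<in> Hom R P B"
  then obtain g where g: "g \<in> Hom R P A" "\<forall>x\<in>carrier P. p (g x) = f x" using lift by metis
  have "f = compose (carrier P) p g"
    by (rule Hom_eqI[OF *(4) Hom_compose[OF g(1) Epi_Hom[OF *(3)] Mods_right_module[OF P]]])
      (use g(2) in \<open>simp add: compose_eq\<close>)
  then show "\<exists>g\<in>Hom R P A. f = compose (carrier P) p g" using g(1) by blast
qed

lemma projective_coproduct:
  fixes P :: "'i \<Rightarrow> ('r, 'u) module" and S :: "('r, 'u) module"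
  assumes S: "is_coproduct R I P S \<iota> TYPE('u)" and SM: "S \<in> Mods R" and P: "\<And>i. i \<in> I \<Longrightarrow> projective R (P i)"
  shows "projective R S"
proof (rule projectiveI[OF SM])
  fix A B :: "('r, 'u) module" and p f
  assume *: "A \<in> Mods R" "B \<in> Mods R" "p \<in> Epi R A B" "f \<in> Hom R S B"
  note A' = Mods_right_module[OF *(1)] and B' = Mods_right_module[OF *(2)] and S' = Mods_right_module[OF SM]
  have "\<exists>g. g \<in> Hom R (P i) A \<and> (\<forall>x\<in>carrier (P i). p (g x) = f (\<iota> i x))" if i: "i \<in> I" for i
  proof -
    have Pi: "right_module R (P i)" using P[OF i] by (simp add: projective_def Mods_def)
    have "compose (carrier (P i)) f (\<iota> i) \<in> Hom R (P i) B"
      by (rule Hom_compose[OF is_coproduct_inj[OF S i] *(4) Pi])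
    then obtain g where "g \<in> Hom R (P i) A" "\<And>x. x \<in> carrier (P i) \<Longrightarrow> p (g x) = compose (carrier (P i)) f (\<iota> i) x"
      using projective_lift[OF P[OF i] *(1-3)] by blast
    then show ?thesis by (metis compose_eq)
  qed
  then obtain g where g: "\<And>i. i \<in> I \<Longrightarrow> g i \<in> Hom R (P i) A" "\<And>i x. i \<in> I \<Longrightarrow> x \<in> carrier (P i) \<Longrightarrow> p (g i x) = f (\<iota> i x)"
    by metis
  obtain h where h: "h \<in> Hom R S A" "\<And>i x. i \<in> I \<Longrightarrow> x \<in> carrier (P i) \<Longrightarrow> h (\<iota> i x) = g i x"
    by (rule is_coproduct_Hom[OF S *(1), of g]) (use g in auto)
  have "compose (carrier S) p h s = f s" if s: "s \<in> carrier S" for s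
    by (rule is_coproduct_ext[OF S Hom_compose[OF h(1) Epi_Hom[OF *(3)] S'] *(4) S' B' _ s])
      (simp add: compose_eq Hom_closed[OF is_coproduct_inj[OF S]] h(2) g(2))
  then show "\<exists>g\<in>Hom R S A. \<forall>x\<in>carrier S. p (g x) = f x"
    using h(1) by (intro bexI[of _ h]) (auto simp: compose_eq)
qed

lemma projective_biproduct:
  fixes P Q S :: "('r, 'u) module"
  assumes S: "is_biproduct R P Q S i j s t" and SM: "S \<in> Mods R" and P: "projective R P" and Q: "projective R Q"
  shows "projective R S"
proof (rule projectiveI[OF SM])
  fix A B :: "('r, 'u) module" and p f
  assume *: "A \<in> Mods R" "B \<in> Mods R" "p \<in> Epi R A B" "f \<in> Hom R S B"
  note A' = Mods_right_module[OF *(1)] and B' = Mods_right_module[OF *(2)] and S' = Mods_right_module[OF SM]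
  have P': "right_module R P" and Q': "right_module R Q" using P Q by (simp_all add: projective_def Mods_def)
  note d = is_biproductD[OF S]
  note homs = Hom_closed[OF d(1)] Hom_closed[OF d(2)] Hom_closed[OF d(3)] Hom_closed[OF d(4)]
  obtain g where g: "g \<in> Hom R P A" "\<And>x. x \<in> carrier P \<Longrightarrow> p (g x) = compose (carrier P) f i x"
    using projective_lift[OF P *(1-3) Hom_compose[OF d(1) *(4) P']] by blast
  obtain h where h: "h \<in> Hom R Q A" "\<And>x. x \<in> carrier Q \<Longrightarrow> p (h x) = compose (carrier Q) f j x"
    using projective_lift[OF Q *(1-3) Hom_compose[OF d(2) *(4) Q']] by blast
  obtain k where k: "k \<in> Hom R S A" "\<And>x. x \<in> carrier P \<Longrightarrow> k (i x) = g x" "\<And>y. y \<in> carrier Q \<Longrightarrow> k (j y) = h y"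
    by (rule is_biproduct_Hom[OF S g(1) h(1) P' Q' S' A']) (erule that; simp)
  have "p (k x) = f x" if x: "x \<in> carrier S" for x
  proof -
    have "p (k (i (s x) \<oplus>\<^bsub>S\<^esub> j (t x))) = f (i (s x) \<oplus>\<^bsub>S\<^esub> j (t x))"
      using x Hom_closed[OF g(1)] Hom_closed[OF h(1)]
      by (simp add: homs Hom_add[OF k(1)] k Hom_add[OF Epi_Hom[OF *(3)]] Hom_add[OF *(4)] g(2) h(2) compose_eq)
    then show ?thesis using d(9)[OF x] by simp
  qed
  then show "\<exists>g\<in>Hom R S A. \<forall>x\<in>carrier S. p (g x) = f x" using k(1) by blast
qed

text \<open>
Lifting along a homomorphism that is not surjective: its image, taken as a module of its own, is an
epimorphic image of \<open>X\<close>.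
\<close>

lemma projective_lift_range:
  fixes P X M :: "('r, 'u) module"
  assumes P: "projective R P" and X: "X \<in> Mods R" and M': "right_module R M"
    and \<epsilon>: "\<epsilon> \<in> Hom R X M" and d: "d \<in> Hom R P M"
    and range: "\<And>x. x \<in> carrier P \<Longrightarrow> \<exists>y\<in>carrier X. d x = \<epsilon> y"
  obtains h where "h \<in> Hom R P X" "\<And>x. x \<in> carrier P \<Longrightarrow> \<epsilon> (h x) = d x"
proof -
  note X' = Mods_right_module[OF X]
  have PM: "P \<in> Mods R" using P by (simp add: projective_def)
  interpret P: right_module R P by (rule Mods_right_module[OF PM])
  interpret X: right_module R X by (rule X')
  interpret M: right_module R M by (rule M')
  obtain I :: "('r, 'u) module" where I: "right_module R I" "carrier I = \<epsilon> ` carrier X" "restrict \<epsilon> (carrier X) \<in> Epi R X I"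
    by (rule right_module_image[OF X', of \<epsilon>]) (auto simp: Hom_add[OF \<epsilon>] Hom_smult[OF \<epsilon>])
  have "restrict \<epsilon> (carrier X) = \<epsilon>" using Hom_extensional[OF \<epsilon>] by (rule extensional_restrict)
  then have \<epsilon>I: "\<epsilon> \<in> Epi R X I" using I(3) by simp
  note \<epsilon>I' = Epi_Hom[OF \<epsilon>I]
  have "carrier I \<prec> (UNIV :: 'u set)"
    unfolding I(2) by (rule lesspoll_trans1[OF image_lepoll]) (use X in \<open>simp add: Mods_def small_def\<close>)
  then have IM: "I \<in> Mods R" using I(1) by (simp add: Mods_def small_def)
  \<comment> \<open>the operations of the image are those of \<open>M\<close>\<close>
  have I_ops: "\<epsilon> x \<oplus>\<^bsub>I\<^esub> \<epsilon> y = \<epsilon> x \<oplus>\<^bsub>M\<^esub> \<epsilon> y" "a \<odot>\<^bsub>I\<^esub> \<epsilon> x = a \<odot>\<^bsub>M\<^esub> \<epsilon> x"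
    if "a \<in> carrier R" "x \<in> carrier X" "y \<in> carrier X" for a x y
    using that Hom_add[OF \<epsilon>] Hom_add[OF \<epsilon>I'] Hom_smult[OF \<epsilon>] Hom_smult[OF \<epsilon>I'] by simp_all
  have "d \<in> Hom R P I"
  proof (rule Hom_memI)
    fix x assume x: "x \<in> carrier P"
    obtain x' where x': "x' \<in> carrier X" "d x = \<epsilon> x'" using range[OF x] by blast
    then show "d x \<in> carrier I" by (simp add: I(2))
    show "d (a \<odot>\<^bsub>P\<^esub> x) = a \<odot>\<^bsub>I\<^esub> d x" if "a \<in> carrier R" for a
      using that x x' I_ops(2)[OF that x'(1) x'(1)] by (simp add: Hom_smult[OF d])
    fix y assume y: "y \<in> carrier P"
    obtain y' where y': "y' \<in> carrier X" "d y = \<epsilon> y'" using range[OF y] by blast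
    show "d (x \<oplus>\<^bsub>P\<^esub> y) = d x \<oplus>\<^bsub>I\<^esub> d y"
      using x y x' y' I_ops(1)[OF P.R.one_closed x'(1) y'(1)] by (simp add: Hom_add[OF d])
  qed (rule Hom_extensional[OF d])
  then show thesis
    by (rule projective_lift[OF P X IM \<epsilon>I]) (erule that; simp)
qed

lemma regular_module_simps:
  "carrier (regular_module R) = carrier R" "\<zero>\<^bsub>regular_module R\<^esub> = \<zero>\<^bsub>R\<^esub>"
  "x \<oplus>\<^bsub>regular_module R\<^esub> y = x \<oplus>\<^bsub>R\<^esub> y" "a \<odot>\<^bsub>regular_module R\<^esub> x = x \<otimes>\<^bsub>R\<^esub> a"
  by (simp_all add: regular_module_def)

lemma regular_module_right_module:
  assumes "ring R" shows "right_module R (regular_module R)"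
proof -
  interpret ring R by fact
  have "abelian_group (regular_module R)"
  proof (rule abelian_groupI)
    fix x assume "x \<in> carrier (regular_module R)"
    then show "\<exists>y\<in>carrier (regular_module R). y \<oplus>\<^bsub>regular_module R\<^esub> x = \<zero>\<^bsub>regular_module R\<^esub>"
      by (intro bexI[of _ "\<ominus>\<^bsub>R\<^esub> x"]) (auto simp: regular_module_simps l_neg)
  qed (auto simp: regular_module_simps a_ac)
  then show ?thesis
    by (intro right_moduleI assms) (auto simp: regular_module_simps l_distr r_distr m_assoc)
qed

text \<open>
Free of rank one, in the form in which it is used: \<open>F\<close> is cyclic with generator \<open>u\<close>, and \<open>u\<close> can be
sent to any element of any module.
\<close>

definition free_on :: "('r, 'm) ring_scheme \<Rightarrow> ('r, 'u) module \<Rightarrow> 'u \<Rightarrow> bool"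
  where "free_on R F u \<longleftrightarrow> F \<in> Mods R \<and> u \<in> carrier F \<and> (\<forall>y\<in>carrier F. \<exists>a\<in>carrier R. y = a \<odot>\<^bsub>F\<^esub> u) \<and>
    (\<forall>X \<in> (Mods R :: ('r, 'u) module set). \<forall>x\<in>carrier X. \<exists>f\<in>Hom R F X. f u = x)"

lemma free_on_projective:
  fixes F :: "('r, 'u) module"
  assumes F: "free_on R F u" shows "projective R F"
proof (rule projectiveI)
  show "F \<in> Mods R" using F by (simp add: free_on_def)
  have u: "u \<in> carrier F" using F by (simp add: free_on_def)
  fix A B :: "('r, 'u) module" and p f
  assume *: "A \<in> Mods R" "B \<in> Mods R" "p \<in> Epi R A B" "f \<in> Hom R F B"
  obtain x where x: "x \<in> carrier A" "f u = p x" using Epi_surj[OF *(3) Hom_closed[OF *(4) u]] by blast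
  obtain g where g: "g \<in> Hom R F A" "g u = x" using F *(1) x(1) unfolding free_on_def by blast
  have "p (g y) = f y" if "y \<in> carrier F" for y
  proof -
    obtain a where a: "a \<in> carrier R" "y = a \<odot>\<^bsub>F\<^esub> u" using F \<open>y \<in> carrier F\<close> unfolding free_on_def by blast
    then show ?thesis using u x by (simp add: Hom_smult[OF g(1)] Hom_smult[OF *(4)] Hom_smult[OF Epi_Hom[OF *(3)]] g(2))
  qed
  then show "\<exists>g\<in>Hom R F A. \<forall>x\<in>carrier F. p (g x) = f x" using g(1) by blast
qed

lemma regular_module_copy_free_on:
  fixes F :: "('r, 'u) module"
  assumes R: "ring R" and F: "F \<in> Mods R" and \<phi>: "\<phi> \<in> Hom R (regular_module R) F" "bij_betw \<phi> (carrier R) (carrier F)"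
  shows "free_on R F (\<phi> \<one>\<^bsub>R\<^esub>)"
  unfolding free_on_def
proof (intro conjI ballI F)
  interpret ring R by fact
  note rm = regular_module_right_module[OF R]
  note F' = Mods_right_module[OF F]
  have bij: "bij_betw \<phi> (carrier (regular_module R)) (carrier F)" using \<phi>(2) by (simp add: regular_module_simps)
  obtain \<psi> where \<psi>: "\<psi> \<in> Hom R F (regular_module R)" "\<And>x. x \<in> carrier (regular_module R) \<Longrightarrow> \<psi> (\<phi> x) = x"
      "\<And>y. y \<in> carrier F \<Longrightarrow> \<phi> (\<psi> y) = y"
    by (rule Hom_inverse[OF \<phi>(1) rm F' bij]) (erule that; simp)
  show "\<phi> \<one>\<^bsub>R\<^esub> \<in> carrier F" using Hom_closed[OF \<phi>(1)] by (simp add: regular_module_simps)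
  show "\<exists>a\<in>carrier R. y = a \<odot>\<^bsub>F\<^esub> \<phi> \<one>\<^bsub>R\<^esub>" if y: "y \<in> carrier F" for y
  proof (rule bexI[of _ "\<psi> y"])
    show a: "\<psi> y \<in> carrier R" using Hom_closed[OF \<psi>(1) y] by (simp add: regular_module_simps)
    then show "y = \<psi> y \<odot>\<^bsub>F\<^esub> \<phi> \<one>\<^bsub>R\<^esub>"
      using Hom_smult[OF \<phi>(1) a, of "\<one>\<^bsub>R\<^esub>"] \<psi>(3)[OF y] by (simp add: regular_module_simps)
  qed
  fix X :: "('r, 'u) module" and x assume X: "X \<in> Mods R" and x: "x \<in> carrier X"
  interpret X: right_module R X by (rule Mods_right_module[OF X])
  have "(\<lambda>a\<in>carrier (regular_module R). a \<odot>\<^bsub>X\<^esub> x) \<in> Hom R (regular_module R) X"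
    by (rule Hom_restrictI[OF rm]) (use x in \<open>auto simp: regular_module_simps X.smult_closed X.smult_l_distr X.smult_assoc\<close>)
  from Hom_compose[OF \<psi>(1) this F'] show "\<exists>f\<in>Hom R F X. f (\<phi> \<one>\<^bsub>R\<^esub>) = x"
    by (rule bexI[rotated]) (use x Hom_closed[OF \<phi>(1)] in \<open>auto simp: compose_eq regular_module_simps \<psi> X.smult_one\<close>)
qed

section \<open>Generated classes and the classes of a projective map\<close>

text \<open>
If the images of all homomorphisms \<open>T \<rightarrow> X\<close> generate \<open>X\<close>, then the sum of all of them is an
epimorphism from the direct sum of copies of \<open>T\<close> indexed by the set of these homomorphisms. That
set is small, and \<open>J\<close> is a copy of it in the universe.
\<close>

lemma Gen_trace:
  fixes X T :: "('r, 'u) module"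
  assumes univ: "is_universe TYPE('u)" and X: "X \<in> Mods R" and T: "T \<in> Mods R"
    and trace: "\<And>N. right_submodule R X N \<Longrightarrow> (\<And>f. f \<in> Hom R T X \<Longrightarrow> f ` carrier T \<subseteq> N) \<Longrightarrow> N = carrier X"
  shows "X \<in> Gen R T"
proof -
  note X' = Mods_right_module[OF X] and T' = Mods_right_module[OF T]
  interpret X: right_module R X by fact
  have small: "Hom R T X \<prec> (UNIV :: 'u set)"
    by (rule small_function_space[OF univ, of "carrier T" "carrier X"])
      (use X T in \<open>auto simp: Mods_def small_def Hom_extensional dest: Hom_closed\<close>)
  then obtain e :: "('u \<Rightarrow> 'u) \<Rightarrow> 'u" where e: "inj_on e (Hom R T X)"
    unfolding lesspoll_def lepoll_def by blast
  define J where "J = e ` Hom R T X"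
  have J: "small J" using small e unfolding J_def small_def by simp
  define f where "f = inv_into (Hom R T X) e"
  have f: "f j \<in> Hom R T X" if "j \<in> J" for j
    using that unfolding J_def f_def by (rule inv_into_into)
  have f_surj: "\<exists>j\<in>J. g = f j" if "g \<in> Hom R T X" for g
    using that e unfolding J_def f_def by force
  note cop = direct_sum_is_coproduct[of R J "\<lambda>_. T", OF X.R.ring_axioms T', where 'u = 'u]
  let ?S = "direct_sum J (\<lambda>_. T)"
  note S' = direct_sum_right_module[of R J "\<lambda>_. T", OF X.R.ring_axioms T']
  define \<iota> where "\<iota> i = (\<lambda>x\<in>carrier T. \<lambda>j\<in>J. if j = i then x else \<zero>\<^bsub>T\<^esub>)" for i
  have cop: "is_coproduct R J (\<lambda>_. T) ?S \<iota> TYPE('u)" using cop unfolding \<iota>_def by simp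
  obtain h where h: "h \<in> Hom R ?S X" "\<And>i x. i \<in> J \<Longrightarrow> x \<in> carrier T \<Longrightarrow> h (\<iota> i x) = f i x"
    by (rule is_coproduct_Hom[OF cop X, of f]) (use f in auto)
  have "h ` carrier ?S = carrier X"
  proof (rule trace[OF right_submodule_image[OF h(1) S' X']])
    fix g assume "g \<in> Hom R T X"
    then obtain j where j: "j \<in> J" "g = f j" using f_surj by blast
    show "g ` carrier T \<subseteq> h ` carrier ?S"
    proof
      fix y assume "y \<in> g ` carrier T"
      then obtain x where "x \<in> carrier T" "y = h (\<iota> j x)" using j h(2) by auto
      then show "y \<in> h ` carrier ?S" using Hom_closed[OF is_coproduct_inj[OF cop j(1)]] by blast
    qed
  qed
  then have "h \<in> Epi R ?S X" using h(1) by (simp add: Epi_def)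
  then show ?thesis using X J unfolding Gen_def by blast
qed

lemma torsion_classD:
  fixes \<T> :: "('r, 'u) module set" and I :: "'u set"
  assumes "torsion_class R \<T>"
  shows "\<T> \<subseteq> Mods R"
    and "X \<in> \<T> \<Longrightarrow> Y \<in> Mods R \<Longrightarrow> f \<in> Epi R X Y \<Longrightarrow> Y \<in> \<T>"
    and "small I \<Longrightarrow> (\<And>i. i \<in> I \<Longrightarrow> A i \<in> \<T>) \<Longrightarrow> Y \<in> Mods R \<Longrightarrow> isomorphic R (direct_sum I A) Y \<Longrightarrow> Y \<in> \<T>"
    and "X \<in> \<T> \<Longrightarrow> Z \<in> \<T> \<Longrightarrow> Y \<in> Mods R \<Longrightarrow> short_exact R X f Y g Z \<Longrightarrow> Y \<in> \<T>"
proof -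
  note t = assms[unfolded torsion_class_def]
  show "\<T> \<subseteq> Mods R" using t by (rule conjunct1)
  show "X \<in> \<T> \<Longrightarrow> Y \<in> Mods R \<Longrightarrow> f \<in> Epi R X Y \<Longrightarrow> Y \<in> \<T>"
    using t[THEN conjunct2, THEN conjunct2, THEN conjunct1] by blast
  show "small I \<Longrightarrow> (\<And>i. i \<in> I \<Longrightarrow> A i \<in> \<T>) \<Longrightarrow> Y \<in> Mods R \<Longrightarrow> isomorphic R (direct_sum I A) Y \<Longrightarrow> Y \<in> \<T>"
    by (rule t[THEN conjunct2, THEN conjunct2, THEN conjunct2, THEN conjunct1, rule_format, of Y I A]) auto
  show "X \<in> \<T> \<Longrightarrow> Z \<in> \<T> \<Longrightarrow> Y \<in> Mods R \<Longrightarrow> short_exact R X f Y g Z \<Longrightarrow> Y \<in> \<T>"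
    using t[THEN conjunct2, THEN conjunct2, THEN conjunct2, THEN conjunct2] by blast
qed

lemma Gen_subset_torsion_class:
  fixes T :: "('r, 'u) module" and \<T> :: "('r, 'u) module set"
  assumes univ: "is_universe TYPE('u)" and R: "ring R" and \<T>: "torsion_class R \<T>" and T: "T \<in> \<T>"
  shows "Gen R T \<subseteq> \<T>"
proof
  fix X assume "X \<in> Gen R T"
  then obtain I :: "'u set" and e where X: "X \<in> Mods R" and I: "small I" and e: "e \<in> Epi R (direct_sum I (\<lambda>_. T)) X"
    unfolding Gen_def by blast
  let ?D = "direct_sum I (\<lambda>_. T)"
  have TM: "T \<in> Mods R" using torsion_classD(1)[OF \<T>] T by blast
  have I': "I \<prec> (UNIV :: 'u set)" using I by (simp add: small_def)
  note D' = direct_sum_right_module[of R I "\<lambda>_. T", OF R Mods_right_module[OF TM]]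
  obtain S :: "('r, 'u) module" and f where S: "S \<in> Mods R" and f: "f \<in> Hom R ?D S" "bij_betw f (carrier ?D) (carrier S)"
    by (rule copy_exists[OF D' direct_sum_small[OF univ I' TM]])
  have "isomorphic R ?D S" using f by (auto simp: isomorphic_def)
  then have S\<T>: "S \<in> \<T>" using torsion_classD(3)[OF \<T> I, of "\<lambda>_. T"] T S by simp
  obtain g where g: "g \<in> Hom R S ?D" "\<And>x. x \<in> carrier ?D \<Longrightarrow> g (f x) = x" "\<And>y. y \<in> carrier S \<Longrightarrow> f (g y) = y"
    by (rule Hom_inverse[OF f(1) D' Mods_right_module[OF S] f(2)]) (erule that; simp)
  have "compose (carrier S) e g \<in> Epi R S X"
  proof (rule EpiI[OF Hom_compose[OF g(1) Epi_Hom[OF e] Mods_right_module[OF S]]])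
    fix y assume "y \<in> carrier X"
    then obtain x where x: "x \<in> carrier ?D" "y = e x" using Epi_surj[OF e] by blast
    then show "\<exists>s\<in>carrier S. y = compose (carrier S) e g s"
      using Hom_closed[OF f(1) x(1)] g(2)[OF x(1)] by (intro bexI[of _ "f x"]) (auto simp: compose_eq)
  qed
  then show "X \<in> \<T>" by (rule torsion_classD(2)[OF \<T> S\<T> X])
qed

lemma D_class_iff:
  assumes P: "right_module R P" and \<sigma>: "\<sigma> \<in> Hom R P Q"
  shows "X \<in> D_class R (P, \<sigma>, Q) \<longleftrightarrow>
    X \<in> Mods R \<and> (\<forall>f\<in>Hom R P X. \<exists>g\<in>Hom R Q X. \<forall>x\<in>carrier P. f x = g (\<sigma> x))"
proof -
  have eq: "f = compose (carrier P) g \<sigma> \<longleftrightarrow> (\<forall>x\<in>carrier P. f x = g (\<sigma> x))"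
    if "f \<in> Hom R P X" "g \<in> Hom R Q X" for f g
    using Hom_eqI[OF that(1) Hom_compose[OF \<sigma> that(2) P]] by (auto simp: compose_eq)
  have "(\<lambda>h. compose (carrier P) h \<sigma>) ` Hom R Q X \<subseteq> Hom R P X"
    using Hom_compose[OF \<sigma> _ P] by blast
  then have "(\<lambda>h. compose (carrier P) h \<sigma>) ` Hom R Q X = Hom R P X \<longleftrightarrow>
      (\<forall>f\<in>Hom R P X. \<exists>g\<in>Hom R Q X. f = compose (carrier P) g \<sigma>)"
    by blast
  then show ?thesis using eq by (simp add: D_class_def)
qed
section \<open>Transport along isomorphisms\<close>

context
  fixes R :: "('r, 'm) ring_scheme" and X :: "('r, 'x) module" and Y :: "('r, 'y) module" and \<phi> :: "'x \<Rightarrow> 'y" and \<psi> :: "'y \<Rightarrow> 'x"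
  assumes X: "right_module R X" and Y: "right_module R Y"
    and \<phi>: "\<phi> \<in> Hom R X Y" and \<psi>: "\<psi> \<in> Hom R Y X"
    and \<psi>\<phi>: "\<And>x. x \<in> carrier X \<Longrightarrow> \<psi> (\<phi> x) = x" and \<phi>\<psi>: "\<And>y. y \<in> carrier Y \<Longrightarrow> \<phi> (\<psi> y) = y"
begin

lemma preenvelope_transport:
  assumes "preenvelope R \<T> X \<epsilon> M"
  shows "preenvelope R \<T> Y (compose (carrier Y) \<epsilon> \<psi>) M"
  unfolding preenvelope_def
proof (intro conjI ballI)
  have \<epsilon>: "\<epsilon> \<in> Hom R X M" and M: "M \<in> \<T>" using assms by (auto simp: preenvelope_def)
  then show "M \<in> \<T>" by simp
  show "compose (carrier Y) \<epsilon> \<psi> \<in> Hom R Y M" by (rule Hom_compose[OF \<psi> \<epsilon> Y])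
  fix T' f assume T': "T' \<in> \<T>" and f: "f \<in> Hom R Y T'"
  have "compose (carrier X) f \<phi> \<in> Hom R X T'" by (rule Hom_compose[OF \<phi> f X])
  then obtain g where g: "g \<in> Hom R M T'" "compose (carrier X) f \<phi> = compose (carrier X) g \<epsilon>"
    using assms T' unfolding preenvelope_def by meson
  have "f = compose (carrier Y) g (compose (carrier Y) \<epsilon> \<psi>)"
  proof (rule Hom_eqI[OF f Hom_compose[OF Hom_compose[OF \<psi> \<epsilon> Y] g(1) Y]])
    fix y assume y: "y \<in> carrier Y"
    have "compose (carrier X) f \<phi> (\<psi> y) = compose (carrier X) g \<epsilon> (\<psi> y)" using g(2) by simp
    then show "f y = compose (carrier Y) g (compose (carrier Y) \<epsilon> \<psi>) y"
      using y Hom_closed[OF \<psi> y] \<phi>\<psi>[OF y] by (simp add: compose_eq)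
  qed
  then show "\<exists>g\<in>Hom R M T'. f = compose (carrier Y) g (compose (carrier Y) \<epsilon> \<psi>)" using g(1) by blast
qed

lemma pushout_diagram_transport:
  fixes L\<^sub>1 L\<^sub>0 M K :: "('r, 'u) module"
  assumes diag: "pushout_diagram R \<T> L\<^sub>1 \<rho> L\<^sub>0 l \<delta> \<beta> X \<epsilon> M \<kappa> K"
  shows "pushout_diagram R \<T> L\<^sub>1 \<rho> L\<^sub>0 l (compose (carrier L\<^sub>1) \<phi> \<delta>) \<beta> Y (compose (carrier Y) \<epsilon> \<psi>) M \<kappa> K"
proof -
  have ex: "right_exact R X \<epsilon> M \<kappa> K" and po: "is_pushout R L\<^sub>1 X L\<^sub>0 M \<delta> \<rho> \<epsilon> \<beta>"
    and box: "(L\<^sub>1, \<rho>, L\<^sub>0) \<in> box_class R \<T>"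
    using diag by (simp_all add: pushout_diagram_def)
  have L\<^sub>1: "right_module R L\<^sub>1" using box by (simp add: box_class_def proj_maps_def projective_def Mods_def)
  have \<epsilon>: "\<epsilon> \<in> Hom R X M" and \<delta>: "\<delta> \<in> Hom R L\<^sub>1 X" and \<rho>: "\<rho> \<in> Hom R L\<^sub>1 L\<^sub>0" and \<beta>: "\<beta> \<in> Hom R L\<^sub>0 M"
    and comm: "compose (carrier L\<^sub>1) \<epsilon> \<delta> = compose (carrier L\<^sub>1) \<beta> \<rho>"
    using po by (simp_all add: is_pushout_def)
  have univ: "\<exists>!h. h \<in> Hom R M Z \<and> compose (carrier X) h \<epsilon> = i' \<and> compose (carrier L\<^sub>0) h \<beta> = j'"
    if "Z \<in> Mods R" "i' \<in> Hom R X Z" "j' \<in> Hom R L\<^sub>0 Z" "compose (carrier L\<^sub>1) i' \<delta> = compose (carrier L\<^sub>1) j' \<rho>"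
    for Z :: "('r, 'u) module" and i' j'
  proof -
    have "\<forall>Z \<in> (Mods R :: ('r, 'u) module set). \<forall>i' \<in> Hom R X Z. \<forall>j' \<in> Hom R L\<^sub>0 Z.
       compose (carrier L\<^sub>1) i' \<delta> = compose (carrier L\<^sub>1) j' \<rho> \<longrightarrow>
       (\<exists>!h. h \<in> Hom R M Z \<and> compose (carrier X) h \<epsilon> = i' \<and> compose (carrier L\<^sub>0) h \<beta> = j')"
      using po unfolding is_pushout_def by (elim conjE)
    from this[rule_format, OF that] show ?thesis .
  qed
  have im: "compose (carrier Y) \<epsilon> \<psi> ` carrier Y = \<epsilon> ` carrier X"
  proof
    show "compose (carrier Y) \<epsilon> \<psi> ` carrier Y \<subseteq> \<epsilon> ` carrier X"
      using Hom_closed[OF \<psi>] by (auto simp: compose_eq)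
    show "\<epsilon> ` carrier X \<subseteq> compose (carrier Y) \<epsilon> \<psi> ` carrier Y"
    proof
      fix m assume "m \<in> \<epsilon> ` carrier X"
      then obtain x where x: "x \<in> carrier X" "m = \<epsilon> x" by blast
      then have "m = compose (carrier Y) \<epsilon> \<psi> (\<phi> x)" using Hom_closed[OF \<phi>] by (simp add: compose_eq \<psi>\<phi>)
      then show "m \<in> compose (carrier Y) \<epsilon> \<psi> ` carrier Y" using Hom_closed[OF \<phi> x(1)] by blast
    qed
  qed
  have "is_pushout R L\<^sub>1 Y L\<^sub>0 M (compose (carrier L\<^sub>1) \<phi> \<delta>) \<rho> (compose (carrier Y) \<epsilon> \<psi>) \<beta>"
    unfolding is_pushout_def
  proof (intro conjI ballI impI \<rho> \<beta> Hom_compose[OF \<delta> \<phi> L\<^sub>1] Hom_compose[OF \<psi> \<epsilon> Y])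
    have "compose (carrier L\<^sub>1) (compose (carrier Y) \<epsilon> \<psi>) (compose (carrier L\<^sub>1) \<phi> \<delta>) = compose (carrier L\<^sub>1) \<epsilon> \<delta>"
      using Hom_closed[OF \<delta>] Hom_closed[OF \<phi>] by (simp add: compose_def \<psi>\<phi> cong: restrict_cong)
    then show "compose (carrier L\<^sub>1) (compose (carrier Y) \<epsilon> \<psi>) (compose (carrier L\<^sub>1) \<phi> \<delta>) = compose (carrier L\<^sub>1) \<beta> \<rho>"
      using comm by simp
    fix Z :: "('r, 'u) module" and i' j'
    assume Z: "Z \<in> Mods R" and i': "i' \<in> Hom R Y Z" and j': "j' \<in> Hom R L\<^sub>0 Z"
      and eq: "compose (carrier L\<^sub>1) i' (compose (carrier L\<^sub>1) \<phi> \<delta>) = compose (carrier L\<^sub>1) j' \<rho>"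
    have "compose (carrier L\<^sub>1) (compose (carrier X) i' \<phi>) \<delta> = compose (carrier L\<^sub>1) i' (compose (carrier L\<^sub>1) \<phi> \<delta>)"
      using Hom_closed[OF \<delta>] by (simp add: compose_def cong: restrict_cong)
    then have ex1: "\<exists>!h. h \<in> Hom R M Z \<and> compose (carrier X) h \<epsilon> = compose (carrier X) i' \<phi> \<and> compose (carrier L\<^sub>0) h \<beta> = j'"
      using univ[OF Z Hom_compose[OF \<phi> i' X] j'] eq by simp
    have "compose (carrier X) h \<epsilon> = compose (carrier X) i' \<phi> \<longleftrightarrow> compose (carrier Y) h (compose (carrier Y) \<epsilon> \<psi>) = i'"
      if h: "h \<in> Hom R M Z" for h
    proof
      assume *: "compose (carrier X) h \<epsilon> = compose (carrier X) i' \<phi>"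
      show "compose (carrier Y) h (compose (carrier Y) \<epsilon> \<psi>) = i'"
      proof (rule Hom_eqI[OF Hom_compose[OF Hom_compose[OF \<psi> \<epsilon> Y] h Y] i'])
        fix y assume y: "y \<in> carrier Y"
        have "compose (carrier X) h \<epsilon> (\<psi> y) = compose (carrier X) i' \<phi> (\<psi> y)" using * by simp
        then show "compose (carrier Y) h (compose (carrier Y) \<epsilon> \<psi>) y = i' y"
          using y Hom_closed[OF \<psi> y] \<phi>\<psi>[OF y] by (simp add: compose_eq)
      qed
    next
      assume *: "compose (carrier Y) h (compose (carrier Y) \<epsilon> \<psi>) = i'"
      show "compose (carrier X) h \<epsilon> = compose (carrier X) i' \<phi>"
        unfolding *[symmetric] using Hom_closed[OF \<phi>] by (simp add: compose_def \<psi>\<phi> cong: restrict_cong)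
    qed
    with ex1 show "\<exists>!h. h \<in> Hom R M Z \<and> compose (carrier Y) h (compose (carrier Y) \<epsilon> \<psi>) = i' \<and> compose (carrier L\<^sub>0) h \<beta> = j'"
      by (metis (no_types, lifting))
  qed
  moreover have "right_exact R Y (compose (carrier Y) \<epsilon> \<psi>) M \<kappa> K"
    using ex im Hom_compose[OF \<psi> \<epsilon> Y] by (simp add: right_exact_def)
  ultimately show ?thesis using diag by (simp add: pushout_diagram_def)
qed

end

section \<open>Silting modules give pushout preenvelopes\<close>

lemma right_exactD:
  assumes "right_exact R A f B g C"
  shows "f \<in> Hom R A B" "g \<in> Epi R B C" "\<And>a. a \<in> carrier A \<Longrightarrow> g (f a) = \<zero>\<^bsub>C\<^esub>"
    "\<And>b. b \<in> carrier B \<Longrightarrow> g b = \<zero>\<^bsub>C\<^esub> \<Longrightarrow> \<exists>a\<in>carrier A. b = f a"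
proof -
  have f: "f \<in> Hom R A B" and g: "g \<in> Epi R B C" and k: "f ` carrier A = a_kernel B C g"
    using assms by (auto simp: right_exact_def)
  show "f \<in> Hom R A B" "g \<in> Epi R B C" by fact+
  show "g (f a) = \<zero>\<^bsub>C\<^esub>" if "a \<in> carrier A" for a
  proof -
    have "f a \<in> a_kernel B C g" using that k by blast
    then show ?thesis by (simp add: a_kernel_def')
  qed
  show "\<exists>a\<in>carrier A. b = f a" if "b \<in> carrier B" "g b = \<zero>\<^bsub>C\<^esub>" for b
  proof -
    have "b \<in> f ` carrier A" unfolding k using that by (simp add: a_kernel_def')
    then show ?thesis by blast
  qed
qed

lemma right_exactI:
  assumes f: "f \<in> Hom R A B" and g: "g \<in> Hom R B C" and surj: "\<And>c. c \<in> carrier C \<Longrightarrow> \<exists>b\<in>carrier B. c = g b"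
    and zero: "\<And>a. a \<in> carrier A \<Longrightarrow> g (f a) = \<zero>\<^bsub>C\<^esub>"
    and ex: "\<And>b. b \<in> carrier B \<Longrightarrow> g b = \<zero>\<^bsub>C\<^esub> \<Longrightarrow> \<exists>a\<in>carrier A. b = f a"
  shows "right_exact R A f B g C"
proof -
  have "f ` carrier A = a_kernel B C g"
    using zero ex Hom_closed[OF f] by (auto simp: a_kernel_def')
  then show ?thesis using f EpiI[OF g surj] by (simp add: right_exact_def)
qed

text \<open>
Take one copy of \<open>\<sigma> : P \<rightarrow> Q\<close> for each homomorphism \<open>f : P \<rightarrow> X\<close>, let \<open>\<rho>\<close> be the direct sum of these
copies, and let \<open>\<delta>\<close> act as \<open>f\<close> on the summand with index \<open>f\<close>. Let \<open>M\<close> be the pushout of \<open>\<rho>\<close> and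
\<open>\<delta>\<close>, and \<open>K\<close> the common cokernel.

Modules in \<open>Gen T = D\<^sub>\<sigma>\<close> lie in \<open>D\<^sub>\<rho>\<close>, because extensions along the copies of \<open>\<sigma>\<close> can be
combined. Hence a homomorphism from \<open>X\<close> to such a module, restricted along \<open>\<delta>\<close>, extends along
\<open>\<rho>\<close>, and by the pushout property it factors through \<open>X \<rightarrow> M\<close>.

It remains to see that \<open>M\<close> lies in \<open>D\<^sub>\<sigma>\<close>. The module \<open>K\<close> does, being a sum of images of \<open>T\<close>, the
cokernel of \<open>\<sigma>\<close>. So a homomorphism \<open>f : P \<rightarrow> M\<close> extends along \<open>\<sigma>\<close> after projection to \<open>K\<close>;
lifting that extension to \<open>M\<close>, the error lands in the image of \<open>X\<close> and lifts to some \<open>h : P \<rightarrow> X\<close>.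
By construction every such \<open>h\<close>, composed with \<open>X \<rightarrow> M\<close>, extends along \<open>\<sigma>\<close>, namely by the copy of
\<open>Q\<close> with index \<open>h\<close>.
\<close>

lemma silting_pushout_preenvelope:
  fixes R :: "('r, 'm) ring_scheme" and T P Q X :: "('r, 'u) module"
  assumes univ: "is_universe TYPE('u)" and R: "ring R" and T: "T \<in> Mods R"
    and \<sigma>: "(P, \<sigma>, Q) \<in> proj_maps R" and pres: "right_exact R P \<sigma> Q \<pi> T"
    and D: "D_class R (P, \<sigma>, Q) = Gen R T" and X: "X \<in> Mods R"
  shows "\<exists>\<epsilon> T\<^sub>0. preenvelope R (Gen R T) X \<epsilon> T\<^sub>0 \<and>
    (\<exists>L\<^sub>1 \<rho> L\<^sub>0 l \<delta> \<beta> \<kappa> T\<^sub>1. pushout_diagram R (Gen R T) L\<^sub>1 \<rho> L\<^sub>0 l \<delta> \<beta> X \<epsilon> T\<^sub>0 \<kappa> T\<^sub>1)"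
proof -
  have projP: "projective R P" and projQ: "projective R Q" and \<sigma>H: "\<sigma> \<in> Hom R P Q"
    using \<sigma> by (auto simp: proj_maps_def)
  have P: "P \<in> Mods R" and Q: "Q \<in> Mods R" using projP projQ by (auto simp: projective_def)
  note P' = Mods_right_module[OF P] and Q' = Mods_right_module[OF Q]
    and T' = Mods_right_module[OF T] and X' = Mods_right_module[OF X]
  note \<pi> = right_exactD(2)[OF pres]
  note D_iff = D_class_iff[OF P' \<sigma>H]

  have small: "Hom R P X \<prec> (UNIV :: 'u set)"
    by (rule small_function_space[OF univ, of "carrier P" "carrier X"])
      (use X P in \<open>auto simp: Mods_def small_def Hom_extensional dest: Hom_closed\<close>)
  let ?J = "Hom R P X"
  obtain L\<^sub>1 :: "('r, 'u) module" and \<iota> where L\<^sub>1: "L\<^sub>1 \<in> Mods R" "is_coproduct R ?J (\<lambda>_. P) L\<^sub>1 \<iota> TYPE('u)"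
    by (rule coproduct_exists[OF univ R small P])
  obtain L\<^sub>0 :: "('r, 'u) module" and \<iota>' where L\<^sub>0: "L\<^sub>0 \<in> Mods R" "is_coproduct R ?J (\<lambda>_. Q) L\<^sub>0 \<iota>' TYPE('u)"
    by (rule coproduct_exists[OF univ R small Q])
  note L1' = Mods_right_module[OF L\<^sub>1(1)] and L0' = Mods_right_module[OF L\<^sub>0(1)]
  note \<iota> = is_coproduct_inj[OF L\<^sub>1(2)] and \<iota>' = is_coproduct_inj[OF L\<^sub>0(2)]
  have projL: "projective R L\<^sub>1" "projective R L\<^sub>0"
    by (rule projective_coproduct[OF L\<^sub>1(2,1) projP] projective_coproduct[OF L\<^sub>0(2,1) projQ])+
  obtain \<delta> where \<delta>: "\<delta> \<in> Hom R L\<^sub>1 X" "\<And>f x. f \<in> ?J \<Longrightarrow> x \<in> carrier P \<Longrightarrow> \<delta> (\<iota> f x) = f x"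
    by (rule is_coproduct_Hom[OF L\<^sub>1(2) X, of "\<lambda>f. f"]) (assumption | erule that; simp)+
  obtain \<rho> where \<rho>: "\<rho> \<in> Hom R L\<^sub>1 L\<^sub>0" "\<And>f x. f \<in> ?J \<Longrightarrow> x \<in> carrier P \<Longrightarrow> \<rho> (\<iota> f x) = compose (carrier P) (\<iota>' f) \<sigma> x"
    by (rule is_coproduct_Hom[OF L\<^sub>1(2) L\<^sub>0(1), of "\<lambda>f. compose (carrier P) (\<iota>' f) \<sigma>"])
      ((rule Hom_compose[OF \<sigma>H \<iota>' P'], assumption) | (erule that; simp))+
  have \<rho>\<iota>: "\<rho> (\<iota> f x) = \<iota>' f (\<sigma> x)" if "f \<in> ?J" "x \<in> carrier P" for f x
    using \<rho>(2)[OF that] that by (simp add: compose_eq)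
  obtain M :: "('r, 'u) module" and \<epsilon> \<beta> where M: "M \<in> Mods R" "is_pushout R L\<^sub>1 X L\<^sub>0 M \<delta> \<rho> \<epsilon> \<beta>"
      and M_gen: "\<And>m. m \<in> carrier M \<Longrightarrow> \<exists>x\<in>carrier X. \<exists>y\<in>carrier L\<^sub>0. m = \<epsilon> x \<oplus>\<^bsub>M\<^esub> \<beta> y"
      and M_eq: "\<And>x y. x \<in> carrier X \<Longrightarrow> y \<in> carrier L\<^sub>0 \<Longrightarrow> \<epsilon> x = \<beta> y \<Longrightarrow> \<exists>z\<in>carrier L\<^sub>1. x = \<delta> z \<and> y = \<rho> z"
    by (rule pushout_exists[OF univ L\<^sub>1(1) X L\<^sub>0(1) \<delta>(1) \<rho>(1)]) (erule (1) that; blast)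
  note M' = Mods_right_module[OF M(1)]
  have \<epsilon>: "\<epsilon> \<in> Hom R X M" and \<beta>: "\<beta> \<in> Hom R L\<^sub>0 M"
    and comm': "compose (carrier L\<^sub>1) \<epsilon> \<delta> = compose (carrier L\<^sub>1) \<beta> \<rho>"
    using M(2) by (simp_all add: is_pushout_def)
  have comm: "\<epsilon> (\<delta> z) = \<beta> (\<rho> z)" if "z \<in> carrier L\<^sub>1" for z
    using comm' that by (metis compose_eq)
  obtain K :: "('r, 'u) module" and \<kappa> where K: "K \<in> Mods R" "right_exact R X \<epsilon> M \<kappa> K"
    by (rule cokernel_exists[OF \<epsilon> X' M(1)])
  note K' = Mods_right_module[OF K(1)]
  note \<kappa> = right_exactD[OF K(2)]
  note \<kappa>H = Epi_Hom[OF \<kappa>(2)]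
  interpret X: right_module R X by fact
  interpret M: right_module R M by fact
  interpret K: right_module R K by fact

  define l where "l = compose (carrier L\<^sub>0) \<kappa> \<beta>"
  have l: "l \<in> Hom R L\<^sub>0 K" unfolding l_def by (rule Hom_compose[OF \<beta> \<kappa>H L0'])
  have l_eq: "l y = \<kappa> (\<beta> y)" if "y \<in> carrier L\<^sub>0" for y using that by (simp add: l_def compose_eq)
  have row: "right_exact R L\<^sub>1 \<rho> L\<^sub>0 l K"
  proof (rule right_exactI[OF \<rho>(1) l])
    fix k assume "k \<in> carrier K"
    then obtain m where m: "m \<in> carrier M" "k = \<kappa> m" using Epi_surj[OF \<kappa>(2)] by blast
    then obtain x y where xy: "x \<in> carrier X" "y \<in> carrier L\<^sub>0" "m = \<epsilon> x \<oplus>\<^bsub>M\<^esub> \<beta> y" using M_gen by blast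
    have "k = l y" using m xy Hom_closed[OF \<beta>] Hom_closed[OF \<epsilon>] Hom_closed[OF \<kappa>H]
      by (simp add: Hom_add[OF \<kappa>H] \<kappa>(3) l_eq)
    then show "\<exists>y\<in>carrier L\<^sub>0. k = l y" using xy(2) by blast
  next
    fix z assume z: "z \<in> carrier L\<^sub>1"
    then show "l (\<rho> z) = \<zero>\<^bsub>K\<^esub>"
      using \<kappa>(3)[OF Hom_closed[OF \<delta>(1) z]] by (simp add: l_eq Hom_closed[OF \<rho>(1)] comm)
  next
    fix y assume y: "y \<in> carrier L\<^sub>0" "l y = \<zero>\<^bsub>K\<^esub>"
    then obtain x where "x \<in> carrier X" "\<beta> y = \<epsilon> x"
      using \<kappa>(4)[OF Hom_closed[OF \<beta> y(1)]] by (auto simp: l_eq)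
    then show "\<exists>z\<in>carrier L\<^sub>1. y = \<rho> z" using M_eq[of x y] y(1) by metis
  qed

  have box: "(L\<^sub>1, \<rho>, L\<^sub>0) \<in> box_class R (Gen R T)"
  proof -
    have "Y \<in> D_class R (L\<^sub>1, \<rho>, L\<^sub>0)" if "Y \<in> Gen R T" for Y
    proof -
      have Y: "Y \<in> Mods R" and lift: "\<forall>f\<in>Hom R P Y. \<exists>g\<in>Hom R Q Y. \<forall>x\<in>carrier P. f x = g (\<sigma> x)"
        using that D_iff D by blast+
      note Y' = Mods_right_module[OF Y]
      have "\<exists>g\<in>Hom R L\<^sub>0 Y. \<forall>z\<in>carrier L\<^sub>1. h z = g (\<rho> z)" if h: "h \<in> Hom R L\<^sub>1 Y" for h
      proof -
        have "\<exists>g. g \<in> Hom R Q Y \<and> (\<forall>x\<in>carrier P. h (\<iota> j x) = g (\<sigma> x))" if j: "j \<in> ?J" for j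
          using lift[rule_format, OF Hom_compose[OF \<iota>[OF j] h P']] by (auto simp: compose_eq)
        then obtain g where g: "\<And>j. j \<in> ?J \<Longrightarrow> g j \<in> Hom R Q Y" "\<And>j x. j \<in> ?J \<Longrightarrow> x \<in> carrier P \<Longrightarrow> h (\<iota> j x) = g j (\<sigma> x)"
          by metis
        obtain k where k: "k \<in> Hom R L\<^sub>0 Y" "\<And>j x. j \<in> ?J \<Longrightarrow> x \<in> carrier Q \<Longrightarrow> k (\<iota>' j x) = g j x"
          by (rule is_coproduct_Hom[OF L\<^sub>0(2) Y, of g]) (use g(1) in auto)
        have "h z = compose (carrier L\<^sub>1) k \<rho> z" if z: "z \<in> carrier L\<^sub>1" for z
          by (rule is_coproduct_ext[OF L\<^sub>1(2) h Hom_compose[OF \<rho>(1) k(1) L1'] L1' Y' _ z])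
            (simp add: compose_eq Hom_closed[OF \<iota>] \<rho>\<iota> k(2) Hom_closed[OF \<sigma>H] g(2))
        then show ?thesis using k(1) by (intro bexI[of _ k]) (simp_all add: compose_eq)
      qed
      then show ?thesis using Y D_class_iff[OF L1' \<rho>(1)] by blast
    qed
    then show ?thesis using projL \<rho>(1) by (auto simp: box_class_def proj_maps_def)
  qed

  have K_Gen: "K \<in> Gen R T"
  proof (rule Gen_trace[OF univ K(1) T])
    fix N assume N: "right_submodule R K N" and TN: "\<And>f. f \<in> Hom R T K \<Longrightarrow> f ` carrier T \<subseteq> N"
    have "l (\<iota>' j q) \<in> N" if j: "j \<in> ?J" and q: "q \<in> carrier Q" for j q
    proof -
      let ?q = "compose (carrier Q) l (\<iota>' j)"
      have hq: "?q \<in> Hom R Q K" by (rule Hom_compose[OF \<iota>'[OF j] l Q'])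
      have "?q y = \<zero>\<^bsub>K\<^esub>" if y: "y \<in> carrier Q" "\<pi> y = \<zero>\<^bsub>T\<^esub>" for y
      proof -
        obtain x where x: "x \<in> carrier P" "y = \<sigma> x" using right_exactD(4)[OF pres y] by blast
        then have "?q y = l (\<rho> (\<iota> j x))" using y(1) by (simp add: compose_eq \<rho>\<iota>[OF j x(1)])
        also have "\<dots> = \<zero>\<^bsub>K\<^esub>" by (rule right_exactD(3)[OF row Hom_closed[OF \<iota>[OF j] x(1)]])
        finally show ?thesis .
      qed
      then obtain t where t: "t \<in> Hom R T K" "\<And>y. y \<in> carrier Q \<Longrightarrow> t (\<pi> y) = ?q y"
        using Hom_factor_Epi[OF \<pi> hq Q' T' K'] by metis
      have "l (\<iota>' j q) = t (\<pi> q)" using q by (simp add: t(2) compose_eq)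
      then show ?thesis using TN[OF t(1)] Hom_closed[OF Epi_Hom[OF \<pi>] q] by auto
    qed
    then have "{y \<in> carrier L\<^sub>0. l y \<in> N} = carrier L\<^sub>0"
      by (intro is_coproduct_gen[OF L\<^sub>0(2) right_submodule_preimage[OF l L0' K' N]]) (auto simp: Hom_closed[OF \<iota>'])
    then have "carrier K \<subseteq> N" using Epi_surj[OF right_exactD(2)[OF row]] by blast
    then show "N = carrier K" using N by (auto simp: right_submodule_def)
  qed

  have M_Gen: "M \<in> Gen R T"
  proof -
    have "\<exists>g\<in>Hom R Q M. \<forall>x\<in>carrier P. f x = g (\<sigma> x)" if f: "f \<in> Hom R P M" for f
    proof -
      have "K \<in> D_class R (P, \<sigma>, Q)" using K_Gen D by simp
      then obtain g where g: "g \<in> Hom R Q K" "\<And>x. x \<in> carrier P \<Longrightarrow> compose (carrier P) \<kappa> f x = g (\<sigma> x)"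
        using D_iff Hom_compose[OF f \<kappa>H P'] by blast
      obtain g' where g': "g' \<in> Hom R Q M" "\<And>y. y \<in> carrier Q \<Longrightarrow> \<kappa> (g' y) = g y"
        by (rule projective_lift[OF projQ M(1) K(1) \<kappa>(2) g(1)]) (erule that; simp)
      \<comment> \<open>the error of the lifted extension \<open>g'\<close>, which vanishes in \<open>K\<close>\<close>
      define d where "d = (\<lambda>x\<in>carrier P. f x \<ominus>\<^bsub>M\<^esub> compose (carrier P) g' \<sigma> x)"
      have d: "d \<in> Hom R P M" unfolding d_def by (rule Hom_diff[OF f Hom_compose[OF \<sigma>H g'(1) P'] P' M'])
      have d_eq: "d x = f x \<ominus>\<^bsub>M\<^esub> g' (\<sigma> x)" if "x \<in> carrier P" for x
        using that by (simp add: d_def compose_eq)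
      have d_im: "\<exists>y\<in>carrier X. d x = \<epsilon> y" if x: "x \<in> carrier P" for x
      proof (rule \<kappa>(4)[OF Hom_closed[OF d x]])
        have "\<kappa> (f x) = \<kappa> (g' (\<sigma> x))"
          using g(2)[OF x] g'(2)[OF Hom_closed[OF \<sigma>H x]] x by (simp add: compose_eq)
        then show "\<kappa> (d x) = \<zero>\<^bsub>K\<^esub>"
          using x Hom_closed[OF f x] Hom_closed[OF g'(1) Hom_closed[OF \<sigma>H x]] Hom_closed[OF \<kappa>H]
          by (simp add: d_eq Hom_minus[OF \<kappa>H M' K'] K.minus_zero_iff_eq)
      qed
      obtain h where h: "h \<in> Hom R P X" "\<And>x. x \<in> carrier P \<Longrightarrow> \<epsilon> (h x) = d x"
        by (rule projective_lift_range[OF projP X M' \<epsilon> d d_im]) (assumption | erule that; simp)+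
      \<comment> \<open>the summand of \<open>L\<^sub>0\<close> with index \<open>h\<close> extends the error along \<open>\<sigma>\<close>\<close>
      define k where "k = compose (carrier Q) \<beta> (\<iota>' h)"
      have k: "k \<in> Hom R Q M" unfolding k_def by (rule Hom_compose[OF \<iota>'[OF h(1)] \<beta> Q'])
      have dk: "d x = k (\<sigma> x)" if x: "x \<in> carrier P" for x
      proof -
        have "d x = \<epsilon> (\<delta> (\<iota> h x))" using h \<delta>(2) x by simp
        also have "\<dots> = \<beta> (\<rho> (\<iota> h x))" by (rule comm[OF Hom_closed[OF \<iota>[OF h(1)] x]])
        also have "\<dots> = k (\<sigma> x)" using \<rho>\<iota>[OF h(1) x] Hom_closed[OF \<sigma>H x] by (simp add: k_def compose_eq)
        finally show ?thesis .
      qed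
      define s where "s = (\<lambda>y\<in>carrier Q. g' y \<oplus>\<^bsub>M\<^esub> k y)"
      have s: "s \<in> Hom R Q M" "\<And>y. y \<in> carrier Q \<Longrightarrow> s y = g' y \<oplus>\<^bsub>M\<^esub> k y"
        unfolding s_def by (rule Hom_sum[OF g'(1) k Q' M']) simp
      have "f x = s (\<sigma> x)" if x: "x \<in> carrier P" for x
      proof -
        have "g' (\<sigma> x) \<oplus>\<^bsub>M\<^esub> (f x \<ominus>\<^bsub>M\<^esub> g' (\<sigma> x)) = f x"
          using Hom_closed[OF f x] Hom_closed[OF g'(1) Hom_closed[OF \<sigma>H x]]
          by (simp add: a_minus_def M.M.a_lcomm M.M.r_neg)
        then show ?thesis using dk[OF x] d_eq[OF x] s(2)[OF Hom_closed[OF \<sigma>H x]] by simp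
      qed
      then show ?thesis using s(1) by blast
    qed
    then show ?thesis using M(1) D_iff D by blast
  qed

  have "preenvelope R (Gen R T) X \<epsilon> M"
    unfolding preenvelope_def
  proof (intro conjI ballI M_Gen \<epsilon>)
    fix Y f assume Y: "Y \<in> Gen R T" and f: "f \<in> Hom R X Y"
    have YM: "Y \<in> Mods R" using Y by (simp add: Gen_def)
    have "Y \<in> D_class R (L\<^sub>1, \<rho>, L\<^sub>0)" using box Y by (auto simp: box_class_def)
    then obtain g where g: "g \<in> Hom R L\<^sub>0 Y" "\<And>z. z \<in> carrier L\<^sub>1 \<Longrightarrow> compose (carrier L\<^sub>1) f \<delta> z = g (\<rho> z)"
      using D_class_iff[OF L1' \<rho>(1)] Hom_compose[OF \<delta>(1) f L1'] by blast
    have "compose (carrier L\<^sub>1) f \<delta> = compose (carrier L\<^sub>1) g \<rho>"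
      by (rule Hom_eqI[OF Hom_compose[OF \<delta>(1) f L1'] Hom_compose[OF \<rho>(1) g(1) L1']])
        (use g(2) in \<open>simp add: compose_eq\<close>)
    then obtain h where "h \<in> Hom R M Y" "compose (carrier X) h \<epsilon> = f"
      using M(2) YM f g(1) unfolding is_pushout_def by meson
    then show "\<exists>g\<in>Hom R M Y. f = compose (carrier X) g \<epsilon>" by blast
  qed
  moreover have "pushout_diagram R (Gen R T) L\<^sub>1 \<rho> L\<^sub>0 l \<delta> \<beta> X \<epsilon> M \<kappa> K"
    using box M K row by (simp add: pushout_diagram_def l_def)
  ultimately show ?thesis by blast
qed
section \<open>Pushout preenvelopes give silting modules\<close>

text \<open>
A pushout given by its universal property is compared with the one constructed as a cokernel:
equality of two elements in the former implies equality in the latter.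
\<close>

lemma pushout_exact:
  fixes A B C D :: "('r, 'u) module"
  assumes univ: "is_universe TYPE('u)" and po: "is_pushout R A B C D f g i j"
    and A: "A \<in> Mods R" and B: "B \<in> Mods R" and C: "C \<in> Mods R"
    and bc: "b \<in> carrier B" "c \<in> carrier C" "i b = j c"
  shows "\<exists>a\<in>carrier A. b = f a \<and> c = g a"
proof -
  have f: "f \<in> Hom R A B" and g: "g \<in> Hom R A C" using po by (simp_all add: is_pushout_def)
  obtain E :: "('r, 'u) module" and i' j' where E: "E \<in> Mods R" "is_pushout R A B C E f g i' j'"
      and eq: "\<And>b c. b \<in> carrier B \<Longrightarrow> c \<in> carrier C \<Longrightarrow> i' b = j' c \<Longrightarrow> \<exists>a\<in>carrier A. b = f a \<and> c = g a"
    by (rule pushout_exists[OF univ A B C f g]) (erule (1) that; blast)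
  have i': "i' \<in> Hom R B E" and j': "j' \<in> Hom R C E" and comm: "compose (carrier A) i' f = compose (carrier A) j' g"
    using E(2) by (simp_all add: is_pushout_def)
  obtain h where "compose (carrier B) h i = i'" "compose (carrier C) h j = j'"
    using po E(1) i' j' comm unfolding is_pushout_def by meson
  then have "i' b = h (i b)" "j' c = h (j c)" using bc(1,2) by (metis compose_eq)+
  then show ?thesis using eq bc by simp
qed

text \<open>
The pushout square is the exact sequence \<open>L\<^sub>1 \<rightarrow> L\<^sub>0 \<oplus> F \<rightarrow> M \<rightarrow> 0\<close>, with maps \<open>(\<rho>, \<delta>)\<close> and
\<open>\<beta> - \<epsilon>\<close>. This is a projective presentation of \<open>M\<close>. A homomorphism on \<open>L\<^sub>1\<close> that extends along
\<open>\<rho>\<close> extends along \<open>(\<rho>, \<delta>)\<close>, by zero on \<open>F\<close>.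
\<close>

lemma pushout_presentation:
  fixes L\<^sub>1 L\<^sub>0 F M K :: "('r, 'u) module"
  assumes univ: "is_universe TYPE('u)" and F: "projective R F"
    and diag: "pushout_diagram R \<T> L\<^sub>1 \<rho> L\<^sub>0 l \<delta> \<beta> F \<epsilon> M \<kappa> K"
  obtains Q :: "('r, 'u) module" and \<sigma> \<pi> where "projective R Q" "right_exact R L\<^sub>1 \<sigma> Q \<pi> M"
    "D_class R (L\<^sub>1, \<rho>, L\<^sub>0) \<subseteq> D_class R (L\<^sub>1, \<sigma>, Q)"
proof -
  have ex: "right_exact R F \<epsilon> M \<kappa> K" and row: "right_exact R L\<^sub>1 \<rho> L\<^sub>0 l K"
    and po: "is_pushout R L\<^sub>1 F L\<^sub>0 M \<delta> \<rho> \<epsilon> \<beta>" and lk: "compose (carrier L\<^sub>0) \<kappa> \<beta> = l"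
    and box: "(L\<^sub>1, \<rho>, L\<^sub>0) \<in> box_class R \<T>" and MM: "M \<in> Mods R" and KM: "K \<in> Mods R"
    using diag by (simp_all add: pushout_diagram_def)
  have proj: "projective R L\<^sub>0" and L1M: "L\<^sub>1 \<in> Mods R" and L0M: "L\<^sub>0 \<in> Mods R" and FM: "F \<in> Mods R"
    using box F by (auto simp: box_class_def proj_maps_def projective_def)
  note L1' = Mods_right_module[OF L1M] and L0' = Mods_right_module[OF L0M] and F' = Mods_right_module[OF FM]
    and M' = Mods_right_module[OF MM] and K' = Mods_right_module[OF KM]
  have \<epsilon>: "\<epsilon> \<in> Hom R F M" and \<delta>: "\<delta> \<in> Hom R L\<^sub>1 F" and \<rho>: "\<rho> \<in> Hom R L\<^sub>1 L\<^sub>0" and \<beta>: "\<beta> \<in> Hom R L\<^sub>0 M"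
    and comm': "compose (carrier L\<^sub>1) \<epsilon> \<delta> = compose (carrier L\<^sub>1) \<beta> \<rho>"
    using po by (simp_all add: is_pushout_def)
  have comm: "\<epsilon> (\<delta> x) = \<beta> (\<rho> x)" if "x \<in> carrier L\<^sub>1" for x
    using comm' that by (metis compose_eq)
  interpret M: right_module R M by (rule M')
  interpret K: right_module R K by (rule K')
  obtain Q :: "('r, 'u) module" and s t p q where Q: "Q \<in> Mods R" "is_biproduct R L\<^sub>0 F Q s t p q"
    by (rule biproduct_exists[OF univ L0M FM])
  note Q' = Mods_right_module[OF Q(1)]
  note d = is_biproductD[OF Q(2)]
  note hp = Hom_closed[OF d(3)] and hq = Hom_closed[OF d(4)] and h\<beta> = Hom_closed[OF \<beta>] and h\<epsilon> = Hom_closed[OF \<epsilon>]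
  obtain \<sigma> where \<sigma>: "\<sigma> \<in> Hom R L\<^sub>1 Q" "\<And>x. x \<in> carrier L\<^sub>1 \<Longrightarrow> p (\<sigma> x) = \<rho> x" "\<And>x. x \<in> carrier L\<^sub>1 \<Longrightarrow> q (\<sigma> x) = \<delta> x"
    by (rule is_biproduct_pairing[OF Q(2) \<rho> \<delta> L0' F' Q' L1']) (erule that; simp)
  define \<pi> where "\<pi> = (\<lambda>z\<in>carrier Q. compose (carrier Q) \<beta> p z \<ominus>\<^bsub>M\<^esub> compose (carrier Q) \<epsilon> q z)"
  have \<pi>: "\<pi> \<in> Hom R Q M" unfolding \<pi>_def
    by (rule Hom_diff[OF Hom_compose[OF d(3) \<beta> Q'] Hom_compose[OF d(4) \<epsilon> Q'] Q' M'])
  have \<pi>_eq: "\<pi> z = \<beta> (p z) \<ominus>\<^bsub>M\<^esub> \<epsilon> (q z)" if "z \<in> carrier Q" for z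
    using that by (simp add: \<pi>_def compose_eq)
  have "right_exact R L\<^sub>1 \<sigma> Q \<pi> M"
  proof (rule right_exactI[OF \<sigma>(1) \<pi>])
    fix m assume m: "m \<in> carrier M"
    note \<kappa>H = Epi_Hom[OF right_exactD(2)[OF ex]]
    obtain y where y: "y \<in> carrier L\<^sub>0" "\<kappa> m = l y"
      using Epi_surj[OF right_exactD(2)[OF row] Hom_closed[OF \<kappa>H m]] by blast
    have "\<kappa> (\<beta> y) = \<kappa> m" using y lk by (metis compose_eq)
    then have "\<kappa> (\<beta> y \<ominus>\<^bsub>M\<^esub> m) = \<zero>\<^bsub>K\<^esub>"
      using m y(1) by (simp add: h\<beta> Hom_minus[OF \<kappa>H M' K'] K.minus_zero_iff_eq Hom_closed[OF \<kappa>H])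
    moreover have "\<beta> y \<ominus>\<^bsub>M\<^esub> m \<in> carrier M" using m y(1) h\<beta> by simp
    ultimately obtain r where r: "r \<in> carrier F" "\<beta> y \<ominus>\<^bsub>M\<^esub> m = \<epsilon> r"
      using right_exactD(4)[OF ex] by blast
    obtain z where z: "z \<in> carrier Q" "p z = y" "q z = r"
      by (rule is_biproduct_pair[OF Q(2) y(1) r(1) L0' F' Q'])
    have "\<pi> z = \<beta> y \<ominus>\<^bsub>M\<^esub> (\<beta> y \<ominus>\<^bsub>M\<^esub> m)" using z r(2) by (simp add: \<pi>_eq)
    also have "\<dots> = m" using m h\<beta>[OF y(1)] by (simp add: a_minus_def M.M.minus_add M.M.r_neg2)
    finally show "\<exists>z\<in>carrier Q. m = \<pi> z" using z(1) by blast
  next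
    fix x assume x: "x \<in> carrier L\<^sub>1"
    show "\<pi> (\<sigma> x) = \<zero>\<^bsub>M\<^esub>"
      using x by (simp add: \<pi>_eq Hom_closed[OF \<sigma>(1)] \<sigma>(2,3) comm M.minus_zero_iff_eq h\<beta> Hom_closed[OF \<rho>])
  next
    fix z assume z: "z \<in> carrier Q" "\<pi> z = \<zero>\<^bsub>M\<^esub>"
    then have "\<epsilon> (q z) = \<beta> (p z)" by (simp add: \<pi>_eq M.minus_zero_iff_eq h\<beta> h\<epsilon> hp hq)
    then obtain a where a: "a \<in> carrier L\<^sub>1" "q z = \<delta> a" "p z = \<rho> a"
      using pushout_exact[OF univ po L1M FM L0M hq[OF z(1)] hp[OF z(1)]] by blast
    have "z = \<sigma> a"
      by (rule is_biproduct_ext[OF Q(2) z(1) Hom_closed[OF \<sigma>(1) a(1)]]) (simp_all add: \<sigma> a)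
    then show "\<exists>x\<in>carrier L\<^sub>1. z = \<sigma> x" using a(1) by blast
  qed
  moreover have "D_class R (L\<^sub>1, \<rho>, L\<^sub>0) \<subseteq> D_class R (L\<^sub>1, \<sigma>, Q)"
  proof
    fix X assume X: "X \<in> D_class R (L\<^sub>1, \<rho>, L\<^sub>0)"
    have "\<exists>k\<in>Hom R Q X. \<forall>x\<in>carrier L\<^sub>1. f x = k (\<sigma> x)" if f: "f \<in> Hom R L\<^sub>1 X" for f
    proof -
      obtain g where g: "g \<in> Hom R L\<^sub>0 X" "\<And>x. x \<in> carrier L\<^sub>1 \<Longrightarrow> f x = g (\<rho> x)"
        using X f unfolding D_class_iff[OF L1' \<rho>] by blast
      then show ?thesis
        by (intro bexI[OF _ Hom_compose[OF d(3) g(1) Q']]) (simp add: compose_eq Hom_closed[OF \<sigma>(1)] \<sigma>(2))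
    qed
    then show "X \<in> D_class R (L\<^sub>1, \<sigma>, Q)"
      using X unfolding D_class_iff[OF L1' \<rho>] D_class_iff[OF L1' \<sigma>(1)] by blast
  qed
  ultimately show thesis using that projective_biproduct[OF Q(2,1) proj F] by blast
qed

text \<open>
The direct sum of the two presentations: a homomorphism extends along \<open>\<sigma>\<^sub>1 \<oplus> \<sigma>\<^sub>2\<close> if and only if
both of its components extend.
\<close>

lemma biproduct_presentation:
  fixes P\<^sub>1 Q\<^sub>1 P\<^sub>2 Q\<^sub>2 A B T :: "('r, 'u) module"
  assumes univ: "is_universe TYPE('u)"
    and proj: "projective R P\<^sub>1" "projective R Q\<^sub>1" "projective R P\<^sub>2" "projective R Q\<^sub>2"
    and ex1: "right_exact R P\<^sub>1 \<sigma>\<^sub>1 Q\<^sub>1 \<pi>\<^sub>1 A" and ex2: "right_exact R P\<^sub>2 \<sigma>\<^sub>2 Q\<^sub>2 \<pi>\<^sub>2 B"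
    and A': "right_module R A" and B': "right_module R B" and T': "right_module R T"
    and T: "is_biproduct R A B T iT jT pT qT"
  obtains P \<sigma> Q \<pi> where "(P, \<sigma>, Q) \<in> proj_maps R" "right_exact R P \<sigma> Q \<pi> T"
    "D_class R (P, \<sigma>, Q) = D_class R (P\<^sub>1, \<sigma>\<^sub>1, Q\<^sub>1) \<inter> D_class R (P\<^sub>2, \<sigma>\<^sub>2, Q\<^sub>2)"
proof -
  have M: "P\<^sub>1 \<in> Mods R" "Q\<^sub>1 \<in> Mods R" "P\<^sub>2 \<in> Mods R" "Q\<^sub>2 \<in> Mods R" using proj by (auto simp: projective_def)
  note M' = M[THEN Mods_right_module]
  note \<sigma>\<^sub>1 = right_exactD(1)[OF ex1] and \<sigma>\<^sub>2 = right_exactD(1)[OF ex2]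
  note \<pi>\<^sub>1 = Epi_Hom[OF right_exactD(2)[OF ex1]] and \<pi>\<^sub>2 = Epi_Hom[OF right_exactD(2)[OF ex2]]
  obtain P :: "('r, 'u) module" and i j p q where P: "P \<in> Mods R" "is_biproduct R P\<^sub>1 P\<^sub>2 P i j p q"
    by (rule biproduct_exists[OF univ M(1,3)])
  obtain Q :: "('r, 'u) module" and s t u v where Q: "Q \<in> Mods R" "is_biproduct R Q\<^sub>1 Q\<^sub>2 Q s t u v"
    by (rule biproduct_exists[OF univ M(2,4)])
  note P' = Mods_right_module[OF P(1)] and Q' = Mods_right_module[OF Q(1)]
  note dP = is_biproductD[OF P(2)] and dQ = is_biproductD[OF Q(2)] and dT = is_biproductD[OF T]
  note hP = Hom_closed[OF dP(1)] Hom_closed[OF dP(2)] Hom_closed[OF dP(3)] Hom_closed[OF dP(4)]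
  note hQ = Hom_closed[OF dQ(1)] Hom_closed[OF dQ(2)] Hom_closed[OF dQ(3)] Hom_closed[OF dQ(4)]
  note hT = Hom_closed[OF dT(1)] Hom_closed[OF dT(2)] Hom_closed[OF dT(3)] Hom_closed[OF dT(4)]
  obtain \<sigma> where \<sigma>: "\<sigma> \<in> Hom R P Q" "\<And>x. x \<in> carrier P \<Longrightarrow> u (\<sigma> x) = compose (carrier P) \<sigma>\<^sub>1 p x"
      "\<And>x. x \<in> carrier P \<Longrightarrow> v (\<sigma> x) = compose (carrier P) \<sigma>\<^sub>2 q x"
    by (rule is_biproduct_pairing[OF Q(2) Hom_compose[OF dP(3) \<sigma>\<^sub>1 P'] Hom_compose[OF dP(4) \<sigma>\<^sub>2 P'] M'(2,4) Q' P'])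
      (erule that; simp)
  have u\<sigma>: "u (\<sigma> x) = \<sigma>\<^sub>1 (p x)" and v\<sigma>: "v (\<sigma> x) = \<sigma>\<^sub>2 (q x)" if "x \<in> carrier P" for x
    using that \<sigma>(2,3) by (simp_all add: compose_eq)
  obtain \<pi> where \<pi>: "\<pi> \<in> Hom R Q T" "\<And>x. x \<in> carrier Q \<Longrightarrow> pT (\<pi> x) = compose (carrier Q) \<pi>\<^sub>1 u x"
      "\<And>x. x \<in> carrier Q \<Longrightarrow> qT (\<pi> x) = compose (carrier Q) \<pi>\<^sub>2 v x"
    by (rule is_biproduct_pairing[OF T Hom_compose[OF dQ(3) \<pi>\<^sub>1 Q'] Hom_compose[OF dQ(4) \<pi>\<^sub>2 Q'] A' B' T' Q'])
      (erule that; simp)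
  have p\<pi>: "pT (\<pi> x) = \<pi>\<^sub>1 (u x)" and q\<pi>: "qT (\<pi> x) = \<pi>\<^sub>2 (v x)" if "x \<in> carrier Q" for x
    using that \<pi>(2,3) by (simp_all add: compose_eq)
  interpret T: right_module R T by (rule T')
  have ex: "right_exact R P \<sigma> Q \<pi> T"
  proof (rule right_exactI[OF \<sigma>(1) \<pi>(1)])
    fix c assume c: "c \<in> carrier T"
    obtain y where y: "y \<in> carrier Q\<^sub>1" "pT c = \<pi>\<^sub>1 y" using Epi_surj[OF right_exactD(2)[OF ex1] hT(3)[OF c]] by blast
    obtain z where z: "z \<in> carrier Q\<^sub>2" "qT c = \<pi>\<^sub>2 z" using Epi_surj[OF right_exactD(2)[OF ex2] hT(4)[OF c]] by blast
    obtain b where b: "b \<in> carrier Q" "u b = y" "v b = z" by (rule is_biproduct_pair[OF Q(2) y(1) z(1) M'(2,4) Q'])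
    have "c = \<pi> b"
      by (rule is_biproduct_ext[OF T c Hom_closed[OF \<pi>(1) b(1)]]) (simp_all add: p\<pi> q\<pi> b y z)
    then show "\<exists>b\<in>carrier Q. c = \<pi> b" using b(1) by blast
  next
    fix a assume a: "a \<in> carrier P"
    note \<sigma>a = Hom_closed[OF \<sigma>(1) a]
    show "\<pi> (\<sigma> a) = \<zero>\<^bsub>T\<^esub>"
      by (rule is_biproduct_ext[OF T Hom_closed[OF \<pi>(1) \<sigma>a] T.M.zero_closed])
        (simp_all add: p\<pi>[OF \<sigma>a] q\<pi>[OF \<sigma>a] u\<sigma>[OF a] v\<sigma>[OF a] right_exactD(3)[OF ex1 hP(3)[OF a]]
          right_exactD(3)[OF ex2 hP(4)[OF a]] Hom_zero[OF dT(3) T' A'] Hom_zero[OF dT(4) T' B'])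
  next
    fix b assume b: "b \<in> carrier Q" "\<pi> b = \<zero>\<^bsub>T\<^esub>"
    have "\<pi>\<^sub>1 (u b) = \<zero>\<^bsub>A\<^esub>" "\<pi>\<^sub>2 (v b) = \<zero>\<^bsub>B\<^esub>"
      using p\<pi>[OF b(1)] q\<pi>[OF b(1)] by (simp_all add: b(2) Hom_zero[OF dT(3) T' A'] Hom_zero[OF dT(4) T' B'])
    then obtain x y where xy: "x \<in> carrier P\<^sub>1" "u b = \<sigma>\<^sub>1 x" "y \<in> carrier P\<^sub>2" "v b = \<sigma>\<^sub>2 y"
      using right_exactD(4)[OF ex1 hQ(3)[OF b(1)]] right_exactD(4)[OF ex2 hQ(4)[OF b(1)]] by blast
    obtain a where a: "a \<in> carrier P" "p a = x" "q a = y" by (rule is_biproduct_pair[OF P(2) xy(1,3) M'(1,3) P'])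
    have "b = \<sigma> a"
      by (rule is_biproduct_ext[OF Q(2) b(1) Hom_closed[OF \<sigma>(1) a(1)]]) (simp_all add: u\<sigma> v\<sigma> a xy)
    then show "\<exists>a\<in>carrier P. b = \<sigma> a" using a(1) by blast
  qed
  note D = D_class_iff[OF P' \<sigma>(1)] and D1 = D_class_iff[OF M'(1) \<sigma>\<^sub>1] and D2 = D_class_iff[OF M'(3) \<sigma>\<^sub>2]
  have \<sigma>i: "\<sigma> (i x) = s (\<sigma>\<^sub>1 x)" if x: "x \<in> carrier P\<^sub>1" for x
    by (rule is_biproduct_ext[OF Q(2) Hom_closed[OF \<sigma>(1) hP(1)[OF x]] hQ(1)[OF Hom_closed[OF \<sigma>\<^sub>1 x]]])
      (simp_all add: u\<sigma> v\<sigma> hP x dP(5,6) dQ(5,6) Hom_closed[OF \<sigma>\<^sub>1] Hom_zero[OF \<sigma>\<^sub>2 M'(3,4)])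
  have \<sigma>j: "\<sigma> (j y) = t (\<sigma>\<^sub>2 y)" if y: "y \<in> carrier P\<^sub>2" for y
    by (rule is_biproduct_ext[OF Q(2) Hom_closed[OF \<sigma>(1) hP(2)[OF y]] hQ(2)[OF Hom_closed[OF \<sigma>\<^sub>2 y]]])
      (simp_all add: u\<sigma> v\<sigma> hP y dP(7,8) dQ(7,8) Hom_closed[OF \<sigma>\<^sub>2] Hom_zero[OF \<sigma>\<^sub>1 M'(1,2)])
  have "D_class R (P, \<sigma>, Q) = D_class R (P\<^sub>1, \<sigma>\<^sub>1, Q\<^sub>1) \<inter> D_class R (P\<^sub>2, \<sigma>\<^sub>2, Q\<^sub>2)"
  proof (intro equalityI subsetI IntI)
    fix X assume X: "X \<in> D_class R (P, \<sigma>, Q)"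
    then have XM: "X \<in> Mods R" and lift: "\<And>f. f \<in> Hom R P X \<Longrightarrow> \<exists>g\<in>Hom R Q X. \<forall>x\<in>carrier P. f x = g (\<sigma> x)"
      unfolding D by blast+
    have "\<exists>g\<in>Hom R Q\<^sub>1 X. \<forall>x\<in>carrier P\<^sub>1. f x = g (\<sigma>\<^sub>1 x)" if f: "f \<in> Hom R P\<^sub>1 X" for f
    proof -
      obtain g where g: "g \<in> Hom R Q X" "\<And>x. x \<in> carrier P \<Longrightarrow> compose (carrier P) f p x = g (\<sigma> x)"
        using lift[OF Hom_compose[OF dP(3) f P']] by blast
      have "f x = g (s (\<sigma>\<^sub>1 x))" if x: "x \<in> carrier P\<^sub>1" for x
        using g(2)[OF hP(1)[OF x]] x hP(1)[OF x] by (simp add: compose_eq \<sigma>i dP(5))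
      then show ?thesis
        by (intro bexI[OF _ Hom_compose[OF dQ(1) g(1) M'(2)]]) (simp add: compose_eq Hom_closed[OF \<sigma>\<^sub>1])
    qed
    then show "X \<in> D_class R (P\<^sub>1, \<sigma>\<^sub>1, Q\<^sub>1)" using XM unfolding D1 by blast
    have "\<exists>g\<in>Hom R Q\<^sub>2 X. \<forall>x\<in>carrier P\<^sub>2. f x = g (\<sigma>\<^sub>2 x)" if f: "f \<in> Hom R P\<^sub>2 X" for f
    proof -
      obtain g where g: "g \<in> Hom R Q X" "\<And>x. x \<in> carrier P \<Longrightarrow> compose (carrier P) f q x = g (\<sigma> x)"
        using lift[OF Hom_compose[OF dP(4) f P']] by blast
      have "f x = g (t (\<sigma>\<^sub>2 x))" if x: "x \<in> carrier P\<^sub>2" for x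
        using g(2)[OF hP(2)[OF x]] x hP(2)[OF x] by (simp add: compose_eq \<sigma>j dP(8))
      then show ?thesis
        by (intro bexI[OF _ Hom_compose[OF dQ(2) g(1) M'(4)]]) (simp add: compose_eq Hom_closed[OF \<sigma>\<^sub>2])
    qed
    then show "X \<in> D_class R (P\<^sub>2, \<sigma>\<^sub>2, Q\<^sub>2)" using XM unfolding D2 by blast
  next
    fix X assume "X \<in> D_class R (P\<^sub>1, \<sigma>\<^sub>1, Q\<^sub>1) \<inter> D_class R (P\<^sub>2, \<sigma>\<^sub>2, Q\<^sub>2)"
    then have XM: "X \<in> Mods R"
      and lift1: "\<And>f. f \<in> Hom R P\<^sub>1 X \<Longrightarrow> \<exists>g\<in>Hom R Q\<^sub>1 X. \<forall>x\<in>carrier P\<^sub>1. f x = g (\<sigma>\<^sub>1 x)"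
      and lift2: "\<And>f. f \<in> Hom R P\<^sub>2 X \<Longrightarrow> \<exists>g\<in>Hom R Q\<^sub>2 X. \<forall>x\<in>carrier P\<^sub>2. f x = g (\<sigma>\<^sub>2 x)"
      unfolding Int_iff D1 D2 by blast+
    note X' = Mods_right_module[OF XM]
    have "\<exists>g\<in>Hom R Q X. \<forall>x\<in>carrier P. f x = g (\<sigma> x)" if f: "f \<in> Hom R P X" for f
    proof -
      obtain g1 where g1: "g1 \<in> Hom R Q\<^sub>1 X" "\<And>x. x \<in> carrier P\<^sub>1 \<Longrightarrow> compose (carrier P\<^sub>1) f i x = g1 (\<sigma>\<^sub>1 x)"
        using lift1[OF Hom_compose[OF dP(1) f M'(1)]] by blast
      obtain g2 where g2: "g2 \<in> Hom R Q\<^sub>2 X" "\<And>x. x \<in> carrier P\<^sub>2 \<Longrightarrow> compose (carrier P\<^sub>2) f j x = g2 (\<sigma>\<^sub>2 x)"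
        using lift2[OF Hom_compose[OF dP(2) f M'(3)]] by blast
      obtain g where g: "g \<in> Hom R Q X" "\<And>x. x \<in> carrier Q\<^sub>1 \<Longrightarrow> g (s x) = g1 x" "\<And>y. y \<in> carrier Q\<^sub>2 \<Longrightarrow> g (t y) = g2 y"
        by (rule is_biproduct_Hom[OF Q(2) g1(1) g2(1) M'(2,4) Q' X']) (erule that; simp)
      have "f x = g (\<sigma> x)" if x: "x \<in> carrier P" for x
      proof -
        note px = hP(3)[OF x] and qx = hP(4)[OF x]
        have "f (i (p x)) = g (\<sigma> (i (p x)))"
          using g1(2)[OF px] px by (simp add: compose_eq \<sigma>i g Hom_closed[OF \<sigma>\<^sub>1])
        moreover have "f (j (q x)) = g (\<sigma> (j (q x)))"
          using g2(2)[OF qx] qx by (simp add: compose_eq \<sigma>j g Hom_closed[OF \<sigma>\<^sub>2])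
        ultimately have "f (i (p x) \<oplus>\<^bsub>P\<^esub> j (q x)) = g (\<sigma> (i (p x) \<oplus>\<^bsub>P\<^esub> j (q x)))"
          using hP(1)[OF px] hP(2)[OF qx] by (simp add: Hom_add[OF f] Hom_add[OF g(1)] Hom_add[OF \<sigma>(1)] Hom_closed[OF \<sigma>(1)])
        then show ?thesis using dP(9)[OF x] by simp
      qed
      then show ?thesis using g(1) by blast
    qed
    then show "X \<in> D_class R (P, \<sigma>, Q)" using XM unfolding D by blast
  qed
  moreover have "(P, \<sigma>, Q) \<in> proj_maps R"
    using projective_biproduct[OF P(2,1) proj(1,3)] projective_biproduct[OF Q(2,1) proj(2,4)] \<sigma>(1)
    by (simp add: proj_maps_def)
  ultimately show thesis using that ex by blast
qed

text \<open>
Three inclusions close up: \<open>\<T> \<subseteq> D\<^sub>\<rho>\<close> is part of the hypothesis on \<open>\<rho>\<close>. For \<open>D\<^sub>\<rho> \<subseteq> Gen T\<close>, every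
element of a module \<open>X\<close> in \<open>D\<^sub>\<rho>\<close> is the image of the basis element under some \<open>F \<rightarrow> X\<close>, whose
restriction to \<open>L\<^sub>1\<close> extends along \<open>\<rho>\<close>; by the pushout property it factors through \<open>M\<close>, a direct
summand of \<open>T\<close>. Finally \<open>Gen T \<subseteq> \<T>\<close>, since \<open>M\<close> lies in \<open>\<T>\<close>, hence so do its
quotient \<open>K\<close> and the extension \<open>T\<close> of \<open>K\<close> by \<open>M\<close>.

A presentation of \<open>T\<close> with the same class is the direct sum of \<open>(\<rho>, \<delta>)\<close>, which presents \<open>M\<close>, and
\<open>\<rho>\<close>, which presents \<open>K\<close>; its class is the intersection of \<open>D\<^sub>\<rho>\<close> with a class containing it.
\<close>

lemma pushout_preenvelope_silting:
  fixes L\<^sub>1 L\<^sub>0 F M K T :: "('r, 'u) module"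
  assumes univ: "is_universe TYPE('u)" and R: "ring R" and \<T>: "torsion_class R \<T>" and F: "free_on R F e"
    and pre: "preenvelope R \<T> F \<epsilon> M"
    and diag: "pushout_diagram R \<T> L\<^sub>1 \<rho> L\<^sub>0 l \<delta> \<beta> F \<epsilon> M \<kappa> K"
    and TM: "T \<in> Mods R" and T: "is_biproduct R M K T i j p q"
  shows "\<T> = D_class R (L\<^sub>1, \<rho>, L\<^sub>0) \<and> silting R T \<and> \<T> = Gen R T"
proof -
  have ex: "right_exact R F \<epsilon> M \<kappa> K" and row: "right_exact R L\<^sub>1 \<rho> L\<^sub>0 l K"
    and po: "is_pushout R L\<^sub>1 F L\<^sub>0 M \<delta> \<rho> \<epsilon> \<beta>"
    and box: "(L\<^sub>1, \<rho>, L\<^sub>0) \<in> box_class R \<T>" and MM: "M \<in> Mods R" and KM: "K \<in> Mods R"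
    using diag by (simp_all add: pushout_diagram_def)
  have proj: "projective R L\<^sub>1" "projective R L\<^sub>0" and \<rho>: "\<rho> \<in> Hom R L\<^sub>1 L\<^sub>0" and sub: "\<T> \<subseteq> D_class R (L\<^sub>1, \<rho>, L\<^sub>0)"
    and L1M: "L\<^sub>1 \<in> Mods R"
    using box by (auto simp: box_class_def proj_maps_def projective_def)
  note M' = Mods_right_module[OF MM] and K' = Mods_right_module[OF KM] and T' = Mods_right_module[OF TM]
    and L1' = Mods_right_module[OF L1M]
  have \<epsilon>: "\<epsilon> \<in> Hom R F M" and \<delta>: "\<delta> \<in> Hom R L\<^sub>1 F"
    using po by (simp_all add: is_pushout_def)
  note d = is_biproductD[OF T]
  have e: "e \<in> carrier F" using F by (simp add: free_on_def)
  interpret T: right_module R T by (rule T')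
  have M\<T>: "M \<in> \<T>" using pre by (simp add: preenvelope_def)
  have K\<T>: "K \<in> \<T>" by (rule torsion_classD(2)[OF \<T> M\<T> KM right_exactD(2)[OF ex]])
  have "short_exact R M i T q K"
    unfolding short_exact_def
  proof (intro conjI right_exactI d(1,4))
    show "inj_on i (carrier M)" by (rule inj_on_inverseI[of _ p]) (rule d(5))
    show "\<exists>t\<in>carrier T. y = q t" if "y \<in> carrier K" for y
      using d(8)[OF that] Hom_closed[OF d(2) that] by metis
    show "q (i x) = \<zero>\<^bsub>K\<^esub>" if "x \<in> carrier M" for x by (rule d(6)[OF that])
    show "\<exists>x\<in>carrier M. t = i x" if t: "t \<in> carrier T" "q t = \<zero>\<^bsub>K\<^esub>" for t
    proof (rule bexI[of _ "p t"])
      show "t = i (p t)"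
        using d(9)[OF t(1)] t Hom_closed[OF d(1) Hom_closed[OF d(3) t(1)]] by (simp add: Hom_zero[OF d(2) K' T'])
    qed (rule Hom_closed[OF d(3) t(1)])
  qed
  then have T\<T>: "T \<in> \<T>" by (rule torsion_classD(4)[OF \<T> M\<T> K\<T> TM])
  have Gen_sub: "Gen R T \<subseteq> \<T>" by (rule Gen_subset_torsion_class[OF univ R \<T> T\<T>])
  have D_sub: "D_class R (L\<^sub>1, \<rho>, L\<^sub>0) \<subseteq> Gen R T"
  proof
    fix X assume X: "X \<in> D_class R (L\<^sub>1, \<rho>, L\<^sub>0)"
    then have XM: "X \<in> Mods R" unfolding D_class_iff[OF L1' \<rho>] by blast
    show "X \<in> Gen R T"
    proof (rule Gen_trace[OF univ XM TM])
      fix N assume N: "right_submodule R X N" and TN: "\<And>f. f \<in> Hom R T X \<Longrightarrow> f ` carrier T \<subseteq> N"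
      have "x \<in> N" if x: "x \<in> carrier X" for x
      proof -
        obtain g where g: "g \<in> Hom R F X" "g e = x" using F XM x unfolding free_on_def by meson
        obtain k where k: "k \<in> Hom R L\<^sub>0 X" "\<forall>z\<in>carrier L\<^sub>1. compose (carrier L\<^sub>1) g \<delta> z = k (\<rho> z)"
          using X Hom_compose[OF \<delta> g(1) L1'] unfolding D_class_iff[OF L1' \<rho>] by blast
        have "compose (carrier L\<^sub>1) g \<delta> = compose (carrier L\<^sub>1) k \<rho>"
          by (rule Hom_eqI[OF Hom_compose[OF \<delta> g(1) L1'] Hom_compose[OF \<rho> k(1) L1']])
            (use k(2) in \<open>simp add: compose_eq\<close>)
        then obtain h where h: "h \<in> Hom R M X" "compose (carrier F) h \<epsilon> = g"
          using po XM g(1) k(1) unfolding is_pushout_def by meson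
        have "x = h (\<epsilon> e)" using h(2) g(2) e by (metis compose_eq)
        then have "x = compose (carrier T) h p (i (\<epsilon> e))"
          using Hom_closed[OF \<epsilon> e] Hom_closed[OF d(1)] by (simp add: compose_eq d(5))
        then show "x \<in> N"
          using TN[OF Hom_compose[OF d(3) h(1) T']] Hom_closed[OF d(1) Hom_closed[OF \<epsilon> e]] by blast
      qed
      then show "N = carrier X" using N by (auto simp: right_submodule_def)
    qed
  qed
  have eqs: "\<T> = D_class R (L\<^sub>1, \<rho>, L\<^sub>0)" "\<T> = Gen R T" using sub D_sub Gen_sub by blast+
  obtain Q :: "('r, 'u) module" and \<sigma> \<pi> where Q: "projective R Q" "right_exact R L\<^sub>1 \<sigma> Q \<pi> M"
      "D_class R (L\<^sub>1, \<rho>, L\<^sub>0) \<subseteq> D_class R (L\<^sub>1, \<sigma>, Q)"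
    by (rule pushout_presentation[OF univ free_on_projective[OF F] diag])
  obtain P' \<sigma>' Q' \<pi>' where S: "(P', \<sigma>', Q') \<in> proj_maps R" "right_exact R P' \<sigma>' Q' \<pi>' T"
      "D_class R (P', \<sigma>', Q') = D_class R (L\<^sub>1, \<sigma>, Q) \<inter> D_class R (L\<^sub>1, \<rho>, L\<^sub>0)"
    by (rule biproduct_presentation[OF univ proj(1) Q(1) proj Q(2) row M' K' T' T])
  have "D_class R (P', \<sigma>', Q') = \<T>" using S(3) Q(3) eqs(1) by blast
  then have "silting R T" unfolding silting_def using TM S(1,2) \<T> T\<T> eqs(2) by metis
  then show ?thesis using eqs by blast
qed
section \<open>The characterisation of silting classes\<close>

theorem proposition2p1:
  fixes R :: "('r, 'm) ring_scheme"
    and \<T> :: "('r, 'u) module set"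
  assumes "ring R"
    and "is_universe TYPE('u)"
    and "carrier R \<prec> (UNIV :: 'u set)"
    and "\<T> \<subseteq> Mods R"
  shows
    "((\<exists>T. silting R T \<and> \<T> = Gen R T)
      \<longleftrightarrow>
      torsion_class R \<T> \<and>
      (\<exists>\<epsilon> M. preenvelope R \<T> (regular_module R) \<epsilon> M \<and>
         (\<exists>L\<^sub>1 \<rho> L\<^sub>0 l \<delta> \<beta> \<kappa> K.
            pushout_diagram R \<T> L\<^sub>1 \<rho> L\<^sub>0 l \<delta> \<beta> (regular_module R) \<epsilon> M \<kappa> K)))
     \<and>
     ((\<exists>T. silting R T \<and> \<T> = Gen R T)
      \<longleftrightarrow>
      torsion_class R \<T> \<and>
      (\<forall>X \<in> (Mods R :: ('r, 'u) module set).
         \<exists>\<epsilon> T\<^sub>0. preenvelope R \<T> X \<epsilon> T\<^sub>0 \<and>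
           (\<exists>L\<^sub>1 \<rho> L\<^sub>0 l \<delta> \<beta> \<kappa> T\<^sub>1.
              pushout_diagram R \<T> L\<^sub>1 \<rho> L\<^sub>0 l \<delta> \<beta> X \<epsilon> T\<^sub>0 \<kappa> T\<^sub>1)))
     \<and>
     (\<forall>\<epsilon> M L\<^sub>1 \<rho> L\<^sub>0 l \<delta> \<beta> \<kappa> K.
        torsion_class R \<T> \<and>
        preenvelope R \<T> (regular_module R) \<epsilon> M \<and>
        pushout_diagram R \<T> L\<^sub>1 \<rho> L\<^sub>0 l \<delta> \<beta> (regular_module R) \<epsilon> M \<kappa> K
        \<longrightarrow>
        \<T> = D_class R (L\<^sub>1, \<rho>, L\<^sub>0) \<and>
        (\<exists>T \<in> (Mods R :: ('r, 'u) module set). isomorphic R (direct_sum2 M K) T) \<and>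
        (\<forall>T \<in> (Mods R :: ('r, 'u) module set). isomorphic R (direct_sum2 M K) T \<longrightarrow>
           silting R T \<and> \<T> = Gen R T))"
proof -
  note R = assms(1) and univ = assms(2)
  note rm = regular_module_right_module[OF R]
  have "carrier (regular_module R) \<prec> (UNIV :: 'u set)" using assms(3) by (simp add: regular_module_simps)
  then obtain F :: "('r, 'u) module" and \<phi> where F: "F \<in> Mods R" and \<phi>: "\<phi> \<in> Hom R (regular_module R) F"
      and bij: "bij_betw \<phi> (carrier (regular_module R)) (carrier F)"
    by (rule copy_exists[OF rm])
  note F' = Mods_right_module[OF F]
  have free: "free_on R F (\<phi> \<one>\<^bsub>R\<^esub>)"
    using regular_module_copy_free_on[OF R F \<phi>] bij by (simp add: regular_module_simps)
  obtain \<psi> where \<psi>: "\<psi> \<in> Hom R F (regular_module R)" and \<psi>\<phi>: "\<And>x. x \<in> carrier (regular_module R) \<Longrightarrow> \<psi> (\<phi> x) = x"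
      and \<phi>\<psi>: "\<And>y. y \<in> carrier F \<Longrightarrow> \<phi> (\<psi> y) = y"
    by (rule Hom_inverse[OF \<phi> rm F' bij]) (erule that; simp)

  have moreover_part: "\<T> = D_class R (L\<^sub>1, \<rho>, L\<^sub>0) \<and>
      (\<exists>T \<in> (Mods R :: ('r, 'u) module set). isomorphic R (direct_sum2 M K) T) \<and>
      (\<forall>T \<in> (Mods R :: ('r, 'u) module set). isomorphic R (direct_sum2 M K) T \<longrightarrow> silting R T \<and> \<T> = Gen R T)"
    if tor: "torsion_class R \<T>" and pre: "preenvelope R \<T> (regular_module R) \<epsilon> M"
      and diag: "pushout_diagram R \<T> L\<^sub>1 \<rho> L\<^sub>0 l \<delta> \<beta> (regular_module R) \<epsilon> M \<kappa> K"
    for \<epsilon> M L\<^sub>1 \<rho> L\<^sub>0 l \<delta> \<beta> \<kappa> K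
  proof -
    have M: "M \<in> Mods R" and K: "K \<in> Mods R" using diag by (simp_all add: pushout_diagram_def)
    note pre' = preenvelope_transport[OF rm F' \<phi> \<psi> \<psi>\<phi> \<phi>\<psi> pre]
    note diag' = pushout_diagram_transport[OF rm F' \<phi> \<psi> \<psi>\<phi> \<phi>\<psi> diag]
    have all: "\<T> = D_class R (L\<^sub>1, \<rho>, L\<^sub>0) \<and> silting R T \<and> \<T> = Gen R T"
      if T: "T \<in> Mods R" "isomorphic R (direct_sum2 M K) T" for T
    proof -
      obtain i j p q where "is_biproduct R M K T i j p q"
        by (rule isomorphic_direct_sum2_is_biproduct[OF T(2) M[THEN Mods_right_module] K[THEN Mods_right_module]
              T(1)[THEN Mods_right_module]])
      from pushout_preenvelope_silting[OF univ R tor free pre' diag' T(1) this] show ?thesis .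
    qed
    obtain T :: "('r, 'u) module" where "T \<in> Mods R" "isomorphic R (direct_sum2 M K) T"
      by (rule direct_sum2_copy_exists[OF univ M K])
    then show ?thesis using all by blast
  qed

  let ?silt = "\<exists>T. silting R T \<and> \<T> = Gen R T"
  let ?env = "\<lambda>X :: ('r, 'u) module. \<exists>\<epsilon> T\<^sub>0. preenvelope R \<T> X \<epsilon> T\<^sub>0 \<and>
           (\<exists>L\<^sub>1 \<rho> L\<^sub>0 l \<delta> \<beta> \<kappa> T\<^sub>1. pushout_diagram R \<T> L\<^sub>1 \<rho> L\<^sub>0 l \<delta> \<beta> X \<epsilon> T\<^sub>0 \<kappa> T\<^sub>1)"
  let ?env_R = "\<exists>\<epsilon> M. preenvelope R \<T> (regular_module R) \<epsilon> M \<and>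
         (\<exists>L\<^sub>1 \<rho> L\<^sub>0 l \<delta> \<beta> \<kappa> K. pushout_diagram R \<T> L\<^sub>1 \<rho> L\<^sub>0 l \<delta> \<beta> (regular_module R) \<epsilon> M \<kappa> K)"

  have silt_env: "torsion_class R \<T> \<and> (\<forall>X\<in>Mods R. ?env X)" if silt: ?silt
  proof -
    obtain T where T: "silting R T" "\<T> = Gen R T" using silt by blast
    obtain P \<sigma> Q \<pi> where "(P, \<sigma>, Q) \<in> proj_maps R" "right_exact R P \<sigma> Q \<pi> T"
        "torsion_class R (D_class R (P, \<sigma>, Q))" "D_class R (P, \<sigma>, Q) = Gen R T" "T \<in> Mods R"
      using T(1) unfolding silting_def by blast
    then show ?thesis
      unfolding T(2) using silting_pushout_preenvelope[OF univ R] by metis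
  qed
  have env_R: ?env_R if env: "\<forall>X\<in>Mods R. ?env X"
  proof -
    obtain \<epsilon> M L\<^sub>1 \<rho> L\<^sub>0 l \<delta> \<beta> \<kappa> K where "preenvelope R \<T> F \<epsilon> M" "pushout_diagram R \<T> L\<^sub>1 \<rho> L\<^sub>0 l \<delta> \<beta> F \<epsilon> M \<kappa> K"
      using bspec[OF env F] by (elim exE conjE) (erule (1) that)
    from preenvelope_transport[OF F' rm \<psi> \<phi> \<phi>\<psi> \<psi>\<phi> this(1)] pushout_diagram_transport[OF F' rm \<psi> \<phi> \<phi>\<psi> \<psi>\<phi> this(2)]
    show ?thesis by blast
  qed
  have env_R_silt: ?silt if tor: "torsion_class R \<T>" and env: ?env_R
  proof -
    obtain \<epsilon> M L\<^sub>1 \<rho> L\<^sub>0 l \<delta> \<beta> \<kappa> K where "preenvelope R \<T> (regular_module R) \<epsilon> M"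
        "pushout_diagram R \<T> L\<^sub>1 \<rho> L\<^sub>0 l \<delta> \<beta> (regular_module R) \<epsilon> M \<kappa> K"
      using env by blast
    from moreover_part[OF tor this] show ?thesis by blast
  qed
  show ?thesis
  proof (intro conjI)
    show "?silt \<longleftrightarrow> torsion_class R \<T> \<and> ?env_R"
      using silt_env env_R env_R_silt by argo
    show "?silt \<longleftrightarrow> torsion_class R \<T> \<and> (\<forall>X\<in>Mods R. ?env X)"
      using silt_env env_R env_R_silt by argo
  qed (use moreover_part in blast)
qed

end
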